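(* Let $d\ge 3$ and let $E\subset\mathbb R^d$ be compact with $\dim_{\mathcal H}(E)>d-1+\frac1d$. Then for every $x^0\in\mathbb R^d$, the set $$V_d^{x^0}(E):=\left\{\left|\det\left[x^1-x^0,\,x^2-x^0,\dots,x^d-x^0\right]\right| : x^1,\dots,x^d\in E\right\}$$ has nonempty interior in $\mathbb R$.
   Context: $\dim_{\mathcal H}$ denotes Hausdorff dimension; $\det[v_1,\dots,v_d]$ is the determinant of the $d\times d$ matrix with columns $v_1,\dots,v_d$. *)

theory Defs
  imports "HOL-Analysis.Analysis"
begin

definition hausdorff_premeasure :: "real \<Rightarrow> real \<Rightarrow> 'a::metric_space set \<Rightarrow> ennreal" where
  "hausdorff_premeasure s \<delta> A =
     (INF U \<in> {U :: nat \<Rightarrow> 'a set. A \<subseteq> (\<Union>i. U i) \<and> (\<forall>i. bounded (U i) \<and> diameter (U i) \<le> \<delta>)}.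
        (\<Sum>i. ennreal (diameter (U i) powr s)))"

definition hausdorff_measure :: "real \<Rightarrow> 'a::metric_space set \<Rightarrow> ennreal" where
  "hausdorff_measure s A = (SUP \<delta> \<in> {0<..}. hausdorff_premeasure s \<delta> A)"

definition hausdorff_dim :: "'a::metric_space set \<Rightarrow> real" where
  "hausdorff_dim A = Inf {s. s > 0 \<and> hausdorff_measure s A = 0}"

end

theory Submission
  imports Defs "HOL-Probability.Characteristic_Functions" "HOL-Real_Asymp.Real_Asymp"
begin

text \<open>
  Translate so that x0 = 0, and fix s between d - 1 + 1/d and the dimension of E. Write the
  determinant as v \<open>\<bullet>\<close> y, where y is one column and v is the cofactor vector of the other d - 1.
  If y is distributed according to a Frostman measure of exponent s, and the d - 1 other columns
  independently so, then v satisfies a Frostman condition of exponent a = (d - 1)(s - d + 1) + 1, and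
  a + s > d + 1 is exactly the hypothesis on s. Under this condition the density of v \<open>\<bullet>\<close> y at t is a
  Fourier integral whose dyadic frequency shell of size L contributes O(L^(-(s + a - d - 1)/2)),
  uniformly for t in a compact subset of the positive half line. Hence the density is continuous in t,
  and it is positive on some interval. All measures are replaced by finitely supported weights that are
  Frostman down to scale 2^(-n); the interval obtained has length bounded below independently of n,
  and compactness of E gives the limit.
\<close>

subsection \<open>Gaussian averages of exponential sums\<close>

text \<open>The shell estimate charges each unit ball of frequency space with the pairs (l, v) whose
  frequency falls into it. Among the frequencies l v in R^d a ball does not determine l when the
  length of v is free, and a whole power of L would be lost. Dilating the equation v \<bullet> y = t
  cures this: the frequencies become (l v, - l t), whose last coordinate fixes l up to O(1/t), while
  the energy of the cone points keeps its order because the dimension and the Frostman exponent both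
  rise by one. This is why t stays in an interval [t0, t1] with t0 > 0.

  The Frostman bound for v is uniform only if the columns stay uniformly independent. They are
  therefore confined to small balls around a tuple of nonzero determinant, in each of which E keeps
  positive content; such a tuple exists because s > d - 1 forbids concentration near a hyperplane.

  The interval of values found at scale 2^(-n) may move with n. Its length is fixed beforehand, so
  the centres accumulate and an interval survives in the limit.\<close>

lemma borel_measurable_cis [measurable (raw)]:
  assumes "f \<in> borel_measurable M"
  shows "(\<lambda>x. cis (f x)) \<in> borel_measurable M"
  using assms by (intro measurable_compose[OF assms] borel_measurable_continuous_onI continuous_intros)

lemma cmod_cis_diff_le: "cmod (cis x - cis y) \<le> \<bar>x - y\<bar>"
proof -
  have "cis x - cis y = cis y * (cis (x - y) - 1)"
    by (simp add: algebra_simps cis_mult)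
  then have "cmod (cis x - cis y) = cmod (cis (x - y) - 1)" by (simp add: norm_mult)
  also have "\<dots> = dist (cis (x - y)) (cis 0)" by (simp add: dist_norm)
  also have "\<dots> \<le> \<bar>x - y\<bar>"
    using iexp_approx1[of "x - y" 0] by (simp add: dist_norm cis_conv_exp)
  finally show ?thesis .
qed

text \<open>This is the characteristic function of the standard normal distribution, freed of the
  normalising factor of its density.\<close>

lemma gaussian_fourier_std:
  fixes x :: real
  shows "has_bochner_integral lborel (\<lambda>t. cis (t * x) * of_real (exp (- t\<^sup>2 / 2))) (of_real (sqrt (2 * pi) * exp (- x\<^sup>2 / 2)))"
proof -
  have int: "integrable lborel (\<lambda>t. std_normal_density t *\<^sub>R cis (x * t))"
    by (rule Bochner_Integration.integrable_bound[OF integrable_normal_density[of 1 0]])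
       (auto simp: )
  have "(\<integral>t. std_normal_density t *\<^sub>R cis (x * t) \<partial>lborel) = char std_normal_distribution x"
    unfolding char_def
    by (subst integral_density) (auto simp: cis_conv_exp)
  also have "\<dots> = of_real (exp (- x\<^sup>2 / 2))"
    by (simp add: char_std_normal_distribution)
  finally have "has_bochner_integral lborel (\<lambda>t. std_normal_density t *\<^sub>R cis (x * t)) (of_real (exp (- x\<^sup>2 / 2)))"
    using int by (simp add: has_bochner_integral_iff)
  from has_bochner_integral_mult_right[of "of_real (sqrt (2*pi))", OF this]
  have "has_bochner_integral lborel (\<lambda>t. of_real (sqrt (2 * pi)) * (std_normal_density t *\<^sub>R cis (x * t)))
     (of_real (sqrt (2 * pi)) * of_real (exp (- x\<^sup>2 / 2)))" by simp
  also have "(\<lambda>t. of_real (sqrt (2 * pi)) * (std_normal_density t *\<^sub>R cis (x * t))) =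
    (\<lambda>t. cis (t * x) * of_real (exp (- t\<^sup>2 / 2)))"
    by (auto simp: std_normal_density_def scaleR_conv_of_real fun_eq_iff real_sqrt_mult field_simps)
  finally show ?thesis by simp
qed

lemma gaussian_fourier_real:
  fixes x R :: real assumes "R > 0"
  shows "has_bochner_integral lborel (\<lambda>t. cis (t * x) * of_real (exp (- t\<^sup>2 / (2 * R\<^sup>2)))) (of_real (sqrt (2 * pi) * R * exp (- (R\<^sup>2 * x\<^sup>2) / 2)))"
proof -
  have "has_bochner_integral lborel (\<lambda>t. cis (t * (R * x)) * of_real (exp (- t\<^sup>2 / 2))) (of_real (sqrt (2 * pi) * exp (- (R * x)\<^sup>2 / 2)))"
    by (rule gaussian_fourier_std)
  then have "has_bochner_integral lborel (\<lambda>t. cis ((0 + (1/R) * t) * (R * x)) * of_real (exp (- (0 + (1/R) * t)\<^sup>2 / 2))) (of_real (sqrt (2 * pi) * exp (- (R * x)\<^sup>2 / 2)) /\<^sub>R \<bar>1/R\<bar>)"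
    using assms by (subst (asm) lborel_has_bochner_integral_real_affine_iff[of "1/R" _ _ 0]) auto
  then show ?thesis using assms by (simp add: power_divide power_mult_distrib scaleR_conv_of_real mult_ac)
qed

text \<open>Character and Gaussian both factor over \<open>Basis\<close>, so the integral is a
  product of one-dimensional ones. The product measure is taken in the shape in which
  \<open>lborel_def\<close> uses it.\<close>

lemma gaussian_fourier:
  fixes x :: "'a::euclidean_space" and R :: real assumes "R > 0"
  shows "has_bochner_integral lborel (\<lambda>\<zeta>. cis (\<zeta> \<bullet> x) * of_real (exp (- (norm \<zeta>)\<^sup>2 / (2 * R\<^sup>2))))
    (of_real ((sqrt (2 * pi) * R) ^ DIM('a) * exp (- (R\<^sup>2 * (norm x)\<^sup>2) / 2)))"
proof -
  interpret product_sigma_finite "\<lambda>b::'a. interval_measure (\<lambda>x. x)"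
    by (rule product_sigma_finite.intro) (auto simp flip: lborel_eq_real intro: lborel.sigma_finite_measure_axioms)
  define f where "f = (\<lambda>b t. cis (t * (x \<bullet> b)) * complex_of_real (exp (- t\<^sup>2 / (2 * R\<^sup>2))))"
  have f: "has_bochner_integral (interval_measure (\<lambda>x. x)) (f b) (of_real (sqrt (2 * pi) * R * exp (- (R\<^sup>2 * (x \<bullet> b)\<^sup>2) / 2)))" for b
    unfolding f_def lborel_eq_real[symmetric] by (rule gaussian_fourier_real[OF assms])
  have cis_sum: "cis (sum g B) = (\<Prod>b\<in>B. cis (g b))" if "finite B" for g :: "'a \<Rightarrow> real" and B
    using that by induction (auto simp flip: cis_mult)
  have eq: "cis ((\<Sum>b\<in>Basis. g b *\<^sub>R b) \<bullet> x) * of_real (exp (- (norm (\<Sum>b\<in>Basis. g b *\<^sub>R b))\<^sup>2 / (2 * R\<^sup>2)))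
     = (\<Prod>b\<in>Basis. f b (g b))" for g :: "'a \<Rightarrow> real"
  proof -
    have "(norm (\<Sum>b\<in>Basis. g b *\<^sub>R b))\<^sup>2 = (\<Sum>b\<in>Basis. (g b)\<^sup>2)"
      by (subst norm_sum_Pythagorean) (auto simp: pairwise_def orthogonal_def inner_Basis)
    moreover have "(\<Sum>b\<in>Basis. g b *\<^sub>R b) \<bullet> x = (\<Sum>b\<in>Basis. g b * (x \<bullet> b))"
      by (simp add: inner_sum_left inner_commute[of x])
    ultimately show ?thesis
      by (simp add: f_def prod.distrib cis_sum sum_divide_distrib exp_sum flip: sum_negf of_real_prod)
  qed
  have "has_bochner_integral (\<Pi>\<^sub>M b\<in>(Basis::'a set). interval_measure (\<lambda>x. x)) (\<lambda>g. \<Prod>b\<in>Basis. f b (g b))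
     (\<Prod>b\<in>Basis. of_real (sqrt (2 * pi) * R * exp (- (R\<^sup>2 * (x \<bullet> b)\<^sup>2) / 2)))"
  proof -
    have "integral\<^sup>L (interval_measure (\<lambda>x. x)) (f b) = of_real (sqrt (2 * pi) * R * exp (- (R\<^sup>2 * (x \<bullet> b)\<^sup>2) / 2))" for b
      using f by (simp add: has_bochner_integral_iff)
    moreover have "integrable (interval_measure (\<lambda>x. x)) (f b)" for b
      using f by (simp add: has_bochner_integral_iff)
    ultimately show ?thesis
      unfolding has_bochner_integral_iff
      by (auto intro!: product_integrable_prod simp: product_integral_prod)
  qed
  also have "(\<Prod>b\<in>Basis. of_real (sqrt (2 * pi) * R * exp (- (R\<^sup>2 * (x \<bullet> b)\<^sup>2) / 2)))
    = complex_of_real ((sqrt (2 * pi) * R) ^ DIM('a) * exp (- (R\<^sup>2 * (norm x)\<^sup>2) / 2))"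
  proof -
    have "(norm x)\<^sup>2 = (\<Sum>b\<in>Basis. (x \<bullet> b)\<^sup>2)"
      unfolding power2_norm_eq_inner by (subst euclidean_inner) (simp add: power2_eq_square)
    then show ?thesis
      by (simp add: prod.distrib sum_distrib_left sum_divide_distrib exp_sum flip: sum_negf of_real_prod)
  qed
  finally have "has_bochner_integral (\<Pi>\<^sub>M b\<in>(Basis::'a set). interval_measure (\<lambda>x. x))
      (\<lambda>g. cis ((\<Sum>b\<in>Basis. g b *\<^sub>R b) \<bullet> x) * of_real (exp (- (norm (\<Sum>b\<in>Basis. g b *\<^sub>R b))\<^sup>2 / (2 * R\<^sup>2))))
      (of_real ((sqrt (2 * pi) * R) ^ DIM('a) * exp (- (R\<^sup>2 * (norm x)\<^sup>2) / 2)))"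
    unfolding eq .
  moreover have "(\<lambda>g. \<Sum>b\<in>Basis. g b *\<^sub>R b) \<in> measurable (\<Pi>\<^sub>M b\<in>(Basis::'a set). interval_measure (\<lambda>x. x)) borel"
    by auto
  ultimately show ?thesis
    unfolding lborel_def by (intro has_bochner_integral_distr) auto
qed

lemma gaussian_fourier_shift:
  fixes x \<xi> :: "'a::euclidean_space"
  shows "has_bochner_integral lborel (\<lambda>\<zeta>. cis (\<zeta> \<bullet> x) * of_real (exp (- (norm (\<zeta> - \<xi>))\<^sup>2 / 2)))
    (of_real (sqrt (2 * pi) ^ DIM('a) * exp (- (norm x)\<^sup>2 / 2)) * cis (\<xi> \<bullet> x))"
proof -
  have "has_bochner_integral (distr lborel borel ((+) \<xi>)) (\<lambda>\<zeta>. cis ((\<zeta> - \<xi>) \<bullet> x) * of_real (exp (- (norm (\<zeta> - \<xi>))\<^sup>2 / 2)))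
      (of_real (sqrt (2 * pi) ^ DIM('a) * exp (- (norm x)\<^sup>2 / 2)))"
    using gaussian_fourier[of 1 x] by (intro has_bochner_integral_distr) auto
  from has_bochner_integral_mult_right[of "cis (\<xi> \<bullet> x)", OF this]
  have "has_bochner_integral lborel (\<lambda>\<zeta>. (cis (\<xi> \<bullet> x) * cis ((\<zeta> - \<xi>) \<bullet> x)) * of_real (exp (- (norm (\<zeta> - \<xi>))\<^sup>2 / 2)))
      (cis (\<xi> \<bullet> x) * of_real (sqrt (2 * pi) ^ DIM('a) * exp (- (norm x)\<^sup>2 / 2)))"
    unfolding lborel_distr_plus mult.assoc .
  then show ?thesis
    unfolding cis_mult by (simp add: inner_diff_left mult.commute)
qed

text \<open>Expanding the square leaves the characters at \<open>Y i - Y j\<close>, each integrated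
  by the Gaussian formula. The double sum sees pairs at distance about 1/R, so L2 mass at
  frequencies up to R is governed by the concentration of the weights at scale 1/R.\<close>

lemma energy_identity:
  fixes Y :: "'i \<Rightarrow> 'a::euclidean_space" and c :: "'i \<Rightarrow> real"
  assumes "finite I" "R > 0"
  shows "has_bochner_integral lborel (\<lambda>\<zeta>. (cmod (\<Sum>i\<in>I. of_real (c i) * cis (\<zeta> \<bullet> Y i)))\<^sup>2 * exp (- (norm \<zeta>)\<^sup>2 / (2 * R\<^sup>2)))
    ((sqrt (2 * pi) * R) ^ DIM('a) * (\<Sum>i\<in>I. \<Sum>j\<in>I. c i * c j * exp (- (R\<^sup>2 * (norm (Y i - Y j))\<^sup>2) / 2)))"
proof -
  let ?g = "\<lambda>\<zeta>::'a. exp (- (norm \<zeta>)\<^sup>2 / (2 * R\<^sup>2))"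
  have "has_bochner_integral lborel (\<lambda>\<zeta>. \<Sum>i\<in>I. \<Sum>j\<in>I. complex_of_real (c i * c j) * (cis (\<zeta> \<bullet> (Y i - Y j)) * of_real (?g \<zeta>)))
     (\<Sum>i\<in>I. \<Sum>j\<in>I. complex_of_real (c i * c j) * of_real ((sqrt (2 * pi) * R) ^ DIM('a) * exp (- (R\<^sup>2 * (norm (Y i - Y j))\<^sup>2) / 2)))"
    by (intro has_bochner_integral_sum has_bochner_integral_mult_right gaussian_fourier assms)
  from has_bochner_integral_bounded_linear[OF bounded_linear_Re this]
  have *: "has_bochner_integral lborel (\<lambda>\<zeta>. Re (\<Sum>i\<in>I. \<Sum>j\<in>I. complex_of_real (c i * c j) * (cis (\<zeta> \<bullet> (Y i - Y j)) * of_real (?g \<zeta>))))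
     (\<Sum>i\<in>I. \<Sum>j\<in>I. c i * c j * ((sqrt (2 * pi) * R) ^ DIM('a) * exp (- (R\<^sup>2 * (norm (Y i - Y j))\<^sup>2) / 2)))"
    by simp
  have "(cmod (\<Sum>i\<in>I. of_real (c i) * cis (\<zeta> \<bullet> Y i)))\<^sup>2 * ?g \<zeta> =
     Re (\<Sum>i\<in>I. \<Sum>j\<in>I. complex_of_real (c i * c j) * (cis (\<zeta> \<bullet> (Y i - Y j)) * of_real (?g \<zeta>)))" for \<zeta>
  proof -
    have "complex_of_real ((cmod (\<Sum>i\<in>I. of_real (c i) * cis (\<zeta> \<bullet> Y i)))\<^sup>2) =
      (\<Sum>i\<in>I. \<Sum>j\<in>I. complex_of_real (c i * c j) * cis (\<zeta> \<bullet> (Y i - Y j)))"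
      unfolding complex_norm_square cnj_sum sum_product
      by (intro sum.cong refl) (simp add: cis_cnj mult_ac inner_diff_right flip: cis_divide[unfolded divide_inverse cis_inverse])
    then have "complex_of_real ((cmod (\<Sum>i\<in>I. of_real (c i) * cis (\<zeta> \<bullet> Y i)))\<^sup>2 * ?g \<zeta>) =
      (\<Sum>i\<in>I. \<Sum>j\<in>I. complex_of_real (c i * c j) * (cis (\<zeta> \<bullet> (Y i - Y j)) * of_real (?g \<zeta>)))"
      by (simp add: sum_distrib_right mult.assoc)
    then show ?thesis by (metis Re_complex_of_real)
  qed
  with * show ?thesis
    by (simp add: sum_distrib_left mult_ac)
qed

text \<open>
  The weights exp(|Y i|^2 / 2) cancel the factors exp(-|Y i|^2 / 2) produced by averaging the
  characters against a Gaussian, so the exponential sum at \<open>\<xi>\<close> is itself a Gaussian average of the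
  reweighted sum and Jensen's inequality applies.
\<close>

lemma norm_exp_sum_le_gaussian_average:
  fixes Y :: "'i \<Rightarrow> 'a::euclidean_space" and c :: "'i \<Rightarrow> real"
  assumes "finite I"
  shows "ennreal (sqrt (2 * pi) ^ DIM('a) * (cmod (\<Sum>i\<in>I. of_real (c i) * cis (\<xi> \<bullet> Y i)))\<^sup>2) \<le>
   (\<integral>\<^sup>+\<zeta>. ennreal ((cmod (\<Sum>i\<in>I. of_real (c i * exp ((norm (Y i))\<^sup>2 / 2)) * cis (\<zeta> \<bullet> Y i)))\<^sup>2 * exp (- (norm (\<zeta> - \<xi>))\<^sup>2 / 2)) \<partial>lborel)"
proof -
  define k where "k = sqrt (2 * pi) ^ DIM('a)"
  define a where "a = (\<Sum>i\<in>I. of_real (c i) * cis (\<xi> \<bullet> Y i))"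
  define f where "f = (\<lambda>\<zeta>. \<Sum>i\<in>I. complex_of_real (c i * exp ((norm (Y i))\<^sup>2 / 2)) * cis (\<zeta> \<bullet> Y i))"
  define g where "g = (\<lambda>\<zeta>. exp (- (norm (\<zeta> - \<xi>))\<^sup>2 / 2))"
  have g: "has_bochner_integral lborel g k"
    using has_bochner_integral_bounded_linear[OF bounded_linear_Re gaussian_fourier_shift[of 0 \<xi>]]
    by (simp add: g_def k_def)
  have "has_bochner_integral lborel (\<lambda>\<zeta>. \<Sum>i\<in>I. complex_of_real (c i * exp ((norm (Y i))\<^sup>2 / 2)) * (cis (\<zeta> \<bullet> Y i) * of_real (g \<zeta>)))
     (\<Sum>i\<in>I. complex_of_real (c i * exp ((norm (Y i))\<^sup>2 / 2)) * (of_real (k * exp (- (norm (Y i))\<^sup>2 / 2)) * cis (\<xi> \<bullet> Y i)))"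
    unfolding g_def k_def
    by (intro has_bochner_integral_sum has_bochner_integral_mult_right gaussian_fourier_shift)
  also have "(\<Sum>i\<in>I. complex_of_real (c i * exp ((norm (Y i))\<^sup>2 / 2)) * (of_real (k * exp (- (norm (Y i))\<^sup>2 / 2)) * cis (\<xi> \<bullet> Y i))) = of_real k * a"
    unfolding a_def sum_distrib_left
    by (intro sum.cong refl) (simp add: exp_minus field_simps flip: of_real_mult)
  also have "(\<lambda>\<zeta>. \<Sum>i\<in>I. complex_of_real (c i * exp ((norm (Y i))\<^sup>2 / 2)) * (cis (\<zeta> \<bullet> Y i) * of_real (g \<zeta>))) = (\<lambda>\<zeta>. f \<zeta> * of_real (g \<zeta>))"
    by (simp add: f_def sum_distrib_right mult.assoc)
  finally have fg: "has_bochner_integral lborel (\<lambda>\<zeta>. f \<zeta> * of_real (g \<zeta>)) (of_real k * a)" .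
  \<comment> \<open>Jensen in variance form: |f - a|^2 \<ge> 0 is integrated against
    \<open>g\<close>, which has total mass \<open>k\<close> and for which \<open>f\<close> has mean
    \<open>a\<close>.\<close>
  have 1: "has_bochner_integral lborel (\<lambda>\<zeta>. 2 * Re (cnj a * (f \<zeta> * of_real (g \<zeta>))) - (cmod a)\<^sup>2 * g \<zeta>)
     (2 * Re (cnj a * (of_real k * a)) - (cmod a)\<^sup>2 * k)"
    by (intro has_bochner_integral_diff has_bochner_integral_mult_right has_bochner_integral_bounded_linear[OF bounded_linear_Re] fg g)
  have v: "2 * Re (cnj a * (of_real k * a)) - (cmod a)\<^sup>2 * k = k * (cmod a)\<^sup>2"
    unfolding cmod_power2 by (simp add: algebra_simps power2_eq_square)
  have le: "2 * Re (cnj a * (f \<zeta> * of_real (g \<zeta>))) - (cmod a)\<^sup>2 * g \<zeta> \<le> (cmod (f \<zeta>))\<^sup>2 * g \<zeta>" for \<zeta>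
  proof -
    have "0 \<le> (Re (f \<zeta>) - Re a)\<^sup>2 + (Im (f \<zeta>) - Im a)\<^sup>2" by simp
    then have "2 * Re (cnj a * f \<zeta>) - (cmod a)\<^sup>2 \<le> (cmod (f \<zeta>))\<^sup>2"
      unfolding cmod_power2 by (simp add: algebra_simps power2_eq_square)
    then have "(2 * Re (cnj a * f \<zeta>) - (cmod a)\<^sup>2) * g \<zeta> \<le> (cmod (f \<zeta>))\<^sup>2 * g \<zeta>"
      by (intro mult_right_mono) (auto simp: g_def)
    then show ?thesis by (simp add: algebra_simps)
  qed
  have bd: "cmod (f \<zeta>) \<le> (\<Sum>i\<in>I. \<bar>c i * exp ((norm (Y i))\<^sup>2 / 2)\<bar>)" for \<zeta>
    unfolding f_def by (intro order_trans[OF norm_sum] sum_mono) (simp add: norm_mult del: of_real_mult)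
  have int: "integrable lborel (\<lambda>\<zeta>. (cmod (f \<zeta>))\<^sup>2 * g \<zeta>)"
  proof (rule Bochner_Integration.integrable_bound)
    show "integrable lborel (\<lambda>\<zeta>. (\<Sum>i\<in>I. \<bar>c i * exp ((norm (Y i))\<^sup>2 / 2)\<bar>)\<^sup>2 * g \<zeta>)"
      using g by (intro integrable_mult_right) (auto simp: has_bochner_integral_iff)
    show "AE \<zeta> in lborel. norm ((cmod (f \<zeta>))\<^sup>2 * g \<zeta>) \<le> norm ((\<Sum>i\<in>I. \<bar>c i * exp ((norm (Y i))\<^sup>2 / 2)\<bar>)\<^sup>2 * g \<zeta>)"
    proof (intro AE_I2)
      fix \<zeta>
      have "(cmod (f \<zeta>))\<^sup>2 \<le> (\<Sum>i\<in>I. \<bar>c i * exp ((norm (Y i))\<^sup>2 / 2)\<bar>)\<^sup>2"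
        by (intro power_mono bd norm_ge_zero)
      then show "norm ((cmod (f \<zeta>))\<^sup>2 * g \<zeta>) \<le> norm ((\<Sum>i\<in>I. \<bar>c i * exp ((norm (Y i))\<^sup>2 / 2)\<bar>)\<^sup>2 * g \<zeta>)"
        unfolding real_norm_def abs_mult abs_power2 by (intro mult_right_mono abs_ge_zero) auto
    qed
  qed (simp add: f_def g_def)
  have "k * (cmod a)\<^sup>2 \<le> (\<integral>\<zeta>. (cmod (f \<zeta>))\<^sup>2 * g \<zeta> \<partial>lborel)"
  proof -
    have "k * (cmod a)\<^sup>2 = (\<integral>\<zeta>. 2 * Re (cnj a * (f \<zeta> * of_real (g \<zeta>))) - (cmod a)\<^sup>2 * g \<zeta> \<partial>lborel)"
      using has_bochner_integral_integral_eq[OF 1] v by metis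
    also have "\<dots> \<le> (\<integral>\<zeta>. (cmod (f \<zeta>))\<^sup>2 * g \<zeta> \<partial>lborel)"
      by (rule integral_mono[OF integrable.intros[OF 1] int le])
    finally show ?thesis .
  qed
  then have "ennreal (k * (cmod a)\<^sup>2) \<le> ennreal (\<integral>\<zeta>. (cmod (f \<zeta>))\<^sup>2 * g \<zeta> \<partial>lborel)"
    by (rule ennreal_leI)
  also have "\<dots> = (\<integral>\<^sup>+\<zeta>. ennreal ((cmod (f \<zeta>))\<^sup>2 * g \<zeta>) \<partial>lborel)"
    using int by (intro nn_integral_eq_integral[symmetric]) (auto simp: g_def)
  finally show ?thesis unfolding k_def a_def f_def g_def .
qed

lemma summable_gaussian_powr:
  "summable (\<lambda>k::nat. exp (- (real k)\<^sup>2 / 4) * (real k + 1) powr b)"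
proof (rule summable_comparison_test_bigo)
  show "summable (\<lambda>k. norm (1 / real k ^ 2))"
    using inverse_power_summable[of 2] by (simp add: divide_inverse)
  show "(\<lambda>k::nat. exp (- (real k)\<^sup>2 / 4) * (real k + 1) powr b) \<in> O(\<lambda>k. 1 / real k ^ 2)"
    by real_asymp
qed

text \<open>The points are sorted into annuli of width 1/L around \<open>p\<close>. The k-th annulus
  lies in a ball of radius (k + 1)/L, which is at least 1/L, so the mass bound applies; the Gaussian
  makes the resulting powers of k + 1 summable.\<close>

lemma gaussian_sum_le:
  fixes f :: "'i \<Rightarrow> 'a::metric_space" and w :: "'i \<Rightarrow> real" and b C L :: real
  assumes "finite I" "\<And>i. i \<in> I \<Longrightarrow> w i \<ge> 0" "L > 0"
    and F: "\<And>\<rho>. \<rho> \<ge> 1 / L \<Longrightarrow> (\<Sum>i\<in>{i\<in>I. dist p (f i) \<le> \<rho>}. w i) \<le> C * \<rho> powr b"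
  shows "(\<Sum>i\<in>I. w i * exp (- (L * dist p (f i))\<^sup>2 / 4)) \<le>
      (\<Sum>k. exp (- (real k)\<^sup>2 / 4) * (real k + 1) powr b) * C * L powr - b"
proof -
  have pw: "((real k + 1) / L) powr b = (real k + 1) powr b * L powr - b" for k
    using assms(3) by (simp add: powr_divide powr_minus_divide)
  define u where "u = (\<lambda>i. nat \<lfloor>L * dist p (f i)\<rfloor>)"
  have u: "real (u i) \<le> L * dist p (f i)" "L * dist p (f i) \<le> real (u i) + 1" for i
    using assms(3) unfolding u_def by (auto simp: of_nat_nat)
  have C: "C \<ge> 0"
  proof -
    have "0 \<le> (\<Sum>i\<in>{i\<in>I. dist p (f i) \<le> 1/L}. w i)" using assms(2) by (intro sum_nonneg) auto
    also have "\<dots> \<le> C * (1/L) powr b" by (rule F) simp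
    finally show ?thesis using assms(3) by (simp add: zero_le_mult_iff)
  qed
  have "(\<Sum>i\<in>I. w i * exp (- (L * dist p (f i))\<^sup>2 / 4)) \<le> (\<Sum>i\<in>I. w i * exp (- (real (u i))\<^sup>2 / 4))"
    using assms(2) u by (intro sum_mono mult_left_mono) (auto intro!: power_mono)
  also have "\<dots> = (\<Sum>k\<in>u ` I. \<Sum>i\<in>{i\<in>I. u i = k}. w i * exp (- (real (u i))\<^sup>2 / 4))"
    by (rule sum.image_gen[OF assms(1)])
  also have "\<dots> = (\<Sum>k\<in>u ` I. exp (- (real k)\<^sup>2 / 4) * (\<Sum>i\<in>{i\<in>I. u i = k}. w i))"
    by (intro sum.cong refl) (simp add: sum_distrib_right mult.commute[of "exp _"])
  also have "\<dots> \<le> (\<Sum>k\<in>u ` I. exp (- (real k)\<^sup>2 / 4) * (C * ((real k + 1) / L) powr b))"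
  proof (intro sum_mono mult_left_mono)
    fix k
    have "(\<Sum>i\<in>{i\<in>I. u i = k}. w i) \<le> (\<Sum>i\<in>{i\<in>I. dist p (f i) \<le> (real k + 1) / L}. w i)"
      using assms u by (intro sum_mono2) (auto simp: field_simps)
    also have "\<dots> \<le> C * ((real k + 1) / L) powr b"
      using assms(3) by (intro F) (auto simp: divide_right_mono)
    finally show "(\<Sum>i\<in>{i\<in>I. u i = k}. w i) \<le> C * ((real k + 1) / L) powr b" .
  qed auto
  also have "\<dots> = (\<Sum>k\<in>u ` I. exp (- (real k)\<^sup>2 / 4) * (real k + 1) powr b) * (C * L powr - b)"
    unfolding sum_distrib_right pw by (intro sum.cong refl) (simp only: mult.assoc mult.left_commute)
  also have "\<dots> \<le> (\<Sum>k. exp (- (real k)\<^sup>2 / 4) * (real k + 1) powr b) * (C * L powr - b)"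
    using C assms(1) by (intro mult_right_mono sum_le_suminf summable_gaussian_powr) auto
  finally show ?thesis by (simp add: mult_ac)
qed

subsection \<open>Bilinear forms under Frostman conditions\<close>

definition gaussian_mass :: "real \<Rightarrow> real" where
  "gaussian_mass b = (\<Sum>k. exp (- (real k)\<^sup>2 / 4) * (real k + 1) powr b)"

lemma gaussian_mass_nonneg: "gaussian_mass b \<ge> 0"
  unfolding gaussian_mass_def by (intro suminf_nonneg summable_gaussian_powr) auto

lemma card_nat_interval_le:
  fixes x y :: real assumes "x \<le> y"
  shows "real (card {i::nat. i < J \<and> x \<le> real i \<and> real i \<le> y}) \<le> y - x + 1"
proof -
  let ?S = "{i::nat. i < J \<and> x \<le> real i \<and> real i \<le> y}"
  have "int ` ?S \<subseteq> {\<lceil>x\<rceil>..\<lfloor>y\<rfloor>}"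
    by (auto simp: le_floor_iff ceiling_le_iff)
  then have "card (int ` ?S) \<le> card {\<lceil>x\<rceil>..\<lfloor>y\<rfloor>}"
    by (intro card_mono) auto
  then have "real (card ?S) \<le> real (nat (\<lfloor>y\<rfloor> + 1 - \<lceil>x\<rceil>))"
    by (simp add: card_image)
  also have "\<dots> \<le> y - x + 1"
  proof (cases "\<lfloor>y\<rfloor> + 1 - \<lceil>x\<rceil> \<ge> 0")
    case True
    then show ?thesis
      using of_int_floor_le[of y] le_of_int_ceiling[of x] by (simp add: of_nat_nat; linarith)
  next
    case False
    then show ?thesis using assms by simp
  qed
  finally show ?thesis .
qed

text \<open>The substitution u = z + l t costs a factor 1/t. With t a value of the bilinear form
  this excludes values near 0; with t = \<epsilon> the same integral bounds the tail of the
  frequency cutoff.\<close>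

lemma nn_integral_gaussian_affine:
  fixes z t :: real assumes "t > 0"
  shows "(\<integral>\<^sup>+l. ennreal (exp (- (z + l * t)\<^sup>2 / 4)) \<partial>lborel) = ennreal (2 * sqrt pi / t)"
proof -
  have "has_bochner_integral lborel (\<lambda>u::real. exp (- u\<^sup>2 / 4)) (2 * sqrt pi)"
  proof -
    have "sqrt (2 * pi) * sqrt 2 = 2 * sqrt pi" by (simp add: real_sqrt_mult)
    then show ?thesis
      using has_bochner_integral_bounded_linear[OF bounded_linear_Re gaussian_fourier_real[of "sqrt 2" 0]]
      by simp
  qed
  then have "(\<integral>\<^sup>+u. ennreal (exp (- u\<^sup>2 / 4)) \<partial>lborel) = ennreal (2 * sqrt pi)"
    by (subst nn_integral_eq_integral) (auto simp: has_bochner_integral_iff)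
  also have "(\<integral>\<^sup>+u. ennreal (exp (- u\<^sup>2 / 4)) \<partial>lborel) = ennreal \<bar>t\<bar> * (\<integral>\<^sup>+l. ennreal (exp (- (z + t * l)\<^sup>2 / 4)) \<partial>lborel)"
    using assms by (intro nn_integral_real_affine) auto
  finally have "ennreal (1/t) * (ennreal t * (\<integral>\<^sup>+l. ennreal (exp (- (z + t * l)\<^sup>2 / 4)) \<partial>lborel)) = ennreal (1/t) * ennreal (2 * sqrt pi)"
    using assms by simp
  then show ?thesis
    using assms by (simp add: mult.assoc[symmetric] ennreal_mult[symmetric] mult.commute[of t])
qed

text \<open>Collects the losses of the shell estimate: 2^(d+1) from the width 2L in d + 1
  dimensions, exp(B^2 + t1^2) from splitting the Gaussian, exp(4 (B^2 + 1)) from the reweighting, 2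
  sqrt pi / t0 from the l-integral, C^3 from one Frostman bound for v and two factors for y, and 3
  from the grid of dilations.\<close>

definition shell_const :: "nat \<Rightarrow> real \<Rightarrow> real \<Rightarrow> real \<Rightarrow> real \<Rightarrow> real \<Rightarrow> real \<Rightarrow> real" where
  "shell_const d s a C B t0 t1 = 2 ^ (d + 1) * exp (B\<^sup>2 + t1\<^sup>2 + 4 * (B\<^sup>2 + 1)) * (2 * sqrt pi / t0)
     * (3 * C ^ 3 * gaussian_mass a * gaussian_mass s * gaussian_mass 1)"

text \<open>
  The Frostman bounds are required only at scales at least h, so finitely supported weights suffice
  and no weak limit of measures has to be taken; all estimates below depend on the
  parameters s, a, C, B, t0, t1 alone.
  The dilations r i discretise [1, 2]: replacing v \<open>\<bullet>\<close> y - t by r (v \<open>\<bullet>\<close> y - t) does not change the zero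
  set, but lifts y to the cone point Y = (r y, r), which gains one dimension.
\<close>

locale bilinear_config =
  fixes A :: "'a::euclidean_space set" and m :: "'a \<Rightarrow> real"
    and Om :: "'i set" and N :: "'i \<Rightarrow> real" and v :: "'i \<Rightarrow> 'a"
    and s a C B t0 t1 h K gap :: real and J :: nat
  assumes fin: "finite A" "finite Om"
    and nonneg: "\<And>y. y \<in> A \<Longrightarrow> m y \<ge> 0" "\<And>\<omega>. \<omega> \<in> Om \<Longrightarrow> N \<omega> \<ge> 0"
    and total: "sum m A \<le> C" "sum N Om \<le> C"
    and frostman_A: "\<And>p \<rho>. \<rho> \<ge> h \<Longrightarrow> (\<Sum>y\<in>{y\<in>A. dist p y \<le> \<rho>}. m y) \<le> C * \<rho> powr s"
    and frostman_Om: "\<And>p \<rho>. \<rho> \<ge> h \<Longrightarrow> (\<Sum>\<omega>\<in>{\<omega>\<in>Om. dist p (v \<omega>) \<le> \<rho>}. N \<omega>) \<le> C * \<rho> powr a"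
    and bounded: "\<And>y. y \<in> A \<Longrightarrow> norm y \<le> B" "\<And>\<omega>. \<omega> \<in> Om \<Longrightarrow> norm (v \<omega>) \<le> B"
    and t01: "0 < t0" "t0 < t1"
    and exps: "s > 0" "a > 0"
    and hJ: "0 < h" "J > 0" "1 / real J \<le> h"
    and K_def: "K = shell_const DIM('a) s a C B t0 t1"
    and gap_def: "gap = (s + a - DIM('a) - 1) / 2"
begin

definition r :: "nat \<Rightarrow> real" where "r i = 1 + real i / real J"

text \<open>Characteristic function at frequency l of the weighted law of
  \<open>r i * (v \<omega> \<bullet> y - t)\<close>.\<close>

definition Psi :: "real \<Rightarrow> real \<Rightarrow> complex" where
  "Psi t l = (\<Sum>\<omega>\<in>Om. \<Sum>p\<in>A \<times> {..<J}. of_real (N \<omega> * (m (fst p) / J)) * cis (l * (r (snd p) * (v \<omega> \<bullet> fst p - t))))"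

definition Y :: "'a \<times> nat \<Rightarrow> 'a \<times> real" where "Y p = (r (snd p) *\<^sub>R fst p, r (snd p))"

definition phi :: "'a \<times> real \<Rightarrow> complex" where
  "phi \<xi> = (\<Sum>p\<in>A \<times> {..<J}. of_real (m (fst p) / J) * cis (\<xi> \<bullet> Y p))"

definition phi' :: "'a \<times> real \<Rightarrow> complex" where
  "phi' \<zeta> = (\<Sum>p\<in>A \<times> {..<J}. of_real (m (fst p) / J * exp ((norm (Y p))\<^sup>2 / 2)) * cis (\<zeta> \<bullet> Y p))"

text \<open>Chosen so that \<open>X t l \<omega> \<bullet> Y (y, i)\<close> equals
  \<open>l * (r i * (v \<omega> \<bullet> y - t))\<close>. The last coordinate records l t and
  thereby l.\<close>

definition X :: "real \<Rightarrow> real \<Rightarrow> 'i \<Rightarrow> 'a \<times> real" where "X t l \<omega> = (l *\<^sub>R v \<omega>, - l * t)"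

lemma C_nonneg: "C \<ge> 0"
  using total(1) sum_nonneg[of A m] nonneg(1) by force

lemma r_bounds: "i < J \<Longrightarrow> 1 \<le> r i" "i < J \<Longrightarrow> r i \<le> 2"
  by (auto simp: r_def field_simps)

lemma Psi_eq: "Psi t l = (\<Sum>\<omega>\<in>Om. of_real (N \<omega>) * phi (X t l \<omega>))"
  unfolding Psi_def phi_def X_def Y_def
  by (intro sum.cong refl) (simp add: sum_distrib_left inner_Pair algebra_simps)

lemma mass_I: "(\<Sum>p\<in>A \<times> {..<J}. m (fst p) / J) = sum m A"
proof -
  have "(\<Sum>p\<in>A \<times> {..<J}. m (fst p) / J) = (\<Sum>y\<in>A. \<Sum>i<J. m y / J)"
    by (subst sum.cartesian_product) (simp add: case_prod_beta)
  then show ?thesis using hJ by simp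
qed

text \<open>The grid spacing satisfies 1/J \<le> h \<le> \<rho>, so the extra 1 in the count is
  absorbed: 2\<rho>J + 1 \<le> 3\<rho>J. This one-dimensional bound lifts the exponent from s to s +
  1.\<close>

lemma frostman_r:
  assumes "\<rho> \<ge> h" shows "(\<Sum>i\<in>{i\<in>{..<J}. dist q (r i) \<le> \<rho>}. 1 / real J) \<le> 3 * \<rho> powr 1"
proof -
  have eq: "{i\<in>{..<J}. dist q (r i) \<le> \<rho>} = {i. i < J \<and> J * (q - 1 - \<rho>) \<le> real i \<and> real i \<le> J * (q - 1 + \<rho>)}"
    using hJ by (auto simp: r_def dist_real_def abs_le_iff field_simps)
  have "real (card {i\<in>{..<J}. dist q (r i) \<le> \<rho>}) \<le> J * (q - 1 + \<rho>) - J * (q - 1 - \<rho>) + 1"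
    unfolding eq using assms hJ by (intro card_nat_interval_le mult_left_mono) auto
  moreover have "1 \<le> J * \<rho>"
    using mult_left_mono[of "1 / J" \<rho> "real J"] assms hJ by simp
  ultimately have "real (card {i\<in>{..<J}. dist q (r i) \<le> \<rho>}) \<le> 3 * \<rho> * J" by (simp add: algebra_simps)
  then have "real (card {i\<in>{..<J}. dist q (r i) \<le> \<rho>}) * (1 / J) \<le> 3 * \<rho> * J * (1 / J)"
    by (intro mult_right_mono) auto
  then show ?thesis using hJ assms by simp
qed

context
  fixes L t :: real
  assumes L: "1 \<le> L" "2 * L * h \<le> 1" and t: "t0 \<le> t" "t \<le> t1"
begin

text \<open>Frequencies l in the shell only see scales from 1/(2L) upwards, and 2 L h \<le> 1 keeps
  these in the range of the Frostman hypotheses.\<close>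

lemma scale_ok: "\<rho> \<ge> 1 / l \<Longrightarrow> L \<le> l \<Longrightarrow> l \<le> 2 * L \<Longrightarrow> \<rho> \<ge> h"
proof -
  assume a: "\<rho> \<ge> 1 / l" "L \<le> l" "l \<le> 2 * L"
  have "h \<le> 1 / (2 * L)" using L by (simp add: field_simps)
  also have "\<dots> \<le> 1 / l" using a L by (intro divide_left_mono) auto
  finally show ?thesis using a by simp
qed

text \<open>Since r i x - r j y = r j ((r i / r j) x - y) and r j \<ge> 1, the distance of two cone
  points dominates both the distance of the dilations and that of y from a rescaled x. The kernel
  thus separates into two factors; a factor 8 in the exponent is given away.\<close>

lemma kernel_le:
  assumes "i < J" "j < J"
  shows "exp (- ((2 * L)\<^sup>2 * (norm (Y (x, i) - Y (y, j)))\<^sup>2) / 2) \<le>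
    exp (- (L * dist (r i) (r j))\<^sup>2 / 4) * exp (- (L * dist ((r i / r j) *\<^sub>R x) y)\<^sup>2 / 4)"
proof -
  have "dist ((r i / r j) *\<^sub>R x) y \<le> norm (r i *\<^sub>R x - r j *\<^sub>R y)"
  proof -
    have "r i *\<^sub>R x - r j *\<^sub>R y = r j *\<^sub>R ((r i / r j) *\<^sub>R x - y)"
      using r_bounds(1)[OF assms(2)] by (simp add: algebra_simps)
    then have "norm (r i *\<^sub>R x - r j *\<^sub>R y) = r j * dist ((r i / r j) *\<^sub>R x) y"
      using r_bounds(1)[OF assms(2)] by (simp add: dist_norm)
    then show ?thesis using r_bounds(1)[OF assms(2)] mult_right_mono[of 1 "r j" "dist ((r i / r j) *\<^sub>R x) y"] by simp
  qed
  then have "(dist ((r i / r j) *\<^sub>R x) y)\<^sup>2 \<le> (norm (r i *\<^sub>R x - r j *\<^sub>R y))\<^sup>2"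
    by (intro power_mono) auto
  moreover have "(norm (Y (x, i) - Y (y, j)))\<^sup>2 = (norm (r i *\<^sub>R x - r j *\<^sub>R y))\<^sup>2 + (dist (r i) (r j))\<^sup>2"
    by (simp add: Y_def norm_Pair dist_real_def)
  ultimately have "(dist (r i) (r j))\<^sup>2 + (dist ((r i / r j) *\<^sub>R x) y)\<^sup>2 \<le> (norm (Y (x, i) - Y (y, j)))\<^sup>2" by simp
  then have "L\<^sup>2 * ((dist (r i) (r j))\<^sup>2 + (dist ((r i / r j) *\<^sub>R x) y)\<^sup>2) \<le> L\<^sup>2 * (norm (Y (x, i) - Y (y, j)))\<^sup>2"
    by (intro mult_left_mono) auto
  moreover have "0 \<le> L\<^sup>2 * (norm (Y (x, i) - Y (y, j)))\<^sup>2" by simp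
  ultimately have *: "L\<^sup>2 * (dist (r i) (r j))\<^sup>2 + L\<^sup>2 * (dist ((r i / r j) *\<^sub>R x) y)\<^sup>2 \<le> 8 * (L\<^sup>2 * (norm (Y (x, i) - Y (y, j)))\<^sup>2)"
    unfolding distrib_left by linarith
  have "- ((2 * L)\<^sup>2 * (norm (Y (x, i) - Y (y, j)))\<^sup>2) / 2 \<le> - (L * dist (r i) (r j))\<^sup>2 / 4 + - (L * dist ((r i / r j) *\<^sub>R x) y)\<^sup>2 / 4"
  proof -
    have "(2 * L)\<^sup>2 * n = 4 * (L\<^sup>2 * n)" for n by (simp add: power_mult_distrib)
    then show ?thesis
      using * unfolding power_mult_distrib[of L] distrib_left by (simp only:)
  qed
  then show ?thesis by (simp flip: exp_add)
qed

text \<open>For fixed j the sum over y is a Gaussian sum around the single point (r i / r j) x and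
  gives L^(-s); the remaining sum over j is a Gaussian sum on the grid and gives L^(-1).\<close>

lemma energy_inner:
  assumes "i < J"
  shows "(\<Sum>q\<in>A \<times> {..<J}. m (fst q) / J * exp (- ((2 * L)\<^sup>2 * (norm (Y (x, i) - Y q))\<^sup>2) / 2))
    \<le> 3 * C * gaussian_mass s * gaussian_mass 1 * L powr (- s - 1)"
proof -
  have "(\<Sum>q\<in>A \<times> {..<J}. m (fst q) / J * exp (- ((2 * L)\<^sup>2 * (norm (Y (x, i) - Y q))\<^sup>2) / 2))
     = (\<Sum>j<J. \<Sum>y\<in>A. m y / J * exp (- ((2 * L)\<^sup>2 * (norm (Y (x, i) - Y (y, j)))\<^sup>2) / 2))"
    by (subst sum.swap) (simp add: sum.cartesian_product case_prod_beta)
  also have "\<dots> \<le> (\<Sum>j<J. \<Sum>y\<in>A. m y / J * (exp (- (L * dist (r i) (r j))\<^sup>2 / 4) * exp (- (L * dist ((r i / r j) *\<^sub>R x) y)\<^sup>2 / 4)))"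
    using assms by (intro sum_mono mult_left_mono kernel_le) (auto simp: nonneg)
  also have "\<dots> = (\<Sum>j<J. 1 / J * exp (- (L * dist (r i) (r j))\<^sup>2 / 4) * (\<Sum>y\<in>A. m y * exp (- (L * dist ((r i / r j) *\<^sub>R x) y)\<^sup>2 / 4)))"
    by (simp add: sum_distrib_left mult_ac)
  also have "\<dots> \<le> (\<Sum>j<J. 1 / J * exp (- (L * dist (r i) (r j))\<^sup>2 / 4) * (gaussian_mass s * C * L powr - s))"
  proof (intro sum_mono mult_left_mono)
    fix j
    show "(\<Sum>y\<in>A. m y * exp (- (L * dist ((r i / r j) *\<^sub>R x) y)\<^sup>2 / 4)) \<le> gaussian_mass s * C * L powr - s"
      unfolding gaussian_mass_def
      by (rule gaussian_sum_le) (use fin nonneg L scale_ok[of L] in \<open>auto intro!: frostman_A\<close>)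
  qed auto
  also have "\<dots> = (\<Sum>j<J. 1 / J * exp (- (L * dist (r i) (r j))\<^sup>2 / 4)) * (gaussian_mass s * C * L powr - s)"
    by (simp only: sum_distrib_right)
  also have "\<dots> \<le> (gaussian_mass 1 * 3 * L powr - 1) * (gaussian_mass s * C * L powr - s)"
  proof (rule mult_right_mono)
    show "(\<Sum>j<J. 1 / J * exp (- (L * dist (r i) (r j))\<^sup>2 / 4)) \<le> gaussian_mass 1 * 3 * L powr - 1"
      unfolding gaussian_mass_def
      by (rule gaussian_sum_le) (use L scale_ok[of L] frostman_r in auto)
  qed (use C_nonneg gaussian_mass_nonneg in auto)
  also have "\<dots> = 3 * C * gaussian_mass s * gaussian_mass 1 * (L powr - 1 * L powr - s)"
    by (simp only: mult_ac)
  also have "L powr - 1 * L powr - s = L powr (- 1 + - s)"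
    by (rule powr_add[symmetric])
  also have "- 1 + - s = - s - 1" by simp
  finally show ?thesis .
qed

lemma norm_Y_le: "p \<in> A \<times> {..<J} \<Longrightarrow> (norm (Y p))\<^sup>2 \<le> 4 * (B\<^sup>2 + 1)"
proof -
  assume "p \<in> A \<times> {..<J}"
  then obtain y i where p: "p = (y, i)" "y \<in> A" "i < J" by auto
  have "(norm (Y p))\<^sup>2 = (r i)\<^sup>2 * ((norm y)\<^sup>2 + 1)"
    by (simp add: p Y_def norm_Pair power_mult_distrib algebra_simps)
  also have "\<dots> \<le> 2\<^sup>2 * (B\<^sup>2 + 1)"
    using p r_bounds[of i] bounded(1)[of y] by (intro mult_mono power_mono add_mono) auto
  finally show ?thesis by simp
qed

text \<open>The energy identity at width 2L in d + 1 dimensions. The points \<open>Y p\<close> are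
  bounded, so the exponential reweighting costs only a constant, and the order is L^(d+1) L^(-s-1) =
  L^(d-s).\<close>

lemma energy_bound:
  "(\<integral>\<^sup>+\<zeta>. ennreal ((cmod (phi' \<zeta>))\<^sup>2 * exp (- (norm \<zeta>)\<^sup>2 / (2 * (2 * L)\<^sup>2))) \<partial>lborel)
    \<le> ennreal ((sqrt (2 * pi) * (2 * L)) ^ (DIM('a) + 1) * (exp (4 * (B\<^sup>2 + 1)) * (3 * C\<^sup>2 * gaussian_mass s * gaussian_mass 1 * L powr (- s - 1))))"
proof -
  let ?I = "A \<times> {..<J}"
  let ?c = "\<lambda>p. m (fst p) / J * exp ((norm (Y p))\<^sup>2 / 2)"
  let ?e = "\<lambda>p q. exp (- ((2 * L)\<^sup>2 * (norm (Y p - Y q))\<^sup>2) / 2)"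
  have c: "0 \<le> ?c p" "?c p \<le> m (fst p) / J * exp (2 * (B\<^sup>2 + 1))" if "p \<in> ?I" for p
  proof -
    show "0 \<le> ?c p" using that nonneg by auto
    show "?c p \<le> m (fst p) / J * exp (2 * (B\<^sup>2 + 1))"
      using that nonneg norm_Y_le[OF that] by (intro mult_left_mono) auto
  qed
  have "has_bochner_integral lborel (\<lambda>\<zeta>. (cmod (phi' \<zeta>))\<^sup>2 * exp (- (norm \<zeta>)\<^sup>2 / (2 * (2 * L)\<^sup>2)))
     ((sqrt (2 * pi) * (2 * L)) ^ DIM('a \<times> real) * (\<Sum>p\<in>?I. \<Sum>q\<in>?I. ?c p * ?c q * ?e p q))"
    unfolding phi'_def using fin L by (intro energy_identity) auto
  then have "(\<integral>\<^sup>+\<zeta>. ennreal ((cmod (phi' \<zeta>))\<^sup>2 * exp (- (norm \<zeta>)\<^sup>2 / (2 * (2 * L)\<^sup>2))) \<partial>lborel)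
    = ennreal ((sqrt (2 * pi) * (2 * L)) ^ (DIM('a) + 1) * (\<Sum>p\<in>?I. \<Sum>q\<in>?I. ?c p * ?c q * ?e p q))"
    by (subst nn_integral_eq_integral) (auto simp: has_bochner_integral_iff)
  also have "\<dots> \<le> ennreal ((sqrt (2 * pi) * (2 * L)) ^ (DIM('a) + 1) * (exp (4 * (B\<^sup>2 + 1)) * (3 * C\<^sup>2 * gaussian_mass s * gaussian_mass 1 * L powr (- s - 1))))"
  proof (intro ennreal_leI mult_left_mono)
    have "(\<Sum>p\<in>?I. \<Sum>q\<in>?I. ?c p * ?c q * ?e p q) \<le> (\<Sum>p\<in>?I. \<Sum>q\<in>?I. (m (fst p) / J * exp (2 * (B\<^sup>2 + 1))) * (m (fst q) / J * exp (2 * (B\<^sup>2 + 1))) * ?e p q)"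
      by (intro sum_mono mult_right_mono mult_mono c) (auto simp: nonneg)
    also have "\<dots> = (\<Sum>p\<in>?I. exp (4 * (B\<^sup>2 + 1)) * (m (fst p) / J) * (\<Sum>q\<in>?I. m (fst q) / J * ?e p q))"
    proof (intro sum.cong refl)
      fix p
      have e: "exp (4 * (B\<^sup>2 + 1)) = exp (2 * (B\<^sup>2 + 1)) * exp (2 * (B\<^sup>2 + 1))"
        by (simp flip: exp_add)
      show "(\<Sum>q\<in>?I. (m (fst p) / J * exp (2 * (B\<^sup>2 + 1))) * (m (fst q) / J * exp (2 * (B\<^sup>2 + 1))) * ?e p q)
         = exp (4 * (B\<^sup>2 + 1)) * (m (fst p) / J) * (\<Sum>q\<in>?I. m (fst q) / J * ?e p q)"
        unfolding e sum_distrib_left by (intro sum.cong refl) (simp only: mult_ac)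
    qed
    also have "\<dots> \<le> (\<Sum>p\<in>?I. exp (4 * (B\<^sup>2 + 1)) * (m (fst p) / J) * (3 * C * gaussian_mass s * gaussian_mass 1 * L powr (- s - 1)))"
    proof (intro sum_mono mult_left_mono)
      fix p assume "p \<in> ?I"
      then show "(\<Sum>q\<in>?I. m (fst q) / J * ?e p q) \<le> 3 * C * gaussian_mass s * gaussian_mass 1 * L powr (- s - 1)"
        using energy_inner[of "snd p" "fst p"] by auto
    qed (auto simp: nonneg)
    also have "\<dots> = exp (4 * (B\<^sup>2 + 1)) * (sum m A * (3 * C * gaussian_mass s * gaussian_mass 1 * L powr (- s - 1)))"
      unfolding mass_I[symmetric] sum_distrib_left sum_distrib_right by (simp only: mult_ac)
    also have "\<dots> \<le> exp (4 * (B\<^sup>2 + 1)) * (C * (3 * C * gaussian_mass s * gaussian_mass 1 * L powr (- s - 1)))"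
      using total(1) C_nonneg gaussian_mass_nonneg by (intro mult_left_mono mult_right_mono) auto
    finally show "(\<Sum>p\<in>?I. \<Sum>q\<in>?I. ?c p * ?c q * ?e p q) \<le> exp (4 * (B\<^sup>2 + 1)) * (3 * C\<^sup>2 * gaussian_mass s * gaussian_mass 1 * L powr (- s - 1))"
      by (simp add: power2_eq_square mult_ac)
  qed (use L in auto)
  finally show ?thesis .
qed

text \<open>
  Half of the Gaussian exponent is kept for localisation, and the other half (divided by L^2 \<open>\<ge>\<close> 1)
  yields decay in \<open>\<zeta>\<close> at scale L.
\<close>

lemma gaussian_split:
  assumes "l \<in> {L..2 * L}" "\<omega> \<in> Om"
  shows "exp (- (norm (\<zeta> - X t l \<omega>))\<^sup>2 / 2) \<le> exp (B\<^sup>2 + t1\<^sup>2) * exp (- (norm \<zeta>)\<^sup>2 / (2 * (2 * L)\<^sup>2))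
     * (exp (- (l * dist (fst \<zeta> /\<^sub>R l) (v \<omega>))\<^sup>2 / 4) * exp (- (snd \<zeta> + l * t)\<^sup>2 / 4))"
proof -
  define n where "n = (norm (\<zeta> - X t l \<omega>))\<^sup>2"
  have lL: "L \<le> l" "l \<le> 2 * L" "0 < l" using assms L by auto
  have "(norm (X t l \<omega>))\<^sup>2 = l\<^sup>2 * ((norm (v \<omega>))\<^sup>2 + t\<^sup>2)"
    by (simp add: X_def norm_Pair power_mult_distrib algebra_simps)
  also have "\<dots> \<le> (2 * L)\<^sup>2 * (B\<^sup>2 + t1\<^sup>2)"
    using lL L t t01 bounded(2)[OF assms(2)] by (intro mult_mono power_mono add_mono) auto
  finally have X: "(norm (X t l \<omega>))\<^sup>2 \<le> 4 * L\<^sup>2 * (B\<^sup>2 + t1\<^sup>2)" by (simp add: power_mult_distrib)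
  have "norm \<zeta> \<le> norm (\<zeta> - X t l \<omega>) + norm (X t l \<omega>)"
    by (metis diff_add_cancel norm_triangle_ineq)
  then have "(norm \<zeta>)\<^sup>2 \<le> (norm (\<zeta> - X t l \<omega>) + norm (X t l \<omega>))\<^sup>2"
    by (intro power_mono) auto
  also have "\<dots> \<le> 2 * n + 2 * (norm (X t l \<omega>))\<^sup>2"
    unfolding n_def using sum_squares_bound[of "norm (\<zeta> - X t l \<omega>)" "norm (X t l \<omega>)"] by (simp add: power2_sum)
  finally have "(norm \<zeta>)\<^sup>2 \<le> 2 * n + 8 * L\<^sup>2 * (B\<^sup>2 + t1\<^sup>2)" using X by linarith
  then have "(norm \<zeta>)\<^sup>2 / (8 * L\<^sup>2) \<le> (2 * n + 8 * L\<^sup>2 * (B\<^sup>2 + t1\<^sup>2)) / (8 * L\<^sup>2)"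
    by (intro divide_right_mono) auto
  also have "\<dots> = n / (4 * L\<^sup>2) + (B\<^sup>2 + t1\<^sup>2)"
    using L by (simp add: field_simps)
  also have "n / (4 * L\<^sup>2) \<le> n / 4"
    using L by (intro divide_left_mono) (auto simp: n_def one_le_power mult_pos_pos)
  finally have 1: "(norm \<zeta>)\<^sup>2 / (8 * L\<^sup>2) \<le> n / 4 + (B\<^sup>2 + t1\<^sup>2)" by simp
  have "l * dist (fst \<zeta> /\<^sub>R l) (v \<omega>) = norm (fst \<zeta> - l *\<^sub>R v \<omega>)"
  proof -
    have "fst \<zeta> - l *\<^sub>R v \<omega> = l *\<^sub>R (fst \<zeta> /\<^sub>R l - v \<omega>)"
      using lL by (simp add: algebra_simps)
    then show ?thesis using lL by (simp add: dist_norm)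
  qed
  then have n: "n = (l * dist (fst \<zeta> /\<^sub>R l) (v \<omega>))\<^sup>2 + (snd \<zeta> + l * t)\<^sup>2"
    unfolding n_def X_def by (cases \<zeta>) (simp add: norm_Pair)
  have "- n / 2 \<le> (B\<^sup>2 + t1\<^sup>2) + - (norm \<zeta>)\<^sup>2 / (2 * (2 * L)\<^sup>2) + (- (l * dist (fst \<zeta> /\<^sub>R l) (v \<omega>))\<^sup>2 / 4 + - (snd \<zeta> + l * t)\<^sup>2 / 4)"
  proof -
    have "2 * (2 * L)\<^sup>2 = 8 * L\<^sup>2" by (simp add: power_mult_distrib)
    moreover have "- n / 2 \<le> b + - z + (- p / 4 + - q / 4)" if "z \<le> n / 4 + b" "n = p + q" for n z b p q :: real
      using that by linarith
    from this[OF 1 n] have "- n / 2 \<le> (B\<^sup>2 + t1\<^sup>2) + - ((norm \<zeta>)\<^sup>2 / (8 * L\<^sup>2)) + (- (l * dist (fst \<zeta> /\<^sub>R l) (v \<omega>))\<^sup>2 / 4 + - (snd \<zeta> + l * t)\<^sup>2 / 4)" .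
    ultimately show ?thesis by (simp only: minus_divide_left)
  qed
  then have "exp (- n / 2) \<le> exp ((B\<^sup>2 + t1\<^sup>2) + - (norm \<zeta>)\<^sup>2 / (2 * (2 * L)\<^sup>2) + (- (l * dist (fst \<zeta> /\<^sub>R l) (v \<omega>))\<^sup>2 / 4 + - (snd \<zeta> + l * t)\<^sup>2 / 4))"
    by (simp only: exp_le_cancel_iff)
  then show ?thesis unfolding n_def[symmetric] by (simp only: exp_add)
qed

text \<open>The first localisation factor forces \<open>v \<omega>\<close> to be within O(1/l) of
  \<open>fst \<zeta> /\<^sub>R l\<close>, which costs mass L^(-a) by the Frostman bound. The factor
  in \<open>snd \<zeta> + l * t\<close> is kept for the integration over l.\<close>

lemma weight_le:
  assumes "l \<in> {L..2 * L}"
  shows "(\<Sum>\<omega>\<in>Om. N \<omega> * exp (- (norm (\<zeta> - X t l \<omega>))\<^sup>2 / 2)) \<le>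
    exp (B\<^sup>2 + t1\<^sup>2) * (gaussian_mass a * C * L powr - a) * exp (- (norm \<zeta>)\<^sup>2 / (2 * (2 * L)\<^sup>2)) * exp (- (snd \<zeta> + l * t)\<^sup>2 / 4)"
proof -
  let ?K = "exp (B\<^sup>2 + t1\<^sup>2) * exp (- (norm \<zeta>)\<^sup>2 / (2 * (2 * L)\<^sup>2)) * exp (- (snd \<zeta> + l * t)\<^sup>2 / 4)"
  have l: "l > 0" "L \<le> l" "l \<le> 2 * L" using assms L by auto
  have "(\<Sum>\<omega>\<in>Om. N \<omega> * exp (- (norm (\<zeta> - X t l \<omega>))\<^sup>2 / 2)) \<le>
     (\<Sum>\<omega>\<in>Om. N \<omega> * (exp (B\<^sup>2 + t1\<^sup>2) * exp (- (norm \<zeta>)\<^sup>2 / (2 * (2 * L)\<^sup>2))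
     * (exp (- (l * dist (fst \<zeta> /\<^sub>R l) (v \<omega>))\<^sup>2 / 4) * exp (- (snd \<zeta> + l * t)\<^sup>2 / 4))))"
    using assms by (intro sum_mono mult_left_mono gaussian_split nonneg) auto
  also have "\<dots> = ?K * (\<Sum>\<omega>\<in>Om. N \<omega> * exp (- (l * dist (fst \<zeta> /\<^sub>R l) (v \<omega>))\<^sup>2 / 4))"
    unfolding sum_distrib_left by (intro sum.cong refl) (simp only: mult_ac)
  also have "\<dots> \<le> ?K * (gaussian_mass a * C * l powr - a)"
  proof (rule mult_left_mono)
    show "(\<Sum>\<omega>\<in>Om. N \<omega> * exp (- (l * dist (fst \<zeta> /\<^sub>R l) (v \<omega>))\<^sup>2 / 4)) \<le> gaussian_mass a * C * l powr - a"
      unfolding gaussian_mass_def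
      by (rule gaussian_sum_le) (use fin nonneg l scale_ok[of l] in \<open>auto intro!: frostman_Om\<close>)
  qed auto
  also have "\<dots> \<le> ?K * (gaussian_mass a * C * L powr - a)"
    using l L C_nonneg gaussian_mass_nonneg exps by (intro mult_left_mono powr_mono2') auto
  finally show ?thesis by (simp only: mult_ac)
qed

text \<open>Each |phi(X)|^2 is bounded by a Gaussian average of |phi'|^2 around X. Summed over
  \<open>\<omega>\<close> and integrated over l, these Gaussians form a weight of order L^(-a) with
  decay at scale L, and the energy bound supplies L^(d-s).\<close>

lemma shell_L2:
  "(\<integral>\<^sup>+l\<in>{L..2 * L}. ennreal (\<Sum>\<omega>\<in>Om. N \<omega> * (cmod (phi (X t l \<omega>)))\<^sup>2) \<partial>lborel) \<le> ennreal (K * L powr (DIM('a) - s - a))"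
proof -
  define k where "k = sqrt (2 * pi) ^ (DIM('a) + 1)"
  define K1 where "K1 = exp (B\<^sup>2 + t1\<^sup>2) * (gaussian_mass a * C * L powr - a)"
  define W where "W = (sqrt (2 * pi) * (2 * L)) ^ (DIM('a) + 1) * (exp (4 * (B\<^sup>2 + 1)) * (3 * C\<^sup>2 * gaussian_mass s * gaussian_mass 1 * L powr (- s - 1)))"
  have k: "k > 0" by (simp add: k_def)
  have K1: "K1 \<ge> 0" unfolding K1_def using C_nonneg gaussian_mass_nonneg by auto
  have mX: "(\<lambda>x. X t (f x) \<omega>) \<in> borel_measurable M" if "f \<in> borel_measurable M" for f \<omega> and M :: "'c measure"
    unfolding X_def using that by measurable
  have [measurable]: "phi' \<in> borel_measurable borel" "phi \<in> borel_measurable borel"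
    unfolding phi'_def phi_def by measurable
  have msnd: "(\<lambda>x. snd (f x)) \<in> borel_measurable M" if "f \<in> borel_measurable M" for f :: "'c \<Rightarrow> 'a \<times> real" and M
    by (rule measurable_compose[OF that]) (intro borel_measurable_continuous_onI continuous_intros)
  note mX[measurable] msnd[measurable]
  have "(\<integral>\<^sup>+l\<in>{L..2 * L}. ennreal (k * (\<Sum>\<omega>\<in>Om. N \<omega> * (cmod (phi (X t l \<omega>)))\<^sup>2)) \<partial>lborel)
     \<le> (\<integral>\<^sup>+l. \<integral>\<^sup>+\<zeta>. ennreal (K1 * (cmod (phi' \<zeta>))\<^sup>2 * exp (- (norm \<zeta>)\<^sup>2 / (2 * (2 * L)\<^sup>2)) * exp (- (snd \<zeta> + l * t)\<^sup>2 / 4)) \<partial>lborel \<partial>lborel)"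
  proof (intro nn_integral_mono)
    fix l :: real
    show "ennreal (k * (\<Sum>\<omega>\<in>Om. N \<omega> * (cmod (phi (X t l \<omega>)))\<^sup>2)) * indicator {L..2 * L} l
      \<le> (\<integral>\<^sup>+\<zeta>. ennreal (K1 * (cmod (phi' \<zeta>))\<^sup>2 * exp (- (norm \<zeta>)\<^sup>2 / (2 * (2 * L)\<^sup>2)) * exp (- (snd \<zeta> + l * t)\<^sup>2 / 4)) \<partial>lborel)"
    proof (cases "l \<in> {L..2 * L}")
      case True
      have "ennreal (k * (\<Sum>\<omega>\<in>Om. N \<omega> * (cmod (phi (X t l \<omega>)))\<^sup>2)) = (\<Sum>\<omega>\<in>Om. ennreal (N \<omega>) * ennreal (k * (cmod (phi (X t l \<omega>)))\<^sup>2))"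
      proof -
        have "k * (\<Sum>\<omega>\<in>Om. N \<omega> * (cmod (phi (X t l \<omega>)))\<^sup>2) = (\<Sum>\<omega>\<in>Om. N \<omega> * (k * (cmod (phi (X t l \<omega>)))\<^sup>2))"
          unfolding sum_distrib_left by (simp only: mult.left_commute)
        also have "ennreal \<dots> = (\<Sum>\<omega>\<in>Om. ennreal (N \<omega> * (k * (cmod (phi (X t l \<omega>)))\<^sup>2)))"
          using nonneg k by (intro sum_ennreal[symmetric]) auto
        also have "\<dots> = (\<Sum>\<omega>\<in>Om. ennreal (N \<omega>) * ennreal (k * (cmod (phi (X t l \<omega>)))\<^sup>2))"
          using nonneg k by (intro sum.cong refl ennreal_mult) auto
        finally show ?thesis .
      qed
      also have "\<dots> \<le> (\<Sum>\<omega>\<in>Om. ennreal (N \<omega>) * (\<integral>\<^sup>+\<zeta>. ennreal ((cmod (phi' \<zeta>))\<^sup>2 * exp (- (norm (\<zeta> - X t l \<omega>))\<^sup>2 / 2)) \<partial>lborel))"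
        using norm_exp_sum_le_gaussian_average[of "A \<times> {..<J}" "\<lambda>p. m (fst p) / J" _ Y] fin
        by (intro sum_mono mult_left_mono) (auto simp: k_def phi_def phi'_def)
      also have "\<dots> = (\<integral>\<^sup>+\<zeta>. (\<Sum>\<omega>\<in>Om. ennreal (N \<omega>) * ennreal ((cmod (phi' \<zeta>))\<^sup>2 * exp (- (norm (\<zeta> - X t l \<omega>))\<^sup>2 / 2))) \<partial>lborel)"
        by (subst nn_integral_sum) (auto simp: nn_integral_cmult)
      also have "\<dots> \<le> (\<integral>\<^sup>+\<zeta>. ennreal (K1 * (cmod (phi' \<zeta>))\<^sup>2 * exp (- (norm \<zeta>)\<^sup>2 / (2 * (2 * L)\<^sup>2)) * exp (- (snd \<zeta> + l * t)\<^sup>2 / 4)) \<partial>lborel)"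
      proof (intro nn_integral_mono)
        fix \<zeta>
        have "(\<Sum>\<omega>\<in>Om. ennreal (N \<omega>) * ennreal ((cmod (phi' \<zeta>))\<^sup>2 * exp (- (norm (\<zeta> - X t l \<omega>))\<^sup>2 / 2)))
          = (\<Sum>\<omega>\<in>Om. ennreal (N \<omega> * ((cmod (phi' \<zeta>))\<^sup>2 * exp (- (norm (\<zeta> - X t l \<omega>))\<^sup>2 / 2))))"
          using nonneg by (intro sum.cong refl) (simp add: ennreal_mult)
        also have "\<dots> = ennreal ((cmod (phi' \<zeta>))\<^sup>2 * (\<Sum>\<omega>\<in>Om. N \<omega> * exp (- (norm (\<zeta> - X t l \<omega>))\<^sup>2 / 2)))"
          using nonneg by (subst sum_ennreal) (auto simp: sum_distrib_left mult_ac)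
        also have "\<dots> \<le> ennreal ((cmod (phi' \<zeta>))\<^sup>2 * (K1 * exp (- (norm \<zeta>)\<^sup>2 / (2 * (2 * L)\<^sup>2)) * exp (- (snd \<zeta> + l * t)\<^sup>2 / 4)))"
          unfolding K1_def by (intro ennreal_leI mult_left_mono weight_le True) auto
        finally show "(\<Sum>\<omega>\<in>Om. ennreal (N \<omega>) * ennreal ((cmod (phi' \<zeta>))\<^sup>2 * exp (- (norm (\<zeta> - X t l \<omega>))\<^sup>2 / 2)))
          \<le> ennreal (K1 * (cmod (phi' \<zeta>))\<^sup>2 * exp (- (norm \<zeta>)\<^sup>2 / (2 * (2 * L)\<^sup>2)) * exp (- (snd \<zeta> + l * t)\<^sup>2 / 4))"
          by (simp only: mult_ac)
      qed
      finally show ?thesis using True by simp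
    qed simp
  qed
  \<comment> \<open>Here the lift pays off: with \<open>\<zeta>\<close> fixed, its last coordinate
    confines l to a window of length O(1/t), so the l-integral costs a constant instead of
    L.\<close>
  also have "\<dots> = (\<integral>\<^sup>+\<zeta>. \<integral>\<^sup>+l. ennreal (K1 * (cmod (phi' \<zeta>))\<^sup>2 * exp (- (norm \<zeta>)\<^sup>2 / (2 * (2 * L)\<^sup>2)) * exp (- (snd \<zeta> + l * t)\<^sup>2 / 4)) \<partial>lborel \<partial>lborel)"
    by (rule pair_sigma_finite.Fubini') (auto intro!: pair_sigma_finite.intro lborel.sigma_finite_measure_axioms)
  also have "\<dots> = (\<integral>\<^sup>+\<zeta>. ennreal (K1 * (2 * sqrt pi / t)) * ennreal ((cmod (phi' \<zeta>))\<^sup>2 * exp (- (norm \<zeta>)\<^sup>2 / (2 * (2 * L)\<^sup>2))) \<partial>lborel)"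
  proof (intro nn_integral_cong)
    fix \<zeta> :: "'a \<times> real"
    have "(\<integral>\<^sup>+l. ennreal (K1 * (cmod (phi' \<zeta>))\<^sup>2 * exp (- (norm \<zeta>)\<^sup>2 / (2 * (2 * L)\<^sup>2)) * exp (- (snd \<zeta> + l * t)\<^sup>2 / 4)) \<partial>lborel)
       = (\<integral>\<^sup>+l. ennreal (K1 * (cmod (phi' \<zeta>))\<^sup>2 * exp (- (norm \<zeta>)\<^sup>2 / (2 * (2 * L)\<^sup>2))) * ennreal (exp (- (snd \<zeta> + l * t)\<^sup>2 / 4)) \<partial>lborel)"
      using K1 by (intro nn_integral_cong) (simp add: ennreal_mult)
    also have "\<dots> = ennreal (K1 * (cmod (phi' \<zeta>))\<^sup>2 * exp (- (norm \<zeta>)\<^sup>2 / (2 * (2 * L)\<^sup>2))) * ennreal (2 * sqrt pi / t)"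
      using t t01 nn_integral_gaussian_affine[of t "snd \<zeta>"] by (subst nn_integral_cmult) auto
    also have "\<dots> = ennreal (K1 * (2 * sqrt pi / t)) * ennreal ((cmod (phi' \<zeta>))\<^sup>2 * exp (- (norm \<zeta>)\<^sup>2 / (2 * (2 * L)\<^sup>2)))"
    proof -
      have q: "0 \<le> 2 * sqrt pi / t" using t t01 by simp
      have pe: "0 \<le> (cmod (phi' \<zeta>))\<^sup>2 * exp (- (norm \<zeta>)\<^sup>2 / (2 * (2 * L)\<^sup>2))" by simp
      show ?thesis
        unfolding ennreal_mult''[OF q, symmetric] ennreal_mult''[OF pe, symmetric] by (simp only: mult_ac)
    qed
    finally show "(\<integral>\<^sup>+l. ennreal (K1 * (cmod (phi' \<zeta>))\<^sup>2 * exp (- (norm \<zeta>)\<^sup>2 / (2 * (2 * L)\<^sup>2)) * exp (- (snd \<zeta> + l * t)\<^sup>2 / 4)) \<partial>lborel)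
      = ennreal (K1 * (2 * sqrt pi / t)) * ennreal ((cmod (phi' \<zeta>))\<^sup>2 * exp (- (norm \<zeta>)\<^sup>2 / (2 * (2 * L)\<^sup>2)))" .
  qed
  also have "\<dots> = ennreal (K1 * (2 * sqrt pi / t)) * (\<integral>\<^sup>+\<zeta>. ennreal ((cmod (phi' \<zeta>))\<^sup>2 * exp (- (norm \<zeta>)\<^sup>2 / (2 * (2 * L)\<^sup>2))) \<partial>lborel)"
    by (rule nn_integral_cmult) auto
  also have "\<dots> \<le> ennreal (K1 * (2 * sqrt pi / t0)) * ennreal W"
    using energy_bound K1 t t01 unfolding W_def
    by (intro mult_mono ennreal_leI mult_left_mono divide_left_mono) auto
  also have "\<dots> = ennreal (k * (K * L powr (DIM('a) - s - a)))"
  proof -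
    have "L powr - a * L ^ (DIM('a) + 1) * L powr (- s - 1) = L powr (DIM('a) - s - a)"
    proof -
      have "L ^ (DIM('a) + 1) = L powr (DIM('a) + 1)" using L by (subst powr_realpow[symmetric]) auto
      then have "L powr - a * L ^ (DIM('a) + 1) * L powr (- s - 1) = L powr (- a + (DIM('a) + 1) + (- s - 1))"
        by (simp only: powr_add)
      also have "- a + (DIM('a) + 1) + (- s - 1) = DIM('a) - s - a" by simp
      finally show ?thesis .
    qed
    note * = this[symmetric]
    have "k * (K * L powr (DIM('a) - s - a)) = K1 * (2 * sqrt pi / t0) * W"
      unfolding * K_def shell_const_def K1_def W_def k_def power_mult_distrib exp_add power3_eq_cube power2_eq_square[of C]
      by (simp only: mult_ac)
    then show ?thesis using K1 t01 by (subst ennreal_mult'[symmetric]) auto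
  qed
  finally have "(\<integral>\<^sup>+l\<in>{L..2 * L}. ennreal (k * (\<Sum>\<omega>\<in>Om. N \<omega> * (cmod (phi (X t l \<omega>)))\<^sup>2)) \<partial>lborel) \<le> ennreal (k * (K * L powr (DIM('a) - s - a)))" .
  also have "(\<integral>\<^sup>+l\<in>{L..2 * L}. ennreal (k * (\<Sum>\<omega>\<in>Om. N \<omega> * (cmod (phi (X t l \<omega>)))\<^sup>2)) \<partial>lborel)
     = ennreal k * (\<integral>\<^sup>+l\<in>{L..2 * L}. ennreal (\<Sum>\<omega>\<in>Om. N \<omega> * (cmod (phi (X t l \<omega>)))\<^sup>2) \<partial>lborel)"
    using k by (subst nn_integral_cmult[symmetric]) (auto simp: ennreal_mult' mult.assoc)
  finally have "ennreal (1/k) * (ennreal k * (\<integral>\<^sup>+l\<in>{L..2 * L}. ennreal (\<Sum>\<omega>\<in>Om. N \<omega> * (cmod (phi (X t l \<omega>)))\<^sup>2) \<partial>lborel))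
     \<le> ennreal (1/k) * ennreal (k * (K * L powr (DIM('a) - s - a)))"
    by (rule mult_left_mono) simp
  then show ?thesis
    using k by (simp add: mult.assoc[symmetric] ennreal_mult'[symmetric])
qed

end
end

section \<open>Modulus of continuity of the smoothed density\<close>

lemma dyadic_shell:
  fixes x :: real assumes "n0 \<le> n" "2 ^ n0 < x" "x < 2 ^ n"
  shows "\<exists>j\<in>{n0..<n}. 2 ^ j \<le> x \<and> x \<le> 2 * 2 ^ j"
  using assms
proof (induction n rule: dec_induct)
  case (step n)
  show ?case
  proof (cases "x < 2 ^ n")
    case True
    with step obtain j where "j \<in> {n0..<n}" "2 ^ j \<le> x \<and> x \<le> 2 * 2 ^ j" by auto
    then show ?thesis by (intro bexI[of _ j]) auto
  next
    case False
    then show ?thesis using step by (intro bexI[of _ n]) auto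
  qed
qed auto

context bilinear_config begin

text \<open>2 pi times the density at 0 of the weighted law of
  \<open>r i * (v \<omega> \<bullet> y - t)\<close> smoothed by a Gaussian of deviation
  \<open>\<epsilon>\<close>. In this normalisation it is the integral of \<open>Psi\<close> against
  the cutoff exp(-(\<epsilon> l)^2 / 2) without a further constant.\<close>

definition dens :: "real \<Rightarrow> real \<Rightarrow> real" where
  "dens \<epsilon> t = (\<Sum>\<omega>\<in>Om. \<Sum>p\<in>A \<times> {..<J}. N \<omega> * (m (fst p) / J) * (sqrt (2 * pi) / \<epsilon> * exp (- (r (snd p) * (v \<omega> \<bullet> fst p - t) / \<epsilon>)\<^sup>2 / 2)))"

lemma K_nonneg: "K \<ge> 0"
  unfolding K_def shell_const_def using C_nonneg gaussian_mass_nonneg t01 by simp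

lemma Psi_measurable [measurable]: "Psi t \<in> borel_measurable borel"
  unfolding Psi_def by measurable

text \<open>The geometric mean of the shell length L and the L2 bound L^(d-s-a) is L^(-gap), so the
  shells are summable once gap > 0.\<close>

lemma shell_L1:
  assumes L: "1 \<le> L" "2 * L * h \<le> 1" and t: "t0 \<le> t" "t \<le> t1"
  shows "(\<integral>\<^sup>+l\<in>{L..2 * L}. ennreal (cmod (Psi t l)) \<partial>lborel) \<le> ennreal ((C + K) * L powr - gap)"
proof -
  \<comment> \<open>the weight \<open>\<tau>\<close> balances the two terms of |z| \<open>\<le>\<close> \<open>\<tau>\<close> + |z|^2 / \<open>\<tau>\<close> after integration over the shell\<close>
  define \<tau> where "\<tau> = L powr (- 1 - gap)"
  define S where "S = (\<lambda>l. \<Sum>\<omega>\<in>Om. N \<omega> * (cmod (phi (X t l \<omega>)))\<^sup>2)"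
  have \<tau>: "\<tau> > 0" using L by (simp add: \<tau>_def)
  have S: "S l \<ge> 0" for l unfolding S_def using nonneg by (auto intro!: sum_nonneg)
  have [measurable]: "S \<in> borel_measurable borel" unfolding S_def phi_def X_def by measurable
  have le: "cmod (Psi t l) \<le> C * \<tau> + S l / \<tau>" for l
  proof -
    have "cmod (Psi t l) \<le> (\<Sum>\<omega>\<in>Om. N \<omega> * cmod (phi (X t l \<omega>)))"
      unfolding Psi_eq using nonneg by (intro order_trans[OF norm_sum] sum_mono) (simp add: norm_mult)
    also have "\<dots> \<le> (\<Sum>\<omega>\<in>Om. N \<omega> * (\<tau> + (cmod (phi (X t l \<omega>)))\<^sup>2 / \<tau>))"
    proof (intro sum_mono mult_left_mono nonneg)
      fix \<omega>
      let ?z = "cmod (phi (X t l \<omega>))"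
      have "?z * \<tau> \<le> \<tau>\<^sup>2 + ?z\<^sup>2"
        using sum_squares_bound[of ?z \<tau>] \<tau> mult_nonneg_nonneg[of ?z \<tau>] norm_ge_zero[of "phi (X t l \<omega>)"] by linarith
      then show "?z \<le> \<tau> + ?z\<^sup>2 / \<tau>"
        using \<tau> by (simp add: field_simps power2_eq_square)
    qed
    also have "\<dots> = sum N Om * \<tau> + S l / \<tau>"
      unfolding S_def by (simp add: distrib_left sum.distrib sum_distrib_right sum_divide_distrib)
    also have "\<dots> \<le> C * \<tau> + S l / \<tau>"
      using total \<tau> by (intro add_right_mono mult_right_mono) auto
    finally show ?thesis .
  qed
  have "(\<integral>\<^sup>+l\<in>{L..2 * L}. ennreal (cmod (Psi t l)) \<partial>lborel) \<le> (\<integral>\<^sup>+l. ennreal (C * \<tau>) * indicator {L..2 * L} l + ennreal (1 / \<tau>) * (ennreal (S l) * indicator {L..2 * L} l) \<partial>lborel)"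
  proof (intro nn_integral_mono)
    fix l :: real
    show "ennreal (cmod (Psi t l)) * indicator {L..2 * L} l \<le> ennreal (C * \<tau>) * indicator {L..2 * L} l + ennreal (1 / \<tau>) * (ennreal (S l) * indicator {L..2 * L} l)"
    proof (cases "l \<in> {L..2 * L}")
      case True
      have "ennreal (cmod (Psi t l)) \<le> ennreal (C * \<tau> + S l / \<tau>)" by (intro ennreal_leI le)
      also have "\<dots> = ennreal (C * \<tau>) + ennreal (1 / \<tau>) * ennreal (S l)"
        using C_nonneg \<tau> S[of l] by (subst ennreal_plus) (auto simp: ennreal_mult'[symmetric])
      finally show ?thesis using True by simp
    qed simp
  qed
  also have "\<dots> = ennreal (C * \<tau>) * ennreal L + ennreal (1 / \<tau>) * (\<integral>\<^sup>+l\<in>{L..2 * L}. ennreal (S l) \<partial>lborel)"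
    using L by (subst nn_integral_add) (auto simp: nn_integral_cmult nn_integral_cmult_indicator)
  also have "\<dots> \<le> ennreal (C * \<tau>) * ennreal L + ennreal (1 / \<tau>) * ennreal (K * L powr (DIM('a) - s - a))"
    unfolding S_def by (intro add_left_mono mult_left_mono shell_L2[OF L t]) auto
  also have "\<dots> = ennreal (C * \<tau> * L + 1 / \<tau> * (K * L powr (DIM('a) - s - a)))"
    using C_nonneg \<tau> L K_nonneg by (simp add: ennreal_mult'[symmetric] ennreal_plus[symmetric] del: ennreal_plus)
  also have "C * \<tau> * L + 1 / \<tau> * (K * L powr (DIM('a) - s - a)) = (C + K) * L powr - gap"
  proof -
    have "\<tau> * L = L powr - gap"
    proof -
      have "\<tau> * L powr 1 = L powr ((- 1 - gap) + 1)" unfolding \<tau>_def by (rule powr_add[symmetric])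
      then show ?thesis using L by simp
    qed
    moreover have "1 / \<tau> * L powr (DIM('a) - s - a) = L powr - gap"
    proof -
      have "1 / \<tau> = L powr (1 + gap)" unfolding \<tau>_def by (simp add: powr_minus_divide[symmetric] add.commute)
      then have "1 / \<tau> * L powr (DIM('a) - s - a) = L powr ((1 + gap) + (DIM('a) - s - a))"
        by (simp only: powr_add)
      also have "(1 + gap) + (DIM('a) - s - a) = - gap" by (simp add: gap_def field_simps)
      finally show ?thesis .
    qed
    ultimately show ?thesis by (simp only: distrib_right mult.assoc mult.left_commute[of _ K])
  qed
  finally show ?thesis .
qed

lemma cmod_Psi_uminus: "cmod (Psi t (- l)) = cmod (Psi t l)"
proof -
  have "Psi t (- l) = cnj (Psi t l)"
    unfolding Psi_def by (simp add: cis_cnj)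
  then show ?thesis by simp
qed

lemma shell_L1_neg:
  assumes "1 \<le> L" "2 * L * h \<le> 1" "t0 \<le> t" "t \<le> t1"
  shows "(\<integral>\<^sup>+l. ennreal (cmod (Psi t l)) * indicator {L..2 * L} (- l) \<partial>lborel) \<le> ennreal ((C + K) * L powr - gap)"
proof -
  have "(\<integral>\<^sup>+l. ennreal (cmod (Psi t l)) * indicator {L..2 * L} l \<partial>lborel) = (\<integral>\<^sup>+l. ennreal (cmod (Psi t (- l))) * indicator {L..2 * L} (- l) \<partial>lborel)"
    by (subst nn_integral_real_affine[of _ "- 1" 0]) auto
  then show ?thesis using shell_L1[OF assms] by (simp add: cmod_Psi_uminus)
qed

lemma mass_total: "(\<Sum>\<omega>\<in>Om. \<Sum>p\<in>A \<times> {..<J}. N \<omega> * (m (fst p) / J)) = sum N Om * sum m A"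
  unfolding sum_distrib_left[symmetric] mass_I sum_distrib_right[symmetric] ..

lemma mass_total_le: "(\<Sum>\<omega>\<in>Om. \<Sum>p\<in>A \<times> {..<J}. N \<omega> * (m (fst p) / J)) \<le> C\<^sup>2"
  unfolding mass_total power2_eq_square using total nonneg C_nonneg
  by (intro mult_mono sum_nonneg) auto

lemma coeff_nonneg: "\<omega> \<in> Om \<Longrightarrow> p \<in> A \<times> {..<J} \<Longrightarrow> 0 \<le> N \<omega> * (m (fst p) / J)"
  using nonneg by auto

lemma cmod_Psi_le: "cmod (Psi t l) \<le> C\<^sup>2"
proof -
  have "cmod (Psi t l) \<le> (\<Sum>\<omega>\<in>Om. \<Sum>p\<in>A \<times> {..<J}. N \<omega> * (m (fst p) / J))"
    unfolding Psi_def using nonneg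
    by (intro order_trans[OF norm_sum] sum_mono) (auto simp: norm_mult norm_divide)
  with mass_total_le show ?thesis by simp
qed

text \<open>Each phase is Lipschitz in t with constant r |l| \<le> 2 |l|. The bound deteriorates
  with l and serves for the low frequencies.\<close>

lemma cmod_Psi_diff_le: "cmod (Psi t l - Psi t' l) \<le> C\<^sup>2 * (2 * \<bar>l\<bar> * \<bar>t - t'\<bar>)"
proof -
  have "cmod (Psi t l - Psi t' l) \<le> (\<Sum>\<omega>\<in>Om. \<Sum>p\<in>A \<times> {..<J}. N \<omega> * (m (fst p) / J) * (2 * \<bar>l\<bar> * \<bar>t - t'\<bar>))"
    unfolding Psi_def sum_subtractf[symmetric]
  proof (intro order_trans[OF norm_sum] sum_mono)
    fix \<omega> p assume \<omega>: "\<omega> \<in> Om" and p: "p \<in> A \<times> {..<J}"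
    let ?x = "l * (r (snd p) * (v \<omega> \<bullet> fst p - t))" and ?y = "l * (r (snd p) * (v \<omega> \<bullet> fst p - t'))"
    have "cmod (cis ?x - cis ?y) \<le> \<bar>?x - ?y\<bar>" by (rule cmod_cis_diff_le)
    also have "?x - ?y = r (snd p) * (l * (t' - t))" by (simp add: algebra_simps)
    also have "\<bar>\<dots>\<bar> = r (snd p) * (\<bar>l\<bar> * \<bar>t - t'\<bar>)"
      using p r_bounds[of "snd p"] by (auto simp: abs_mult)
    also have "\<dots> \<le> 2 * (\<bar>l\<bar> * \<bar>t - t'\<bar>)"
      using p r_bounds[of "snd p"] by (intro mult_right_mono) auto
    finally have "N \<omega> * (m (fst p) / J) * cmod (cis ?x - cis ?y) \<le> N \<omega> * (m (fst p) / J) * (2 * \<bar>l\<bar> * \<bar>t - t'\<bar>)"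
      using coeff_nonneg[OF \<omega> p] by (intro mult_left_mono) auto
    then show "cmod (of_real (N \<omega> * (m (fst p) / J)) * cis ?x - of_real (N \<omega> * (m (fst p) / J)) * cis ?y) \<le> N \<omega> * (m (fst p) / J) * (2 * \<bar>l\<bar> * \<bar>t - t'\<bar>)"
      unfolding right_diff_distrib[symmetric] norm_mult norm_of_real abs_of_nonneg[OF coeff_nonneg[OF \<omega> p]] .
  qed
  also have "\<dots> = (\<Sum>\<omega>\<in>Om. \<Sum>p\<in>A \<times> {..<J}. N \<omega> * (m (fst p) / J)) * (2 * \<bar>l\<bar> * \<bar>t - t'\<bar>)"
    by (simp only: sum_distrib_right)
  also have "\<dots> \<le> C\<^sup>2 * (2 * \<bar>l\<bar> * \<bar>t - t'\<bar>)"
    by (intro mult_right_mono mass_total_le) auto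
  finally show ?thesis .
qed

lemma Psi_gaussian_integral:
  assumes "\<epsilon> > 0"
  shows "has_bochner_integral lborel (\<lambda>l. Psi t l * of_real (exp (- (\<epsilon> * l)\<^sup>2 / 2))) (of_real (dens \<epsilon> t))"
proof -
  have g: "has_bochner_integral lborel (\<lambda>l. cis (l * x) * of_real (exp (- (\<epsilon> * l)\<^sup>2 / 2))) (of_real (sqrt (2 * pi) / \<epsilon> * exp (- (x / \<epsilon>)\<^sup>2 / 2)))" for x
    using gaussian_fourier_real[of "1 / \<epsilon>" x] assms by (simp add: power_divide power_mult_distrib mult.commute)
  have "has_bochner_integral lborel (\<lambda>l. \<Sum>\<omega>\<in>Om. \<Sum>p\<in>A \<times> {..<J}. complex_of_real (N \<omega> * (m (fst p) / J)) * (cis (l * (r (snd p) * (v \<omega> \<bullet> fst p - t))) * of_real (exp (- (\<epsilon> * l)\<^sup>2 / 2))))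
    (\<Sum>\<omega>\<in>Om. \<Sum>p\<in>A \<times> {..<J}. complex_of_real (N \<omega> * (m (fst p) / J)) * of_real (sqrt (2 * pi) / \<epsilon> * exp (- (r (snd p) * (v \<omega> \<bullet> fst p - t) / \<epsilon>)\<^sup>2 / 2)))"
    by (intro has_bochner_integral_sum has_bochner_integral_mult_right g)
  then show ?thesis
    unfolding Psi_def dens_def of_real_sum of_real_mult sum_distrib_right mult.assoc by simp
qed

text \<open>Three ranges of frequency: up to 2^n0 the Lipschitz bound in t; on the dyadic shells up
  to 2^n the L1 bound, for t and t' separately and for both signs, hence the factor 4; beyond 2^n,
  where the Frostman hypotheses say nothing, the trivial bound 2 C^2 against the Gaussian
  cutoff.\<close>

lemma dens_diff_le:
  assumes \<epsilon>: "\<epsilon> > 0" and n: "n0 \<le> n" "2 ^ n * h \<le> 1" and t: "t \<in> {t0..t1}" "t' \<in> {t0..t1}"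
  shows "\<bar>dens \<epsilon> t - dens \<epsilon> t'\<bar> \<le> 4 * C\<^sup>2 * 4 ^ n0 * \<bar>t - t'\<bar> + 4 * (C + K) * (\<Sum>j\<in>{n0..<n}. (2 ^ j) powr - gap)
    + 4 * C\<^sup>2 * exp (- (\<epsilon> * 2 ^ n)\<^sup>2 / 4) * sqrt pi / \<epsilon>"
proof -
  let ?e = "\<lambda>l. exp (- (\<epsilon> * l)\<^sup>2 / 2)"
  let ?I = "\<lambda>j. {2 ^ j..2 * 2 ^ j :: real}"
  \<comment> \<open>The Lipschitz bound at |l| = 2^n0; multiplied by the length 2 * 2^n0 of the low
    range it gives the term with 4^n0.\<close>
  define a0 where "a0 = C\<^sup>2 * (2 * 2 ^ n0 * \<bar>t - t'\<bar>)"
  define a2 where "a2 = 2 * C\<^sup>2 * exp (- (\<epsilon> * 2 ^ n)\<^sup>2 / 4)"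
  define F where "F = (\<lambda>\<tau> j l. ennreal (cmod (Psi \<tau> l)) * indicator (?I j) l + ennreal (cmod (Psi \<tau> l)) * indicator (?I j) (- l))"
  have a: "a0 \<ge> 0" "a2 \<ge> 0" unfolding a0_def a2_def by auto
  have "has_bochner_integral lborel (\<lambda>l. Psi t l * of_real (?e l) - Psi t' l * of_real (?e l)) (of_real (dens \<epsilon> t) - of_real (dens \<epsilon> t'))"
    by (intro has_bochner_integral_diff Psi_gaussian_integral \<epsilon>)
  then have "has_bochner_integral lborel (\<lambda>l. (Psi t l - Psi t' l) * of_real (?e l)) (of_real (dens \<epsilon> t - dens \<epsilon> t'))"
    by (simp add: left_diff_distrib)
  then have int: "integrable lborel (\<lambda>l. (Psi t l - Psi t' l) * of_real (?e l))" "(\<integral>l. (Psi t l - Psi t' l) * of_real (?e l) \<partial>lborel) = of_real (dens \<epsilon> t - dens \<epsilon> t')"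
    by (auto simp: has_bochner_integral_iff)
  have "ennreal \<bar>dens \<epsilon> t - dens \<epsilon> t'\<bar> = ennreal (norm (\<integral>l. (Psi t l - Psi t' l) * of_real (?e l) \<partial>lborel))"
    unfolding int by (simp del: of_real_diff)
  also have "\<dots> \<le> (\<integral>\<^sup>+l. ennreal (norm ((Psi t l - Psi t' l) * of_real (?e l))) \<partial>lborel)"
    by (rule integral_norm_bound_ennreal[OF int(1)])
  also have "\<dots> \<le> (\<integral>\<^sup>+l. ennreal a0 * indicator {- (2 ^ n0)..2 ^ n0} l + (\<Sum>j\<in>{n0..<n}. F t j l + F t' j l) + ennreal a2 * ennreal (exp (- (0 + l * \<epsilon>)\<^sup>2 / 4)) \<partial>lborel)"
  proof (intro nn_integral_mono)
    fix l :: real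
    let ?z = "norm ((Psi t l - Psi t' l) * of_real (?e l))"
    have z: "?z = cmod (Psi t l - Psi t' l) * ?e l" by (simp add: norm_mult)
    have z1: "?z \<le> cmod (Psi t l - Psi t' l)" unfolding z by (intro mult_left_le) auto
    have z2: "cmod (Psi t l - Psi t' l) \<le> cmod (Psi t l) + cmod (Psi t' l)" by (rule norm_triangle_ineq4)
    consider "\<bar>l\<bar> \<le> 2 ^ n0" | j where "j \<in> {n0..<n}" "2 ^ j \<le> \<bar>l\<bar>" "\<bar>l\<bar> \<le> 2 * 2 ^ j" | "\<bar>l\<bar> \<ge> 2 ^ n"
      using dyadic_shell[OF n(1), of "\<bar>l\<bar>"] by fastforce
    then show "ennreal ?z \<le> ennreal a0 * indicator {- (2 ^ n0)..2 ^ n0} l + (\<Sum>j\<in>{n0..<n}. F t j l + F t' j l) + ennreal a2 * ennreal (exp (- (0 + l * \<epsilon>)\<^sup>2 / 4))"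
    proof cases
      case 1
      have "?z \<le> C\<^sup>2 * (2 * \<bar>l\<bar> * \<bar>t - t'\<bar>)" using z1 cmod_Psi_diff_le[of t l t'] by simp
      also have "\<dots> \<le> a0" unfolding a0_def using 1 by (intro mult_left_mono mult_right_mono) auto
      finally have "ennreal ?z \<le> ennreal a0 * indicator {- (2 ^ n0)..2 ^ n0} l" 
      proof -
        have "indicator {- (2 ^ n0)..2 ^ n0} l = (1::ennreal)" using 1 by (simp add: indicator_def) linarith
        then show ?thesis if "?z \<le> a0" using that by (simp add: ennreal_leI)
      qed
      then show ?thesis by (intro add_increasing2) auto
    next
      case 2
      have "ennreal ?z \<le> ennreal (cmod (Psi t l)) + ennreal (cmod (Psi t' l))"
        using z1 z2 by (subst ennreal_plus[symmetric]) (auto intro!: ennreal_leI simp del: ennreal_plus)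
      also have "\<dots> \<le> F t j l + F t' j l"
        unfolding F_def using 2(2,3) by (intro add_mono) (auto simp: indicator_def abs_if split: if_splits)
      also have "\<dots> \<le> (\<Sum>j\<in>{n0..<n}. F t j l + F t' j l)"
        using 2(1) by (intro member_le_sum) auto
      finally show ?thesis by (intro add_increasing2 add_increasing) auto
    next
      case 3
      \<comment> \<open>The cutoff exponent is halved: one half is frozen at |l| = 2^n and yields
        the small factor in \<open>a2\<close>, the other half remains integrable.\<close>
      have "(\<epsilon> * 2 ^ n)\<^sup>2 \<le> (\<epsilon> * \<bar>l\<bar>)\<^sup>2" using 3 \<epsilon> by (intro power_mono mult_left_mono) auto
      then have "- (\<epsilon> * l)\<^sup>2 / 2 \<le> - (\<epsilon> * 2 ^ n)\<^sup>2 / 4 + - (\<epsilon> * l)\<^sup>2 / 4"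
        by (simp add: power_mult_distrib)
      then have "?e l \<le> exp (- (\<epsilon> * 2 ^ n)\<^sup>2 / 4) * exp (- (\<epsilon> * l)\<^sup>2 / 4)"
        by (simp only: exp_add[symmetric] exp_le_cancel_iff)
      moreover have "cmod (Psi t l - Psi t' l) \<le> 2 * C\<^sup>2" using z2 cmod_Psi_le[of t l] cmod_Psi_le[of t' l] by linarith
      ultimately have "?z \<le> (2 * C\<^sup>2) * (exp (- (\<epsilon> * 2 ^ n)\<^sup>2 / 4) * exp (- (\<epsilon> * l)\<^sup>2 / 4))"
        unfolding z by (intro mult_mono) auto
      then have "ennreal ?z \<le> ennreal (a2 * exp (- (0 + l * \<epsilon>)\<^sup>2 / 4))"
        unfolding a2_def by (intro ennreal_leI) (simp only: mult_ac add_0)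
      then show ?thesis using a by (intro add_increasing) (auto simp: ennreal_mult)
    qed
  qed
  also have "\<dots> = (\<integral>\<^sup>+l. ennreal a0 * indicator {- (2 ^ n0)..2 ^ n0 :: real} l \<partial>lborel) + (\<Sum>j\<in>{n0..<n}. (\<integral>\<^sup>+l. F t j l \<partial>lborel) + (\<integral>\<^sup>+l. F t' j l \<partial>lborel))
     + ennreal a2 * (\<integral>\<^sup>+l. ennreal (exp (- (0 + l * \<epsilon>)\<^sup>2 / 4)) \<partial>lborel)"
    unfolding F_def by (simp add: nn_integral_add nn_integral_sum nn_integral_cmult)
  also have "\<dots> \<le> ennreal (a0 * (2 * 2 ^ n0)) + (\<Sum>j\<in>{n0..<n}. ennreal (4 * ((C + K) * (2 ^ j) powr - gap))) + ennreal (a2 * (2 * sqrt pi / \<epsilon>))"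
  proof (intro add_mono sum_mono)
    show "(\<integral>\<^sup>+l. ennreal a0 * indicator {- (2 ^ n0)..2 ^ n0 :: real} l \<partial>lborel) \<le> ennreal (a0 * (2 * 2 ^ n0))"
      using a by (subst nn_integral_cmult_indicator) (auto simp: ennreal_mult'[symmetric])
    show "ennreal a2 * (\<integral>\<^sup>+l. ennreal (exp (- (0 + l * \<epsilon>)\<^sup>2 / 4)) \<partial>lborel) \<le> ennreal (a2 * (2 * sqrt pi / \<epsilon>))"
      unfolding nn_integral_gaussian_affine[OF \<epsilon>] using a by (simp add: ennreal_mult'[symmetric])
  next
    fix j assume j: "j \<in> {n0..<n}"
    let ?b = "(C + K) * (2 ^ j) powr - gap"
    \<comment> \<open>Since j < n, the top 2 * 2^j of the shell is at most 2^n, which meets the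
      scale condition of the shell estimate.\<close>
    have "2 * 2 ^ j * h \<le> 2 ^ n * h"
      using j hJ power_increasing[of "Suc j" n "2::real"] by (intro mult_right_mono) auto
    then have jh: "2 * 2 ^ j * h \<le> 1" using n by simp
    have F: "(\<integral>\<^sup>+l. F \<tau> j l \<partial>lborel) \<le> ennreal ?b + ennreal ?b" if "\<tau> \<in> {t0..t1}" for \<tau>
      unfolding F_def using that jh
      by (subst nn_integral_add) (auto intro!: add_mono shell_L1 shell_L1_neg)
    have b: "?b \<ge> 0" using C_nonneg K_nonneg by simp
    have "(\<integral>\<^sup>+l. F t j l \<partial>lborel) + (\<integral>\<^sup>+l. F t' j l \<partial>lborel) \<le> (ennreal ?b + ennreal ?b) + (ennreal ?b + ennreal ?b)"
      using t by (intro add_mono F)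
    also have "\<dots> = ennreal (4 * ?b)"
      using b by (simp add: ennreal_plus[symmetric] del: ennreal_plus)
    finally show "(\<integral>\<^sup>+l. F t j l \<partial>lborel) + (\<integral>\<^sup>+l. F t' j l \<partial>lborel) \<le> ennreal (4 * ?b)" .
  qed
  also have "\<dots> = ennreal (a0 * (2 * 2 ^ n0) + (\<Sum>j\<in>{n0..<n}. 4 * ((C + K) * (2 ^ j) powr - gap)) + a2 * (2 * sqrt pi / \<epsilon>))"
    using a C_nonneg K_nonneg \<epsilon> by (subst sum_ennreal) (auto simp: ennreal_plus[symmetric] sum_nonneg simp del: ennreal_plus)
  finally have "\<bar>dens \<epsilon> t - dens \<epsilon> t'\<bar> \<le> a0 * (2 * 2 ^ n0) + (\<Sum>j\<in>{n0..<n}. 4 * ((C + K) * (2 ^ j) powr - gap)) + a2 * (2 * sqrt pi / \<epsilon>)"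
    using a C_nonneg K_nonneg \<epsilon> by (subst (asm) ennreal_le_iff) (auto intro!: add_nonneg_nonneg sum_nonneg)
  also have "a0 * (2 * 2 ^ n0) = 4 * C\<^sup>2 * 4 ^ n0 * \<bar>t - t'\<bar>"
  proof -
    have "(4::real) ^ n0 = 2 ^ n0 * 2 ^ n0" by (simp flip: power_mult_distrib)
    then show ?thesis unfolding a0_def by simp
  qed
  also have "(\<Sum>j\<in>{n0..<n}. 4 * ((C + K) * (2 ^ j) powr - gap)) = 4 * (C + K) * (\<Sum>j\<in>{n0..<n}. (2 ^ j) powr - gap)"
    by (simp only: sum_distrib_left mult.assoc)
  also have "a2 * (2 * sqrt pi / \<epsilon>) = 4 * C\<^sup>2 * exp (- (\<epsilon> * 2 ^ n)\<^sup>2 / 4) * sqrt pi / \<epsilon>"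
    unfolding a2_def by simp
  finally show ?thesis .
qed

end

section \<open>From bounds on the density to an interval of approximate values\<close>

context bilinear_config begin

text \<open>On whichever side of u there is room, an interval of length \<open>\<epsilon>\<close>
  with endpoint u fits into [t0, t1]. On it the Gaussian argument is at most 2 in modulus because r
  \<le> 2, so the integrand is at least its value at 2.\<close>

lemma gaussian_window:
  assumes \<epsilon>: "0 < \<epsilon>" "2 * \<epsilon> \<le> t1 - t0" and u: "u \<in> {t0..t1}" and i: "i < J"
  shows "ennreal (sqrt (2 * pi) * exp (- 2)) \<le> (\<integral>\<^sup>+t\<in>{t0..t1}. ennreal (sqrt (2 * pi) / \<epsilon> * exp (- (r i * (u - t) / \<epsilon>)\<^sup>2 / 2)) \<partial>lborel)"
proof -
  define b where "b = (if u + \<epsilon> \<le> t1 then u else u - \<epsilon>)"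
  have b: "t0 \<le> b" "b + \<epsilon> \<le> t1" "b \<le> u" "u \<le> b + \<epsilon>"
    using \<epsilon> u by (auto simp: b_def)
  have "ennreal (sqrt (2 * pi) * exp (- 2)) = (\<integral>\<^sup>+t. ennreal (sqrt (2 * pi) / \<epsilon> * exp (- 2)) * indicator {b..b + \<epsilon>} t \<partial>lborel)"
    using \<epsilon> by (subst nn_integral_cmult_indicator) (auto simp: ennreal_mult'[symmetric])
  also have "\<dots> \<le> (\<integral>\<^sup>+t\<in>{t0..t1}. ennreal (sqrt (2 * pi) / \<epsilon> * exp (- (r i * (u - t) / \<epsilon>)\<^sup>2 / 2)) \<partial>lborel)"
  proof (intro nn_integral_mono)
    fix t :: real
    show "ennreal (sqrt (2 * pi) / \<epsilon> * exp (- 2)) * indicator {b..b + \<epsilon>} t \<le> ennreal (sqrt (2 * pi) / \<epsilon> * exp (- (r i * (u - t) / \<epsilon>)\<^sup>2 / 2)) * indicator {t0..t1} t"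
    proof (cases "t \<in> {b..b + \<epsilon>}")
      case True
      then have "\<bar>u - t\<bar> \<le> \<epsilon>" using b by auto
      then have "r i * \<bar>u - t\<bar> \<le> 2 * \<epsilon>"
        using r_bounds[OF i] by (intro mult_mono) auto
      then have "\<bar>r i * (u - t) / \<epsilon>\<bar> \<le> 2"
        using r_bounds[OF i] \<epsilon> unfolding abs_divide abs_mult by (simp add: divide_le_eq)
      then have "\<bar>r i * (u - t) / \<epsilon>\<bar>\<^sup>2 \<le> 2\<^sup>2" by (intro power_mono) auto
      then have "exp (- 2) \<le> exp (- (r i * (u - t) / \<epsilon>)\<^sup>2 / 2)" unfolding power2_abs by simp
      then show ?thesis using True b \<epsilon> by (auto intro!: ennreal_leI divide_right_mono)
    qed simp
  qed
  finally show ?thesis .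
qed

text \<open>All values lie in [t0, t1], so the integral of \<open>dens\<close> over this interval is
  at least sqrt(2 pi) exp(-2) times the total mass, and the mean value is attained up to a constant.
  The weaker exp(-3) makes the contradiction strict.\<close>

lemma dens_large_somewhere:
  assumes \<epsilon>: "0 < \<epsilon>" "2 * \<epsilon> \<le> t1 - t0" and range: "\<And>\<omega> y. \<omega> \<in> Om \<Longrightarrow> y \<in> A \<Longrightarrow> v \<omega> \<bullet> y \<in> {t0..t1}"
    and pos: "sum N Om * sum m A > 0"
  shows "\<exists>t\<in>{t0..t1}. dens \<epsilon> t \<ge> sqrt (2 * pi) * exp (- 3) * (sum N Om * sum m A) / (t1 - t0)"
proof (rule ccontr)
  define T where "T = sum N Om * sum m A"
  define q where "q = sqrt (2 * pi) * exp (- 3) * T / (t1 - t0)"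
  assume "\<not> ?thesis"
  then have small: "dens \<epsilon> t \<le> q" if "t \<in> {t0..t1}" for t
    using that unfolding q_def T_def by force
  have q: "q \<ge> 0" unfolding q_def using pos t01 by (simp add: T_def)
  let ?w = "\<lambda>\<omega> p. N \<omega> * (m (fst p) / J)"
  let ?g = "\<lambda>\<omega> p t. sqrt (2 * pi) / \<epsilon> * exp (- (r (snd p) * (v \<omega> \<bullet> fst p - t) / \<epsilon>)\<^sup>2 / 2)"
  have "ennreal (sqrt (2 * pi) * exp (- 2) * T) = (\<Sum>\<omega>\<in>Om. \<Sum>p\<in>A \<times> {..<J}. ennreal (?w \<omega> p) * ennreal (sqrt (2 * pi) * exp (- 2)))"
  proof -
    have "sqrt (2 * pi) * exp (- 2) * T = (\<Sum>\<omega>\<in>Om. \<Sum>p\<in>A \<times> {..<J}. ?w \<omega> p * (sqrt (2 * pi) * exp (- 2)))"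
      unfolding sum_distrib_right[symmetric] mass_total T_def by (simp only: mult.commute)
    also have "ennreal \<dots> = (\<Sum>\<omega>\<in>Om. \<Sum>p\<in>A \<times> {..<J}. ennreal (?w \<omega> p * (sqrt (2 * pi) * exp (- 2))))"
      using nonneg by (subst sum_ennreal[symmetric])
        (auto intro!: sum_nonneg sum.cong sum_ennreal[symmetric] simp del: sum_ennreal)
    also have "\<dots> = (\<Sum>\<omega>\<in>Om. \<Sum>p\<in>A \<times> {..<J}. ennreal (?w \<omega> p) * ennreal (sqrt (2 * pi) * exp (- 2)))"
      by (intro sum.cong refl ennreal_mult'') auto
    finally show ?thesis .
  qed
  also have "\<dots> \<le> (\<Sum>\<omega>\<in>Om. \<Sum>p\<in>A \<times> {..<J}. ennreal (?w \<omega> p) * (\<integral>\<^sup>+t\<in>{t0..t1}. ennreal (?g \<omega> p t) \<partial>lborel))"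
    by (intro sum_mono mult_left_mono gaussian_window \<epsilon> range) auto
  also have "\<dots> = (\<integral>\<^sup>+t. (\<Sum>\<omega>\<in>Om. \<Sum>p\<in>A \<times> {..<J}. ennreal (?w \<omega> p) * (ennreal (?g \<omega> p t) * indicator {t0..t1} t)) \<partial>lborel)"
    by (simp add: nn_integral_sum nn_integral_cmult)
  also have "\<dots> \<le> (\<integral>\<^sup>+t. ennreal q * indicator {t0..t1} t \<partial>lborel)"
  proof (intro nn_integral_mono)
    fix t
    show "(\<Sum>\<omega>\<in>Om. \<Sum>p\<in>A \<times> {..<J}. ennreal (?w \<omega> p) * (ennreal (?g \<omega> p t) * indicator {t0..t1} t)) \<le> ennreal q * indicator {t0..t1} t"
    proof (cases "t \<in> {t0..t1}")
      case True
      have "(\<Sum>\<omega>\<in>Om. \<Sum>p\<in>A \<times> {..<J}. ennreal (?w \<omega> p) * (ennreal (?g \<omega> p t) * indicator {t0..t1} t))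
        = (\<Sum>\<omega>\<in>Om. \<Sum>p\<in>A \<times> {..<J}. ennreal (?w \<omega> p) * ennreal (?g \<omega> p t))"
        using True by simp
      also have "\<dots> = (\<Sum>\<omega>\<in>Om. \<Sum>p\<in>A \<times> {..<J}. ennreal (?w \<omega> p * ?g \<omega> p t))"
        using \<epsilon> by (intro sum.cong refl ennreal_mult''[symmetric]) auto
      also have "\<dots> = ennreal (dens \<epsilon> t)"
        unfolding dens_def using nonneg \<epsilon>
        by (subst sum_ennreal[symmetric])
          (auto intro!: sum_nonneg sum.cong sum_ennreal simp del: sum_ennreal)
      also have "\<dots> \<le> ennreal q" by (intro ennreal_leI small True)
      finally show ?thesis using True by simp
    qed simp
  qed
  also have "\<dots> = ennreal (q * (t1 - t0))"
    using t01 q by (subst nn_integral_cmult_indicator) (auto simp: ennreal_mult'[symmetric])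
  finally have "sqrt (2 * pi) * exp (- 2) * T \<le> q * (t1 - t0)"
    using q t01 by (subst (asm) ennreal_le_iff) auto
  also have "\<dots> = sqrt (2 * pi) * exp (- 3) * T" using t01 by (simp add: q_def)
  also have "\<dots> < sqrt (2 * pi) * exp (- 2) * T"
    using pos by (intro mult_strict_right_mono mult_strict_left_mono) (auto simp: T_def)
  finally show False by simp
qed

text \<open>Dilations r \<ge> 1 only increase the distance to 0, so every Gaussian is at most its
  value at \<open>\<delta> / \<epsilon>\<close>. Read contrapositively: a density that is not tiny
  at t produces a value within \<open>\<delta>\<close> of t.\<close>

lemma dens_le_if_far:
  assumes \<epsilon>: "0 < \<epsilon>" and \<delta>: "0 \<le> \<delta>" and far: "\<And>\<omega> y. \<omega> \<in> Om \<Longrightarrow> y \<in> A \<Longrightarrow> \<delta> \<le> \<bar>v \<omega> \<bullet> y - t\<bar>"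
  shows "dens \<epsilon> t \<le> C\<^sup>2 * (sqrt (2 * pi) / \<epsilon> * exp (- (\<delta> / \<epsilon>)\<^sup>2 / 2))"
proof -
  have "dens \<epsilon> t \<le> (\<Sum>\<omega>\<in>Om. \<Sum>p\<in>A \<times> {..<J}. N \<omega> * (m (fst p) / J) * (sqrt (2 * pi) / \<epsilon> * exp (- (\<delta> / \<epsilon>)\<^sup>2 / 2)))"
    unfolding dens_def
  proof (intro sum_mono mult_left_mono coeff_nonneg)
    fix \<omega> p assume \<omega>: "\<omega> \<in> Om" and p: "p \<in> A \<times> {..<J}"
    have "\<delta> \<le> r (snd p) * \<bar>v \<omega> \<bullet> fst p - t\<bar>"
      using far[OF \<omega>, of "fst p"] p r_bounds(1)[of "snd p"] mult_right_mono[of 1 "r (snd p)" "\<bar>v \<omega> \<bullet> fst p - t\<bar>"] by auto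
    also have "\<dots> = \<bar>r (snd p) * (v \<omega> \<bullet> fst p - t)\<bar>"
      using p r_bounds(1)[of "snd p"] by (auto simp: abs_mult)
    finally have "(\<delta> / \<epsilon>)\<^sup>2 \<le> \<bar>r (snd p) * (v \<omega> \<bullet> fst p - t) / \<epsilon>\<bar>\<^sup>2"
      using \<epsilon> \<delta> by (intro power_mono) (auto simp: abs_divide divide_right_mono)
    then show "exp (- (r (snd p) * (v \<omega> \<bullet> fst p - t) / \<epsilon>)\<^sup>2 / 2) \<le> exp (- (\<delta> / \<epsilon>)\<^sup>2 / 2)"
      unfolding power2_abs by simp
  qed (use \<epsilon> in auto)
  also have "\<dots> = (\<Sum>\<omega>\<in>Om. \<Sum>p\<in>A \<times> {..<J}. N \<omega> * (m (fst p) / J)) * (sqrt (2 * pi) / \<epsilon> * exp (- (\<delta> / \<epsilon>)\<^sup>2 / 2))"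
    by (simp only: sum_distrib_right)
  also have "\<dots> \<le> C\<^sup>2 * (sqrt (2 * pi) / \<epsilon> * exp (- (\<delta> / \<epsilon>)\<^sup>2 / 2))"
    using \<epsilon> by (intro mult_right_mono mass_total_le) auto
  finally show ?thesis .
qed

end

lemma geometric_sum_interval:
  fixes q :: real
  assumes "n0 \<le> n" "q \<noteq> 1"
  shows "(\<Sum>j\<in>{n0..<n}. q ^ j) = (q ^ n0 - q ^ n) / (1 - q)"
  using assms(1)
proof (induction n rule: dec_induct)
  case (step n)
  then have "(\<Sum>j\<in>{n0..<Suc n}. q ^ j) = (q ^ n0 - q ^ n) / (1 - q) + q ^ n" by simp
  also have "\<dots> = (q ^ n0 - q ^ Suc n) / (1 - q)" using assms(2) by (simp add: field_simps)
  finally show ?case .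
qed simp

text \<open>The order of choices matters: \<open>n0\<close> makes the dyadic tail small, then
  \<open>\<kappa>\<close> makes the Lipschitz term small, and only the threshold for n depends on
  \<open>\<delta>\<close>. The three error terms together stay below 3/8 of \<open>c1\<close>, so
  within \<open>\<kappa>\<close> of a point of density at least \<open>c1\<close> the density
  exceeds \<open>c1\<close> / 2, while a gap of size \<open>\<delta>\<close> in the values would
  push it below.\<close>

lemma bilinear_values_near_interval:
  fixes s a C B t0 t1 c :: real
  defines "K \<equiv> shell_const DIM('a::euclidean_space) s a C B t0 t1" and "gap \<equiv> (s + a - DIM('a) - 1) / 2"
  assumes c: "c > 0" and gap: "s + a > DIM('a) + 1" and t01: "t0 < t1"
  shows "\<exists>\<kappa>>0. \<forall>\<delta>>0. eventually (\<lambda>n. \<forall>(A::'a set) m (Om::'i set) N v J.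
       bilinear_config A m Om N v s a C B t0 t1 (1 / 2 ^ n) K gap J \<longrightarrow> c \<le> sum m A \<longrightarrow> c \<le> sum N Om \<longrightarrow>
       (\<forall>\<omega>\<in>Om. \<forall>y\<in>A. v \<omega> \<bullet> y \<in> {t0..t1}) \<longrightarrow>
       (\<exists>ts\<in>{t0..t1}. \<forall>t\<in>{t0..t1}. \<bar>t - ts\<bar> \<le> \<kappa> \<longrightarrow> (\<exists>\<omega>\<in>Om. \<exists>y\<in>A. \<bar>v \<omega> \<bullet> y - t\<bar> < \<delta>))) sequentially"
proof -
  define c1 where "c1 = sqrt (2 * pi) * exp (- 3) * (c * c) / (t1 - t0)"
  have c1: "c1 > 0" unfolding c1_def using c t01 by simp
  \<comment> \<open>The hypothesis s + a > d + 1 enters here: the shell bounds form a geometric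
    series with ratio q < 1.\<close>
  define q where "q = (2::real) powr - gap"
  have q: "0 < q" "q < 1"
    unfolding q_def using gap by (auto simp: gap_def powr_less_one)
  have "(\<lambda>n. 4 * \<bar>C + K\<bar> / (1 - q) * q ^ n) \<longlonglongrightarrow> 4 * \<bar>C + K\<bar> / (1 - q) * 0"
    by (intro tendsto_mult_left LIMSEQ_realpow_zero) (use q in auto)
  then have "eventually (\<lambda>n. 4 * \<bar>C + K\<bar> / (1 - q) * q ^ n < c1 / 8) sequentially"
    by (intro order_tendstoD(2)) (use c1 in auto)
  \<comment> \<open>\<open>n0\<close> is fixed before any configuration is given, hence before C
    \<ge> 0 is known; this explains the absolute value of C + K.\<close>
  then obtain n0 where n0: "4 * \<bar>C + K\<bar> / (1 - q) * q ^ n0 < c1 / 8"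
    by (auto simp: eventually_sequentially)
  \<comment> \<open>The added 1 keeps the denominator positive when C = 0.\<close>
  define \<kappa> where "\<kappa> = c1 / (8 * (4 * C\<^sup>2 * 4 ^ n0 + 1))"
  have \<kappa>: "\<kappa> > 0" unfolding \<kappa>_def using c1 by (intro divide_pos_pos mult_pos_pos add_nonneg_pos) auto
  have \<kappa>1: "4 * C\<^sup>2 * 4 ^ n0 * \<kappa> \<le> c1 / 8"
  proof -
    have p: "4 * C\<^sup>2 * 4 ^ n0 + 1 > 0" by (intro add_nonneg_pos) auto
    have "4 * C\<^sup>2 * 4 ^ n0 * \<kappa> \<le> (4 * C\<^sup>2 * 4 ^ n0 + 1) * \<kappa>" using \<kappa> by simp
    also have "\<dots> = c1 / 8" unfolding \<kappa>_def using p by (simp add: field_simps)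
    finally show ?thesis .
  qed
  have pow: "filterlim (\<lambda>n. (2::real) ^ n) at_top sequentially"
    by real_asymp
  show ?thesis
  proof (intro exI[of _ \<kappa>] conjI \<kappa> allI impI)
    fix \<delta> :: real assume \<delta>: "\<delta> > 0"
    \<comment> \<open>M stands for 2^n and 1 / sqrt M for \<open>\<epsilon>\<close>, so that
      (\<epsilon> 2^n)^2 = M: the smoothing scale tends to 0, yet stays coarse enough that the
      cutoff kills all frequencies beyond 2^n.\<close>
    have "eventually (\<lambda>M::real. 2 * (1 / sqrt M) < t1 - t0) at_top"
    proof (rule order_tendstoD(2))
      show "((\<lambda>M. 2 * (1 / sqrt M)) \<longlongrightarrow> 0) at_top" by real_asymp
    qed (use t01 in auto)
    moreover have "eventually (\<lambda>M::real. 4 * C\<^sup>2 * exp (- M / 4) * sqrt pi / (1 / sqrt M) < c1 / 8) at_top"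
    proof (rule order_tendstoD(2))
      show "((\<lambda>M. 4 * C\<^sup>2 * exp (- M / 4) * sqrt pi / (1 / sqrt M)) \<longlongrightarrow> 0) at_top" by real_asymp
    qed (use c1 in auto)
    moreover have "eventually (\<lambda>M::real. C\<^sup>2 * (sqrt (2 * pi) / (1 / sqrt M) * exp (- (\<delta> / (1 / sqrt M))\<^sup>2 / 2)) < c1 / 2) at_top"
    proof (rule order_tendstoD(2))
      show "((\<lambda>M. C\<^sup>2 * (sqrt (2 * pi) / (1 / sqrt M) * exp (- (\<delta> / (1 / sqrt M))\<^sup>2 / 2))) \<longlongrightarrow> 0) at_top"
        using \<delta> by real_asymp
    qed (use c1 in auto)
    ultimately have "eventually (\<lambda>M::real. 2 * (1 / sqrt M) < t1 - t0 \<and> 4 * C\<^sup>2 * exp (- M / 4) * sqrt pi / (1 / sqrt M) < c1 / 8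
       \<and> C\<^sup>2 * (sqrt (2 * pi) / (1 / sqrt M) * exp (- (\<delta> / (1 / sqrt M))\<^sup>2 / 2)) < c1 / 2) at_top"
      by eventually_elim auto
    from eventually_compose_filterlim[OF this pow] eventually_ge_at_top[of n0]
    show "eventually (\<lambda>n. \<forall>(A::'a set) m (Om::'i set) N v J.
       bilinear_config A m Om N v s a C B t0 t1 (1 / 2 ^ n) K gap J \<longrightarrow> c \<le> sum m A \<longrightarrow> c \<le> sum N Om \<longrightarrow>
       (\<forall>\<omega>\<in>Om. \<forall>y\<in>A. v \<omega> \<bullet> y \<in> {t0..t1}) \<longrightarrow>
       (\<exists>ts\<in>{t0..t1}. \<forall>t\<in>{t0..t1}. \<bar>t - ts\<bar> \<le> \<kappa> \<longrightarrow> (\<exists>\<omega>\<in>Om. \<exists>y\<in>A. \<bar>v \<omega> \<bullet> y - t\<bar> < \<delta>))) sequentially"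
    proof eventually_elim
      case (elim n)
      define \<epsilon> where "\<epsilon> = 1 / sqrt (2 ^ n :: real)"
      have \<epsilon>: "\<epsilon> > 0" by (simp add: \<epsilon>_def)
      have \<epsilon>n: "(\<epsilon> * 2 ^ n)\<^sup>2 = 2 ^ n"
        by (simp add: \<epsilon>_def power_mult_distrib power_divide power2_eq_square)
      show ?case
      proof (intro allI impI)
        fix A :: "'a set" and m and Om :: "'i set" and N v J
        assume cfg: "bilinear_config A m Om N v s a C B t0 t1 (1 / 2 ^ n) K gap J"
          and mA: "c \<le> sum m A" and mO: "c \<le> sum N Om" and range: "\<forall>\<omega>\<in>Om. \<forall>y\<in>A. v \<omega> \<bullet> y \<in> {t0..t1}"
        interpret bilinear_config A m Om N v s a C B t0 t1 "1 / 2 ^ n" K gap J by (rule cfg)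
        have cc: "c * c \<le> sum N Om * sum m A" using c mA mO by (intro mult_mono) auto
        moreover have "c * c > 0" using c by simp
        ultimately have pos: "sum N Om * sum m A > 0" by linarith
        obtain ts where ts: "ts \<in> {t0..t1}" "dens \<epsilon> ts \<ge> sqrt (2 * pi) * exp (- 3) * (sum N Om * sum m A) / (t1 - t0)"
          using dens_large_somewhere[OF \<epsilon> _ _ pos] range elim by (auto simp: \<epsilon>_def)
        have "c1 \<le> dens \<epsilon> ts"
          using ts(2) unfolding c1_def
          by (rule order_trans[rotated]) (intro divide_right_mono mult_left_mono cc; use t01 in simp)
        have geo: "4 * (C + K) * (\<Sum>j\<in>{n0..<n}. (2 ^ j) powr - gap) < c1 / 8"
        proof -
          have "(\<Sum>j\<in>{n0..<n}. (2 ^ j) powr - gap) = (\<Sum>j\<in>{n0..<n}. q ^ j)"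
            unfolding q_def by (intro sum.cong refl) (simp add: powr_powr mult.commute flip: powr_realpow)
          also have "\<dots> = (q ^ n0 - q ^ n) / (1 - q)"
            using elim q by (intro geometric_sum_interval) auto
          also have "\<dots> \<le> q ^ n0 / (1 - q)" using q by (intro divide_right_mono) auto
          finally have "4 * (C + K) * (\<Sum>j\<in>{n0..<n}. (2 ^ j) powr - gap) \<le> 4 * \<bar>C + K\<bar> * (q ^ n0 / (1 - q))"
            using abs_ge_self[of "C + K"] by - (rule mult_mono, auto intro!: sum_nonneg)
          then show ?thesis using n0 by simp
        qed
        show "\<exists>ts\<in>{t0..t1}. \<forall>t\<in>{t0..t1}. \<bar>t - ts\<bar> \<le> \<kappa> \<longrightarrow> (\<exists>\<omega>\<in>Om. \<exists>y\<in>A. \<bar>v \<omega> \<bullet> y - t\<bar> < \<delta>)"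
        proof (intro bexI[OF _ ts(1)] ballI impI, rule ccontr)
          fix t assume t: "t \<in> {t0..t1}" "\<bar>t - ts\<bar> \<le> \<kappa>" and no: "\<not> (\<exists>\<omega>\<in>Om. \<exists>y\<in>A. \<bar>v \<omega> \<bullet> y - t\<bar> < \<delta>)"
          have "dens \<epsilon> t \<le> C\<^sup>2 * (sqrt (2 * pi) / \<epsilon> * exp (- (\<delta> / \<epsilon>)\<^sup>2 / 2))"
            using no \<delta> by (intro dens_le_if_far \<epsilon>) (auto simp: not_less)
          also have "\<dots> < c1 / 2" using elim unfolding \<epsilon>_def by simp
          finally have small: "dens \<epsilon> t < c1 / 2" .
          have "\<bar>dens \<epsilon> t - dens \<epsilon> ts\<bar> \<le> 4 * C\<^sup>2 * 4 ^ n0 * \<bar>t - ts\<bar> + 4 * (C + K) * (\<Sum>j\<in>{n0..<n}. (2 ^ j) powr - gap)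
              + 4 * C\<^sup>2 * exp (- (\<epsilon> * 2 ^ n)\<^sup>2 / 4) * sqrt pi / \<epsilon>"
            using elim by (intro dens_diff_le \<epsilon> t ts) auto
          also have "4 * C\<^sup>2 * 4 ^ n0 * \<bar>t - ts\<bar> \<le> 4 * C\<^sup>2 * 4 ^ n0 * \<kappa>"
            using t by (intro mult_left_mono) auto
          also have "4 * C\<^sup>2 * exp (- (\<epsilon> * 2 ^ n)\<^sup>2 / 4) * sqrt pi / \<epsilon> < c1 / 8"
            unfolding \<epsilon>n using elim unfolding \<epsilon>_def by simp
          finally show False using \<kappa>1 geo small \<open>c1 \<le> dens \<epsilon> ts\<close> c1 by linarith
        qed
      qed
    qed
  qed
qed

subsection \<open>Finitely supported Frostman weights\<close>

text \<open>Vanishing Hausdorff content, with finite covers by balls. No upper bound on the radii is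
  imposed, since for s > 0 a small sum already forces small radii.\<close>

definition content_null :: "real \<Rightarrow> 'a::metric_space set \<Rightarrow> bool" where
  "content_null s A \<longleftrightarrow> (\<forall>e>0. \<exists>F. finite F \<and> A \<subseteq> (\<Union>p\<in>F. cball (fst p) (snd p)) \<and> (\<forall>p\<in>F. 0 < snd p) \<and> (\<Sum>p\<in>F. snd p powr s) < e)"

lemma content_null_subset: "content_null s B \<Longrightarrow> A \<subseteq> B \<Longrightarrow> content_null s A"
  unfolding content_null_def by (meson subset_trans)

lemma content_null_empty: "content_null s {}"
  unfolding content_null_def by (intro allI impI exI[of _ "{}"]) auto

lemma content_null_Un:
  assumes "content_null s A" "content_null s B"
  shows "content_null s (A \<union> B)"
  unfolding content_null_def
proof (intro allI impI)
  fix e :: real assume "e > 0"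
  then have e: "e / 2 > 0" by simp
  obtain F where F: "finite F" "A \<subseteq> (\<Union>p\<in>F. cball (fst p) (snd p))" "\<forall>p\<in>F. 0 < snd p" "(\<Sum>p\<in>F. snd p powr s) < e / 2"
    using assms(1) e unfolding content_null_def by blast
  obtain G where G: "finite G" "B \<subseteq> (\<Union>p\<in>G. cball (fst p) (snd p))" "\<forall>p\<in>G. 0 < snd p" "(\<Sum>p\<in>G. snd p powr s) < e / 2"
    using assms(2) e unfolding content_null_def by blast
  have "(\<Sum>p\<in>F \<union> G. snd p powr s) \<le> (\<Sum>p\<in>F. snd p powr s) + (\<Sum>p\<in>G. snd p powr s)"
    using F(1) G(1) by (simp add: sum_Un sum_nonneg)
  then show "\<exists>H. finite H \<and> A \<union> B \<subseteq> (\<Union>p\<in>H. cball (fst p) (snd p)) \<and> (\<forall>p\<in>H. 0 < snd p) \<and> (\<Sum>p\<in>H. snd p powr s) < e"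
    using F G by (intro exI[of _ "F \<union> G"]) auto
qed

lemma content_null_UN:
  "finite I \<Longrightarrow> (\<And>i. i \<in> I \<Longrightarrow> content_null s (A i)) \<Longrightarrow> content_null s (\<Union>i\<in>I. A i)"
  by (induction I rule: finite_induct) (auto intro: content_null_empty content_null_Un)

lemma hausdorff_premeasure_le_sum:
  assumes "finite F" "A \<subseteq> (\<Union>p\<in>F. cball (fst p) (snd p))" "\<And>p. p \<in> F \<Longrightarrow> 0 < snd p \<and> 2 * snd p \<le> \<delta>" "s > 0" "\<delta> > 0"
  shows "hausdorff_premeasure s \<delta> A \<le> ennreal (2 powr s * (\<Sum>p\<in>F. snd p powr s))"
proof -
  obtain g where g: "bij_betw g {0..<card F} F" using ex_bij_betw_nat_finite[OF assms(1)] by blast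
  \<comment> \<open>The finite cover is padded by empty sets, which have diameter 0 and contribute 0
    powr s = 0.\<close>
  define U where "U = (\<lambda>i. if i < card F then cball (fst (g i)) (snd (g i)) else {})"
  have gF: "g i \<in> F" if "i < card F" for i using g that by (auto simp: bij_betw_def)
  have diam: "diameter (cball x \<rho>) \<le> 2 * \<rho>" if "\<rho> > 0" for x :: 'a and \<rho>
  proof -
    have "dist y z \<le> 2 * \<rho>" if "y \<in> cball x \<rho>" "z \<in> cball x \<rho>" for y z
      using that dist_triangle[of y z x] by (simp add: dist_commute)
    then show ?thesis using that by (auto simp: diameter_def intro!: cSUP_least)
  qed
  have "A \<subseteq> (\<Union>i. U i)"
  proof
    fix x assume "x \<in> A"
    then obtain p where p: "p \<in> F" "x \<in> cball (fst p) (snd p)" using assms(2) by auto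
    then obtain i where "i < card F" "g i = p" using g by (auto simp: bij_betw_def image_iff) (metis atLeastLessThan_iff imageE)
    then show "x \<in> (\<Union>i. U i)" using p by (auto simp: U_def intro!: exI[of _ i])
  qed
  moreover have "bounded (U i) \<and> diameter (U i) \<le> \<delta>" for i
    using assms(3)[OF gF] assms(5) diam[of "snd (g i)" "fst (g i)"] by (fastforce simp: U_def)
  ultimately have "hausdorff_premeasure s \<delta> A \<le> (\<Sum>i. ennreal (diameter (U i) powr s))"
    unfolding hausdorff_premeasure_def by (intro INF_lower) auto
  also have "\<dots> = (\<Sum>i<card F. ennreal (diameter (U i) powr s))"
    using assms(4) by (intro suminf_finite) (auto simp: U_def)
  also have "\<dots> \<le> (\<Sum>i<card F. ennreal ((2 * snd (g i)) powr s))"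
  proof (intro sum_mono ennreal_leI)
    fix i assume i: "i \<in> {..<card F}"
    then show "diameter (U i) powr s \<le> (2 * snd (g i)) powr s"
      using assms(3)[OF gF] diam[of "snd (g i)" "fst (g i)"] assms(4)
      by (intro powr_mono2) (auto simp: U_def diameter_ge_0)
  qed
  also have "\<dots> = ennreal (\<Sum>i<card F. (2 * snd (g i)) powr s)"
    by (intro sum_ennreal) auto
  also have "(\<Sum>i<card F. (2 * snd (g i)) powr s) = (\<Sum>p\<in>F. (2 * snd p) powr s)"
    using g unfolding atLeast0LessThan by (rule sum.reindex_bij_betw)
  also have "\<dots> = 2 powr s * (\<Sum>p\<in>F. snd p powr s)"
    unfolding sum_distrib_left using assms(3) by (intro sum.cong refl) (auto simp: powr_mult less_imp_le)
  finally show ?thesis .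
qed

lemma content_null_imp_hausdorff_measure_0:
  assumes "content_null s A" "s > 0"
  shows "hausdorff_measure s A = 0"
proof -
  have "hausdorff_premeasure s \<delta> A \<le> ennreal e" if "\<delta> > 0" "e > 0" for \<delta> e :: real
  proof -
    \<comment> \<open>The second term of the minimum forces every radius below \<delta>/2, the first
      controls the sum after doubling the radii.\<close>
    define e' where "e' = min (e / 2 powr s) ((\<delta> / 2) powr s)"
    have "e' > 0" using that by (simp add: e'_def)
    then obtain F where F: "finite F" "A \<subseteq> (\<Union>p\<in>F. cball (fst p) (snd p))" "\<forall>p\<in>F. 0 < snd p" "(\<Sum>p\<in>F. snd p powr s) < e'"
      using assms(1) unfolding content_null_def by blast
    have "0 < snd p \<and> 2 * snd p \<le> \<delta>" if p: "p \<in> F" for p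
    proof -
      have "snd p powr s \<le> (\<Sum>p\<in>F. snd p powr s)" using F p by (intro member_le_sum) auto
      also have "\<dots> < (\<delta> / 2) powr s" using F by (simp add: e'_def)
      finally have "snd p < \<delta> / 2" using F p assms(2) \<open>\<delta> > 0\<close>
        by (metis linorder_not_less powr_mono2 less_imp_le half_gt_zero)
      then show ?thesis using F p by auto
    qed
    then have "hausdorff_premeasure s \<delta> A \<le> ennreal (2 powr s * (\<Sum>p\<in>F. snd p powr s))"
      using F assms that by (intro hausdorff_premeasure_le_sum) auto
    also have "\<dots> \<le> ennreal e"
    proof (rule ennreal_leI)
      have "(\<Sum>p\<in>F. snd p powr s) \<le> e / 2 powr s" using F(4) unfolding e'_def by simp
      then have "2 powr s * (\<Sum>p\<in>F. snd p powr s) \<le> 2 powr s * (e / 2 powr s)" by (intro mult_left_mono) auto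
      then show "2 powr s * (\<Sum>p\<in>F. snd p powr s) \<le> e" by simp
    qed
    finally show ?thesis .
  qed
  then have "hausdorff_premeasure s \<delta> A = 0" if "\<delta> > 0" for \<delta>
    using that by (metis ennreal_le_epsilon add_0 le_zero_eq)
  then show ?thesis unfolding hausdorff_measure_def by (intro antisym SUP_least) auto
qed

lemma not_content_null_if_less_hausdorff_dim:
  assumes "0 < s" "s < hausdorff_dim A"
  shows "\<not> content_null s A"
proof
  assume "content_null s A"
  then have "hausdorff_measure s A = 0" using assms by (intro content_null_imp_hausdorff_measure_0)
  then have "hausdorff_dim A \<le> s"
    unfolding hausdorff_dim_def using assms by (intro cInf_lower bdd_belowI[of _ 0]) auto
  with assms show False by simp
qed

lemma content_null_translation:
  fixes A :: "'a::real_normed_vector set"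
  assumes "content_null s ((\<lambda>x. x - c) ` A)"
  shows "content_null s A"
  unfolding content_null_def
proof (intro allI impI)
  fix e :: real assume "e > 0"
  then obtain F where F: "finite F" "(\<lambda>x. x - c) ` A \<subseteq> (\<Union>p\<in>F. cball (fst p) (snd p))" "\<forall>p\<in>F. 0 < snd p" "(\<Sum>p\<in>F. snd p powr s) < e"
    using assms unfolding content_null_def by blast
  let ?f = "\<lambda>p. (fst p + c, snd p)"
  have inj: "inj_on ?f F" by (auto simp: inj_on_def prod_eq_iff)
  have "(\<Sum>p\<in>?f ` F. snd p powr s) < e" using F(4) by (simp add: sum.reindex[OF inj])
  moreover have "A \<subseteq> (\<Union>p\<in>?f ` F. cball (fst p) (snd p))"
  proof
    fix x assume "x \<in> A"
    then obtain p where "p \<in> F" "dist (fst p) (x - c) \<le> snd p" using F(2) by force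
    then show "x \<in> (\<Union>p\<in>?f ` F. cball (fst p) (snd p))" by (auto simp: dist_norm algebra_simps intro!: bexI[of _ p])
  qed
  ultimately show "\<exists>F. finite F \<and> A \<subseteq> (\<Union>p\<in>F. cball (fst p) (snd p)) \<and> (\<forall>p\<in>F. 0 < snd p) \<and> (\<Sum>p\<in>F. snd p powr s) < e"
    using F by (intro exI[of _ "?f ` F"]) auto
qed

text \<open>
  Greedy construction: points are treated one after the other, and the weight of each is raised until
  some set containing it is saturated. Saturated sets stay saturated.
\<close>

lemma saturating_weights:
  fixes S :: "'i \<Rightarrow> 'a set" and cap :: "'i \<Rightarrow> real"
  assumes "finite F" "finite I" "\<And>i. i \<in> I \<Longrightarrow> cap i \<ge> 0" "\<And>x. x \<in> F \<Longrightarrow> \<exists>i\<in>I. x \<in> S i"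
  shows "\<exists>w::'a \<Rightarrow> real. (\<forall>x. w x \<ge> 0) \<and> (\<forall>i\<in>I. sum w (F \<inter> S i) \<le> cap i) \<and> (\<forall>x\<in>F. \<exists>i\<in>I. x \<in> S i \<and> sum w (F \<inter> S i) = cap i)"
  using assms(1,4)
proof (induction F rule: finite_induct)
  case empty
  show ?case using assms(3) by (intro exI[of _ "\<lambda>_. 0"]) auto
next
  case (insert x F)
  then obtain w where w: "\<forall>x. w x \<ge> 0" "\<forall>i\<in>I. sum w (F \<inter> S i) \<le> cap i" "\<forall>x\<in>F. \<exists>i\<in>I. x \<in> S i \<and> sum w (F \<inter> S i) = cap i"
    by auto
  let ?J = "{i\<in>I. x \<in> S i}"
  let ?sl = "\<lambda>i. cap i - sum w (F \<inter> S i)"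
  have J: "finite ?J" "?J \<noteq> {}" using assms(2) insert.prems[of x] by auto
  \<comment> \<open>The least remaining slack among the sets containing x: the largest weight for x
    that violates no cap.\<close>
  define m where "m = Min (?sl ` ?J)"
  have m: "m \<le> ?sl i" if "i \<in> I" "x \<in> S i" for i unfolding m_def using J that by (intro Min_le) auto
  obtain i0 where i0: "i0 \<in> I" "x \<in> S i0" "m = ?sl i0"
    using Min_in[of "?sl ` ?J"] J unfolding m_def by fastforce
  define w' where "w' = w(x := m)"
  have eq: "sum w' (insert x F \<inter> S i) = (if x \<in> S i then m else 0) + sum w (F \<inter> S i)" for i
  proof -
    have "sum w' (F \<inter> S i) = sum w (F \<inter> S i)" using insert by (intro sum.cong) (auto simp: w'_def)
    then show ?thesis using insert by (auto simp: w'_def Int_insert_left)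
  qed
  have m0: "m \<ge> 0" using i0 w(2) by auto
  show ?case
  proof (intro exI[of _ w'] conjI ballI allI)
    show "w' y \<ge> 0" for y using w m0 by (auto simp: w'_def)
    show le: "sum w' (insert x F \<inter> S i) \<le> cap i" if "i \<in> I" for i using m[OF that] w that by (auto simp: eq)
    fix y assume "y \<in> insert x F"
    then consider "y = x" | "y \<in> F" by auto
    then show "\<exists>i\<in>I. y \<in> S i \<and> sum w' (insert x F \<inter> S i) = cap i"
    proof cases
      case 1
      then show ?thesis using i0 by (auto simp: eq intro!: bexI[of _ i0])
    next
      case 2
      then obtain i where i: "i \<in> I" "y \<in> S i" "sum w (F \<inter> S i) = cap i" using w by auto
      then show ?thesis using le[of i] m0 by (intro bexI[of _ i]) (auto simp: eq split: if_splits)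
    qed
  qed
qed

text \<open>A discrete Frostman lemma by saturation. Weights on an h-net are raised until every net
  point lies in a ball of mass equal to its cap R^s. The doubled saturated balls cover E; the Vitali
  lemma selects disjoint ones whose fivefold enlargements still cover. Positive content bounds the
  sum of their R^s from below, and disjointness turns this into a lower bound for the total mass
  that does not involve h.\<close>

lemma discrete_frostman:
  fixes E :: "'a::euclidean_space set"
  assumes "compact E" "\<not> content_null s E" "s > 0"
  obtains c where "c > 0" "\<And>h. h > 0 \<Longrightarrow> \<exists>F w. finite F \<and> F \<subseteq> E \<and> (\<forall>x. (0::real) \<le> w x) \<and> c \<le> sum w F \<and>
     (\<forall>p \<rho>. h \<le> \<rho> \<longrightarrow> (\<Sum>y\<in>{y\<in>F. dist p y \<le> \<rho>}. w y) \<le> (2 * \<rho>) powr s)"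
proof -
  obtain e where e0: "e > 0" "\<not> (\<exists>F. finite F \<and> E \<subseteq> (\<Union>p\<in>F. cball (fst p) (snd p)) \<and> (\<forall>p\<in>F. 0 < snd p) \<and> (\<Sum>p\<in>F. snd p powr s) < e)"
    using assms(2) unfolding content_null_def by blast
  have e: "e \<le> (\<Sum>p\<in>F. snd p powr s)" if "finite F" "E \<subseteq> (\<Union>p\<in>F. cball (fst p) (snd p))" "\<forall>p\<in>F. 0 < snd p" for F
    using e0(2) that not_less by blast
  show ?thesis
  proof (rule that[of "e / 10 powr s"])
    show "e / 10 powr s > 0" using e0 by simp
    fix h :: real assume h: "h > 0"
    obtain F where F: "finite F" "F \<subseteq> E" "E \<subseteq> (\<Union>x\<in>F. ball x h)"
      using compact_imp_seq_compact[OF assms(1)] seq_compact_imp_totally_bounded h by metis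
    \<comment> \<open>Balls around net points through net points form a finite family that suffices
      for all balls of radius \<rho> \<ge> h: the net points in such a ball lie in a member of
      radius at most 2\<rho>.\<close>
    define R where "R = (\<lambda>p::'a \<times> 'a. max h (dist (fst p) (snd p)))"
    define S where "S = (\<lambda>p::'a \<times> 'a. cball (fst p) (R p))"
    have R: "R p \<ge> h" "R p > 0" for p using h by (auto simp: R_def)
    have "\<exists>w::'a \<Rightarrow> real. (\<forall>x. w x \<ge> 0) \<and> (\<forall>i\<in>F \<times> F. sum w (F \<inter> S i) \<le> R i powr s) \<and> (\<forall>x\<in>F. \<exists>i\<in>F \<times> F. x \<in> S i \<and> sum w (F \<inter> S i) = R i powr s)"
    proof (rule saturating_weights)
      fix x assume "x \<in> F"
      then show "\<exists>i\<in>F \<times> F. x \<in> S i" using h by (intro bexI[of _ "(x, x)"]) (auto simp: S_def R_def)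
    qed (use F in auto)
    then obtain w where w: "\<forall>x. w x \<ge> 0" "\<forall>i\<in>F \<times> F. sum w (F \<inter> S i) \<le> R i powr s" "\<forall>x\<in>F. \<exists>i\<in>F \<times> F. x \<in> S i \<and> sum w (F \<inter> S i) = R i powr s"
      by auto
    have frost: "(\<Sum>y\<in>{y\<in>F. dist p y \<le> \<rho>}. w y) \<le> (2 * \<rho>) powr s" if "h \<le> \<rho>" for p \<rho>
    proof (cases "{y\<in>F. dist p y \<le> \<rho>} = {}")
      case False
      let ?T = "{y\<in>F. dist p y \<le> \<rho>}"
      obtain x where x: "x \<in> ?T" using False by auto
      have fin: "finite (dist x ` ?T)" "dist x ` ?T \<noteq> {}" using F x by auto
      obtain y where y: "y \<in> ?T" "dist x y = Max (dist x ` ?T)" using Max_in[OF fin] by auto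
      have "dist x z \<le> dist x y" if "z \<in> ?T" for z
        unfolding y(2) using that by (intro Max_ge fin imageI)
      then have "?T \<subseteq> F \<inter> S (x, y)" by (auto simp: S_def R_def le_max_iff_disj)
      then have "(\<Sum>y\<in>?T. w y) \<le> sum w (F \<inter> S (x, y))" using F w by (intro sum_mono2) auto
      also have "\<dots> \<le> R (x, y) powr s" using w x y by auto
      also have "\<dots> \<le> (2 * \<rho>) powr s"
        using x y h that assms(3) dist_triangle[of x y p] by (intro powr_mono2) (auto simp: R_def dist_commute)
      finally show ?thesis .
    qed (metis powr_ge_zero sum.empty)
    define K where "K = {i\<in>F \<times> F. sum w (F \<inter> S i) = R i powr s}"
    have K: "finite K" unfolding K_def using F by auto
    have cover: "E \<subseteq> (\<Union>i\<in>K. cball (fst i) (2 * R i))"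
    proof
      fix z assume "z \<in> E"
      then obtain x where x: "x \<in> F" "dist x z < h" using F by auto
      then obtain i where i: "i \<in> K" "x \<in> S i" using w unfolding K_def by blast
      have "dist (fst i) z \<le> dist (fst i) x + dist x z" by (rule dist_triangle)
      also have "\<dots> \<le> 2 * R i" using i x R(1)[of i] by (simp add: S_def)
      finally show "z \<in> (\<Union>i\<in>K. cball (fst i) (2 * R i))" using i by auto
    qed
    obtain C where C: "countable C" "C \<subseteq> K" "pairwise (\<lambda>i j. disjnt (cball (fst i) (2 * R i)) (cball (fst j) (2 * R j))) C"
       "E \<subseteq> (\<Union>i\<in>C. cball (fst i) (5 * (2 * R i)))"
    proof (rule Vitali_covering_lemma_cballs[OF cover, of "Max (insert 0 ((\<lambda>i. 2 * R i) ` K))"])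
      fix i assume "i \<in> K"
      then show "0 < 2 * R i \<and> 2 * R i \<le> Max (insert 0 ((\<lambda>i. 2 * R i) ` K))" using R K by auto
    qed (rule that)
    have finC: "finite C" using C K finite_subset by auto
    \<comment> \<open>The factor 10 is 2 for passing from the net to E times 5 from the Vitali
      lemma.\<close>
    let ?G = "(\<lambda>i. (fst i, 10 * R i)) ` C"
    have "e \<le> (\<Sum>p\<in>?G. snd p powr s)"
      using finC C(4) R by (intro e) auto
    also have "\<dots> \<le> (\<Sum>i\<in>C. (10 * R i) powr s)"
      using finC by (intro order_trans[OF sum_image_le]) auto
    also have "\<dots> = 10 powr s * (\<Sum>i\<in>C. R i powr s)"
      unfolding sum_distrib_left by (intro sum.cong refl) (simp add: powr_mult R less_imp_le)
    also have "(\<Sum>i\<in>C. R i powr s) = (\<Sum>i\<in>C. sum w (F \<inter> S i))"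
      using C(2) by (intro sum.cong refl) (auto simp: K_def)
    also have "\<dots> = sum w (\<Union>i\<in>C. F \<inter> S i)"
    proof (rule sum.UNION_disjoint[symmetric])
      show "\<forall>i\<in>C. \<forall>j\<in>C. i \<noteq> j \<longrightarrow> (F \<inter> S i) \<inter> (F \<inter> S j) = {}"
      proof (intro ballI impI)
        fix i j assume "i \<in> C" "j \<in> C" "i \<noteq> j"
        then have "disjnt (cball (fst i) (2 * R i)) (cball (fst j) (2 * R j))" using C(3) by (auto simp: pairwise_def)
        then have "cball (fst i) (2 * R i) \<inter> cball (fst j) (2 * R j) = {}" by (simp add: disjnt_def)
        moreover have sub: "S p \<subseteq> cball (fst p) (2 * R p)" for p
          using R(2)[of p] unfolding S_def by (intro subset_cball) simp
        ultimately show "(F \<inter> S i) \<inter> (F \<inter> S j) = {}"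
          using sub[of i] sub[of j] by blast
      qed
    qed (use finC F in auto)
    also have "\<dots> \<le> sum w F" using F w by (intro sum_mono2) auto
    finally have "e \<le> 10 powr s * sum w F" by simp
    then have "e / 10 powr s \<le> sum w F" by (simp add: divide_le_eq mult.commute)
    then show "\<exists>F w. finite F \<and> F \<subseteq> E \<and> (\<forall>x. (0::real) \<le> w x) \<and> e / 10 powr s \<le> sum w F \<and>
     (\<forall>p \<rho>. h \<le> \<rho> \<longrightarrow> (\<Sum>y\<in>{y\<in>F. dist p y \<le> \<rho>}. w y) \<le> (2 * \<rho>) powr s)"
      using F w(1) frost by (intro exI[of _ F] exI[of _ w] conjI allI impI) simp_all
  qed
qed

section \<open>Covering boxes and slabs, and the support of the content\<close>

text \<open>A grid of mesh \<open>\<epsilon>\<close> in the coordinates \<open>T\<close>: one point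
  of \<open>A\<close> is kept from each occupied cell, and \<open>lip\<close> turns closeness in
  coordinates into distance. The product counts the cells.\<close>

lemma coordinate_box_cover:
  fixes T :: "'a::metric_space \<Rightarrow> 'n::finite \<Rightarrow> real"
  assumes box: "\<And>x i. x \<in> A \<Longrightarrow> \<bar>T x i - \<alpha> i\<bar> \<le> R i"
    and lip: "\<And>x y. (\<forall>i. \<bar>T x i - T y i\<bar> \<le> \<epsilon>) \<Longrightarrow> dist x y \<le> \<beta> * \<epsilon>"
    and \<epsilon>: "\<epsilon> > 0" and R: "\<And>i. R i \<ge> 0"
  obtains P where "finite P" "P \<subseteq> A" "A \<subseteq> (\<Union>p\<in>P. cball p (\<beta> * \<epsilon>))" "real (card P) \<le> (\<Prod>i\<in>UNIV. 2 * R i / \<epsilon> + 1)"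
proof -
  define g where "g = (\<lambda>x i. \<lfloor>(T x i - \<alpha> i + R i) / \<epsilon>\<rfloor>)"
  let ?B = "PiE UNIV (\<lambda>i. {0..\<lfloor>2 * R i / \<epsilon>\<rfloor>})"
  have gB: "g ` A \<subseteq> ?B"
  proof
    fix f assume "f \<in> g ` A"
    then obtain x where x: "x \<in> A" "f = g x" by auto
    show "f \<in> ?B"
    proof (rule PiE_I)
      fix i
      have "0 \<le> T x i - \<alpha> i + R i" "T x i - \<alpha> i + R i \<le> 2 * R i" using box[OF x(1), of i] by auto
      then show "f i \<in> {0..\<lfloor>2 * R i / \<epsilon>\<rfloor>}"
        using \<epsilon> by (auto simp: x g_def intro!: floor_mono divide_right_mono)
    qed auto
  qed
  have finB: "finite ?B" by (intro finite_PiE) auto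
  then have fin: "finite (g ` A)" using gB finite_subset by blast
  define c where "c = inv_into A g"
  have c: "c f \<in> A" "g (c f) = f" if "f \<in> g ` A" for f
    using that unfolding c_def by (auto intro: inv_into_into f_inv_into_f)
  show ?thesis
  proof (rule that[of "c ` g ` A"])
    show "A \<subseteq> (\<Union>p\<in>c ` g ` A. cball p (\<beta> * \<epsilon>))"
    proof
      fix x assume x: "x \<in> A"
      have "dist (c (g x)) x \<le> \<beta> * \<epsilon>"
      proof (intro lip allI)
        fix i
        have "\<lfloor>(T (c (g x)) i - \<alpha> i + R i) / \<epsilon>\<rfloor> = \<lfloor>(T x i - \<alpha> i + R i) / \<epsilon>\<rfloor>"
          using c(2)[of "g x"] x unfolding g_def by (auto simp: fun_eq_iff)
        then have "\<bar>(T (c (g x)) i - \<alpha> i + R i) / \<epsilon> - (T x i - \<alpha> i + R i) / \<epsilon>\<bar> < 1" by linarith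
        also have "(T (c (g x)) i - \<alpha> i + R i) / \<epsilon> - (T x i - \<alpha> i + R i) / \<epsilon> = (T (c (g x)) i - T x i) / \<epsilon>"
          by (simp add: diff_divide_distrib[symmetric])
        finally show "\<bar>T (c (g x)) i - T x i\<bar> \<le> \<epsilon>" using \<epsilon> by (simp add: abs_divide)
      qed
      then show "x \<in> (\<Union>p\<in>c ` g ` A. cball p (\<beta> * \<epsilon>))" using x by auto
    qed
    have "card (c ` g ` A) \<le> card ?B"
      using card_image_le[OF fin, of c] card_mono[OF finB gB] by linarith
    also have "\<dots> = (\<Prod>i\<in>UNIV. nat (\<lfloor>2 * R i / \<epsilon>\<rfloor> + 1))" by (simp add: card_PiE)
    finally have "real (card (c ` g ` A)) \<le> real (\<Prod>i\<in>UNIV. nat (\<lfloor>2 * R i / \<epsilon>\<rfloor> + 1))" by linarith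
    also have "\<dots> = (\<Prod>i\<in>UNIV. real (nat (\<lfloor>2 * R i / \<epsilon>\<rfloor> + 1)))" by simp
    also have "\<dots> \<le> (\<Prod>i\<in>UNIV. 2 * R i / \<epsilon> + 1)"
    proof (intro prod_mono conjI)
      fix i
      have "0 \<le> 2 * R i / \<epsilon>" using R \<epsilon> by simp
      then have "0 \<le> \<lfloor>2 * R i / \<epsilon>\<rfloor>" by simp
      then show "real (nat (\<lfloor>2 * R i / \<epsilon>\<rfloor> + 1)) \<le> 2 * R i / \<epsilon> + 1"
        using of_int_floor_le[of "2 * R i / \<epsilon>"] by (simp add: of_nat_nat)
    qed auto
    finally show "real (card (c ` g ` A)) \<le> (\<Prod>i\<in>UNIV. 2 * R i / \<epsilon> + 1)" .
  qed (use fin c in auto)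
qed

text \<open>A thin coordinate meets a bounded number of cells and every other one O(1/\<epsilon>),
  so each thin direction saves one power of \<open>\<epsilon>\<close>.\<close>

lemma thin_box_cover:
  fixes T :: "'a::metric_space \<Rightarrow> 'n::finite \<Rightarrow> real"
  assumes thin: "\<And>x i. x \<in> A \<Longrightarrow> i \<in> S \<Longrightarrow> \<bar>T x i - \<alpha> i\<bar> \<le> \<kappa> * \<epsilon>"
    and thick: "\<And>x i. x \<in> A \<Longrightarrow> \<bar>T x i - \<alpha> i\<bar> \<le> \<kappa>"
    and lip: "\<And>x y. (\<forall>i. \<bar>T x i - T y i\<bar> \<le> \<epsilon>) \<Longrightarrow> dist x y \<le> \<beta> * \<epsilon>"
    and \<epsilon>: "0 < \<epsilon>" "\<epsilon> \<le> 1" and \<kappa>: "\<kappa> \<ge> 0"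
  obtains P where "finite P" "P \<subseteq> A" "A \<subseteq> (\<Union>p\<in>P. cball p (\<beta> * \<epsilon>))"
    "real (card P) \<le> (2 * \<kappa> + 1) ^ CARD('n) * \<epsilon> powr - (real CARD('n) - real (card S))"
proof -
  define R where "R = (\<lambda>i. if i \<in> S then \<kappa> * \<epsilon> else \<kappa>)"
  obtain P where P: "finite P" "P \<subseteq> A" "A \<subseteq> (\<Union>p\<in>P. cball p (\<beta> * \<epsilon>))" "real (card P) \<le> (\<Prod>i\<in>UNIV. 2 * R i / \<epsilon> + 1)"
    by (rule coordinate_box_cover[of A T \<alpha> R \<epsilon> \<beta>]) (use assms in \<open>auto simp: R_def\<close>)
  note P(4)
  also have "(\<Prod>i\<in>UNIV. 2 * R i / \<epsilon> + 1) \<le> (\<Prod>i\<in>UNIV. (2 * \<kappa> + 1) * (if i \<in> S then 1 else 1 / \<epsilon>))"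
  proof (intro prod_mono conjI)
    fix i
    show "0 \<le> 2 * R i / \<epsilon> + 1" using \<epsilon> \<kappa> by (simp add: R_def)
    show "2 * R i / \<epsilon> + 1 \<le> (2 * \<kappa> + 1) * (if i \<in> S then 1 else 1 / \<epsilon>)"
      using \<epsilon> \<kappa> by (auto simp: R_def field_simps)
  qed
  also have "\<dots> = (2 * \<kappa> + 1) ^ CARD('n) * (1 / \<epsilon>) ^ card (- S)"
  proof -
    have "(\<Prod>i\<in>UNIV. if i \<in> S then 1 else 1 / \<epsilon>) = (\<Prod>i\<in>- S. 1 / \<epsilon>)"
      by (intro prod.mono_neutral_cong_right) auto
    then show ?thesis by (simp add: prod.distrib)
  qed
  also have "(1 / \<epsilon>) ^ card (- S) = \<epsilon> powr - (real CARD('n) - real (card S))"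
  proof -
    have "real (card (- S)) = real CARD('n) - real (card S)"
      by (simp add: Compl_eq_Diff_UNIV card_Diff_subset of_nat_diff card_mono)
    moreover have "(1 / \<epsilon>) ^ card (- S) = \<epsilon> powr - real (card (- S))"
      using \<epsilon> by (simp add: powr_minus_divide powr_realpow power_one_over)
    ultimately show ?thesis by simp
  qed
  finally show ?thesis using P that by blast
qed

lemma norm_le_sum_of_scaled:
  fixes X :: "'n::finite \<Rightarrow> 'a::real_normed_vector"
  assumes "\<And>i. \<bar>c i\<bar> \<le> \<epsilon>" "\<And>i. norm (X i) \<le> B"
  shows "norm (\<Sum>i\<in>UNIV. c i *\<^sub>R X i) \<le> real CARD('n) * B * \<epsilon>"
proof -
  have "0 \<le> \<epsilon>" using assms(1) by (meson abs_ge_zero order_trans)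
  then have "norm (\<Sum>i\<in>UNIV. c i *\<^sub>R X i) \<le> (\<Sum>i\<in>(UNIV::'n set). \<epsilon> * B)"
    using assms by (intro order_trans[OF norm_sum] sum_mono) (auto intro!: mult_mono)
  then show ?thesis by (simp add: mult_ac)
qed

text \<open>If u $ k is nonzero, replacing the k-th coordinate of x by u \<bullet> x is an
  invertible linear change of coordinates, in which the slab is a box with one thin side.\<close>

lemma slab_cover:
  fixes u :: "real ^ 'n" and K :: "(real ^ 'n) set"
  assumes u: "u \<noteq> 0" and K: "bounded K"
  shows "\<exists>\<beta>>0. \<exists>M>0. \<forall>\<eta>\<in>{0<..1}. \<exists>P. finite P \<and> {x\<in>K. \<bar>u \<bullet> x\<bar> \<le> \<eta>} \<subseteq> (\<Union>p\<in>P. cball p (\<beta> * \<eta>)) \<and>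
     real (card P) \<le> M * \<eta> powr - (real CARD('n) - 1)"
proof -
  obtain k where k: "u $ k \<noteq> 0" using u by (auto simp: vec_eq_iff)
  obtain B where B: "\<And>x. x \<in> K \<Longrightarrow> norm x \<le> B" "B > 0" using K bounded_pos by blast
  define T where "T = (\<lambda>x i. if i = k then u \<bullet> x else x $ i)"
  define U where "U = (\<Sum>i\<in>UNIV. \<bar>u $ i\<bar>)"
  have U: "U \<ge> 0" by (auto simp: U_def sum_nonneg)
  define b where "b = max 1 ((1 + U) / \<bar>u $ k\<bar>)"
  define \<beta> where "\<beta> = real CARD('n) * b"
  define \<kappa> where "\<kappa> = 1 + B + norm u * B"
  have \<kappa>: "\<kappa> \<ge> 1" using B by (simp add: \<kappa>_def)
  have lip: "dist x y \<le> \<beta> * \<eta>" if T: "\<forall>i. \<bar>T x i - T y i\<bar> \<le> \<eta>" for x y \<eta>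
  proof -
    have \<eta>: "\<eta> \<ge> 0" using T by (meson abs_ge_zero order_trans)
    have o: "\<bar>(x - y) $ i\<bar> \<le> \<eta>" if "i \<noteq> k" for i using T that by (auto simp: T_def dest: spec[of _ i])
    have kk: "\<bar>u \<bullet> (x - y)\<bar> \<le> \<eta>" using T by (auto simp: T_def inner_diff_right dest: spec[of _ k])
    have "u \<bullet> (x - y) = u $ k * (x - y) $ k + (\<Sum>i\<in>UNIV - {k}. u $ i * (x - y) $ i)"
      unfolding inner_vec_def by (subst sum.remove[of _ k]) auto
    then have "\<bar>u $ k * (x - y) $ k\<bar> \<le> \<bar>u \<bullet> (x - y)\<bar> + \<bar>\<Sum>i\<in>UNIV - {k}. u $ i * (x - y) $ i\<bar>" by linarith
    also have "\<dots> \<le> \<eta> + (\<Sum>i\<in>UNIV - {k}. \<bar>u $ i\<bar> * \<eta>)"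
      using kk o by (intro add_mono order_trans[OF sum_abs] sum_mono) (auto simp: abs_mult intro!: mult_left_mono)
    also have "(\<Sum>i\<in>UNIV - {k}. \<bar>u $ i\<bar> * \<eta>) \<le> U * \<eta>"
      unfolding U_def sum_distrib_right using \<eta> by (intro sum_mono2) auto
    finally have "\<bar>u $ k\<bar> * \<bar>(x - y) $ k\<bar> \<le> (1 + U) * \<eta>"
      unfolding abs_mult[symmetric] by (simp only: distrib_right mult_1 add_mono)
    then have "\<bar>(x - y) $ k\<bar> \<le> (1 + U) / \<bar>u $ k\<bar> * \<eta>" using k by (simp add: field_simps)
    also have "\<dots> \<le> b * \<eta>" unfolding b_def using \<eta> by (intro mult_right_mono) auto
    finally have k': "\<bar>(x - y) $ k\<bar> \<le> b * \<eta>" .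
    have "\<bar>(x - y) $ i\<bar> \<le> b * \<eta>" for i
    proof (cases "i = k")
      case False
      then have "\<bar>(x - y) $ i\<bar> \<le> 1 * \<eta>" using o by simp
      also have "\<dots> \<le> b * \<eta>" using \<eta> by (intro mult_right_mono) (auto simp: b_def)
      finally show ?thesis .
    qed (use k' in simp)
    then have "(\<Sum>i\<in>UNIV. \<bar>(x - y) $ i\<bar>) \<le> (\<Sum>i\<in>(UNIV::'n set). b * \<eta>)" by (intro sum_mono)
    then show ?thesis using norm_le_l1_cart[of "x - y"] by (simp add: dist_norm \<beta>_def)
  qed
  show ?thesis
  proof (rule exI[of _ \<beta>], intro exI[of _ "(2 * \<kappa> + 1) ^ CARD('n)"] conjI ballI)
    show "\<beta> > 0" by (auto simp: \<beta>_def b_def)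
    show "(2 * \<kappa> + 1) ^ CARD('n) > 0" using \<kappa> by auto
    fix \<eta> :: real assume "\<eta> \<in> {0<..1}"
    then have \<eta>: "0 < \<eta>" "\<eta> \<le> 1" by auto
    obtain P where "finite P" "P \<subseteq> {x\<in>K. \<bar>u \<bullet> x\<bar> \<le> \<eta>}" "{x\<in>K. \<bar>u \<bullet> x\<bar> \<le> \<eta>} \<subseteq> (\<Union>p\<in>P. cball p (\<beta> * \<eta>))"
      "real (card P) \<le> (2 * \<kappa> + 1) ^ CARD('n) * \<eta> powr - (real CARD('n) - real (card {k}))"
    proof (rule thin_box_cover[of "{x\<in>K. \<bar>u \<bullet> x\<bar> \<le> \<eta>}" "{k}" T "\<lambda>_. 0" \<kappa> \<eta> \<beta>])
      fix x i assume x: "x \<in> {x\<in>K. \<bar>u \<bullet> x\<bar> \<le> \<eta>}"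
      have "\<bar>u \<bullet> x\<bar> \<le> norm u * B"
        using Cauchy_Schwarz_ineq2[of u x] B(1)[of x] x by (auto intro: order_trans[OF _ mult_left_mono])
      moreover have "\<bar>x $ i\<bar> \<le> B" using component_le_norm_cart[of x i] B(1)[of x] x by auto
      ultimately show "\<bar>T x i - 0\<bar> \<le> \<kappa>" using B(2) unfolding T_def \<kappa>_def
        by (auto intro: order_trans[of _ "norm u * B"] order_trans[of _ B])
      show "\<bar>T x i - 0\<bar> \<le> \<kappa> * \<eta>" if "i \<in> {k}"
      proof -
        have "\<bar>T x i - 0\<bar> \<le> 1 * \<eta>" using x that by (simp add: T_def)
        also have "\<dots> \<le> \<kappa> * \<eta>" using \<kappa> \<eta> by (intro mult_right_mono) auto
        finally show ?thesis .
      qed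
    qed (use \<eta> \<kappa> lip in auto)
    then show "\<exists>P. finite P \<and> {x\<in>K. \<bar>u \<bullet> x\<bar> \<le> \<eta>} \<subseteq> (\<Union>p\<in>P. cball p (\<beta> * \<eta>)) \<and>
     real (card P) \<le> (2 * \<kappa> + 1) ^ CARD('n) * \<eta> powr - (real CARD('n) - 1)" by auto
  qed
qed

lemma content_null_compact_local:
  fixes K :: "'a::metric_space set"
  assumes "compact K" "\<And>z. z \<in> K \<Longrightarrow> \<exists>r>0. content_null s (K \<inter> cball z r)"
  shows "content_null s K"
proof -
  obtain r where r: "\<And>z. z \<in> K \<Longrightarrow> r z > 0 \<and> content_null s (K \<inter> cball z (r z))"
    using assms(2) by metis
  obtain D where D: "D \<subseteq> K" "finite D" "K \<subseteq> (\<Union>z\<in>D. ball z (r z))"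
    using compactE_image[OF assms(1), of K "\<lambda>z. ball z (r z)"] r by (metis (no_types, lifting) UN_I centre_in_ball open_ball subsetI)
  have "content_null s (\<Union>z\<in>D. K \<inter> cball z (r z))"
    using D r by (intro content_null_UN) auto
  then show ?thesis
    by (rule content_null_subset) (use D(3) ball_subset_cball in blast)
qed

text \<open>Otherwise the points of locally positive content lie in a hyperplane. The slab of
  thickness \<eta> around it is covered at cost O(\<eta>^(s-(d-1))), which tends to 0 since s > d -
  1. The rest of K is compact and locally null, hence null, and so K would be null.\<close>

lemma span_content_support:
  fixes K :: "(real ^ 'n) set"
  assumes K: "compact K" "\<not> content_null s K" and s: "s > real CARD('n) - 1"
  shows "span {z\<in>K. \<forall>r>0. \<not> content_null s (K \<inter> cball z r)} = UNIV"
proof (rule ccontr)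
  let ?S = "{z\<in>K. \<forall>r>0. \<not> content_null s (K \<inter> cball z r)}"
  assume "span ?S \<noteq> UNIV"
  then obtain u where u: "u \<noteq> 0" "\<forall>x\<in>span ?S. u \<bullet> x = 0" using span_not_UNIV_orthogonal by blast
  obtain \<beta> M where \<beta>: "\<beta> > 0" "M > 0" and cov: "\<forall>\<eta>\<in>{0<..1}. \<exists>P. finite P \<and> {x\<in>K. \<bar>u \<bullet> x\<bar> \<le> \<eta>} \<subseteq> (\<Union>p\<in>P. cball p (\<beta> * \<eta>)) \<and>
     real (card P) \<le> M * \<eta> powr - (real CARD('n) - 1)"
    using slab_cover[OF u(1) compact_imp_bounded[OF K(1)]] by blast
  have "content_null s K"
    unfolding content_null_def
  proof (intro allI impI)
    fix e :: real assume e: "e > 0"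
    have "((\<lambda>\<eta>. M * \<beta> powr s * \<eta> powr (s - (real CARD('n) - 1))) \<longlongrightarrow> M * \<beta> powr s * 0) (at_right 0)"
      using s by (intro tendsto_mult_left tendsto_powr'[of _ 0 _ _ "s - (real CARD('n) - 1)", simplified]) (auto intro!: tendsto_intros eventually_mono[OF eventually_at_right_less[of 0]])
    then have "eventually (\<lambda>\<eta>. M * \<beta> powr s * \<eta> powr (s - (real CARD('n) - 1)) < e / 2) (at_right 0)"
      using e by (intro order_tendstoD) auto
    moreover have "eventually (\<lambda>\<eta>::real. 0 < \<eta> \<and> \<eta> < 1) (at_right 0)"
      by (auto simp: eventually_at_right_field intro!: exI[of _ 1])
    ultimately have "eventually (\<lambda>\<eta>. 0 < \<eta> \<and> \<eta> < 1 \<and> M * \<beta> powr s * \<eta> powr (s - (real CARD('n) - 1)) < e / 2) (at_right 0)"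
      by eventually_elim auto
    then obtain \<eta> where \<eta>: "0 < \<eta>" "\<eta> < 1" "M * \<beta> powr s * \<eta> powr (s - (real CARD('n) - 1)) < e / 2"
      using eventually_happens'[of "at_right (0::real)"] by (metis (no_types, lifting) trivial_limit_at_right_real)
    obtain P where P: "finite P" "{x\<in>K. \<bar>u \<bullet> x\<bar> \<le> \<eta>} \<subseteq> (\<Union>p\<in>P. cball p (\<beta> * \<eta>))" "real (card P) \<le> M * \<eta> powr - (real CARD('n) - 1)"
      using bspec[OF cov, of \<eta>] \<eta> by auto
    let ?L = "{x\<in>K. \<bar>u \<bullet> x\<bar> \<ge> \<eta>}"
    have "content_null s ?L"
    proof (rule content_null_compact_local)
      have "closed {x. \<bar>u \<bullet> x\<bar> \<ge> \<eta>}" by (intro closed_Collect_le continuous_intros)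
      then have "compact (K \<inter> {x. \<bar>u \<bullet> x\<bar> \<ge> \<eta>})" using K(1) by (rule compact_Int_closed[rotated])
      moreover have "?L = K \<inter> {x. \<bar>u \<bullet> x\<bar> \<ge> \<eta>}" by auto
      ultimately show "compact ?L" by (simp only:)
      fix z assume z: "z \<in> ?L"
      then have "z \<notin> ?S" using u(2) span_base[of z ?S] \<eta> by fastforce
      then obtain r where r: "r > 0" "content_null s (K \<inter> cball z r)" using z by auto
      then have "content_null s (?L \<inter> cball z r)" by (intro content_null_subset[OF r(2)]) auto
      with r(1) show "\<exists>r>0. content_null s (?L \<inter> cball z r)" by blast
    qed
    moreover have "e / 2 > 0" using e by simp
    ultimately obtain F where F: "finite F" "?L \<subseteq> (\<Union>p\<in>F. cball (fst p) (snd p))" "\<forall>p\<in>F. 0 < snd p" "(\<Sum>p\<in>F. snd p powr s) < e / 2"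
      unfolding content_null_def by blast
    let ?G = "(\<lambda>p. (p, \<beta> * \<eta>)) ` P"
    have "(\<Sum>p\<in>?G. snd p powr s) \<le> (\<Sum>p\<in>P. (\<beta> * \<eta>) powr s)"
      using P(1) by (intro order_trans[OF sum_image_le]) auto
    also have "\<dots> = real (card P) * (\<beta> powr s * \<eta> powr s)" using \<beta> \<eta> by (simp add: powr_mult)
    also have "\<dots> \<le> (M * \<eta> powr - (real CARD('n) - 1)) * (\<beta> powr s * \<eta> powr s)"
      by (intro mult_right_mono P) auto
    also have "\<dots> = M * \<beta> powr s * (\<eta> powr - (real CARD('n) - 1) * \<eta> powr s)" by (simp only: mult_ac)
    also have "\<eta> powr - (real CARD('n) - 1) * \<eta> powr s = \<eta> powr (s - (real CARD('n) - 1))"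
      by (subst powr_add[symmetric]) (simp add: algebra_simps)
    finally have G: "(\<Sum>p\<in>?G. snd p powr s) < e / 2" using \<eta> by linarith
    have "(\<Sum>p\<in>F \<union> ?G. snd p powr s) \<le> (\<Sum>p\<in>F. snd p powr s) + (\<Sum>p\<in>?G. snd p powr s)"
      using F(1) P(1) by (simp add: sum_Un sum_nonneg)
    then have "(\<Sum>p\<in>F \<union> ?G. snd p powr s) < e" using F(4) G by linarith
    moreover have "K \<subseteq> (\<Union>p\<in>F \<union> ?G. cball (fst p) (snd p))"
    proof
      fix x assume "x \<in> K"
      then have "x \<in> ?L \<or> x \<in> {x\<in>K. \<bar>u \<bullet> x\<bar> \<le> \<eta>}" by auto
      then show "x \<in> (\<Union>p\<in>F \<union> ?G. cball (fst p) (snd p))" using F(2) P(2) by fastforce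
    qed
    ultimately show "\<exists>F. finite F \<and> K \<subseteq> (\<Union>p\<in>F. cball (fst p) (snd p)) \<and> (\<forall>p\<in>F. 0 < snd p) \<and> (\<Sum>p\<in>F. snd p powr s) < e"
      using F P \<beta> \<eta> by (intro exI[of _ "F \<union> ?G"]) auto
  qed
  with K show False by simp
qed

subsection \<open>Distribution of cofactor vectors\<close>

definition column_det :: "('n::finite \<Rightarrow> real ^ 'n) \<Rightarrow> real" where
  "column_det x = det (\<chi> i j. x j $ i)"

text \<open>The generalised cross product of the columns other than k, the vector that represents
  the determinant as a linear form in column k. The value \<open>x k\<close> does not enter.\<close>

definition cofactor_vector :: "('n::finite \<Rightarrow> real ^ 'n) \<Rightarrow> 'n \<Rightarrow> real ^ 'n" where
  "cofactor_vector x k = (\<chi> i. column_det (x(k := axis i 1)))"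

lemma column_det_rows: "column_det x = det (\<chi> j. x j)"
proof -
  have "(\<chi> i j. x j $ i) = transpose (\<chi> j. x j)" by (simp add: transpose_def vec_eq_iff)
  then show ?thesis by (simp add: column_det_def)
qed

lemma linear_column_det: "linear (\<lambda>y. column_det (x(k := y)))"
proof (rule linearI)
  have eq: "(\<chi> j. (x(k := y)) j) = (\<chi> j. if j = k then y else x j)" for y
    by (simp add: vec_eq_iff)
  show "column_det (x(k := y + z)) = column_det (x(k := y)) + column_det (x(k := z))" for y z
    unfolding column_det_rows eq by (rule det_row_add)
  show "column_det (x(k := c *\<^sub>R y)) = c *\<^sub>R column_det (x(k := y))" for c y
  proof -
    have sc: "c *\<^sub>R y = c *s y" by (simp add: vec_eq_iff)
    show ?thesis unfolding column_det_rows eq sc using det_row_mul[of k c "\<lambda>_. y" x] by simp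
  qed
qed

lemma column_det_repeated: "j \<noteq> k \<Longrightarrow> column_det (x(k := x j)) = 0"
  unfolding column_det_rows by (rule det_identical_rows[of k j]) (auto simp: row_def)

lemma column_det_eq_inner: "column_det (x(k := y)) = cofactor_vector x k \<bullet> y"
proof -
  interpret linear "\<lambda>y. column_det (x(k := y))" by (rule linear_column_det)
  have "column_det (x(k := y)) = column_det (x(k := (\<Sum>i\<in>UNIV. y $ i *\<^sub>R axis i 1)))"
    using basis_expansion[of y] by (simp add: scalar_mult_eq_scaleR)
  also have "\<dots> = (\<Sum>i\<in>UNIV. y $ i * column_det (x(k := axis i 1)))" by (simp add: sum scaleR)
  also have "\<dots> = cofactor_vector x k \<bullet> y" by (simp add: cofactor_vector_def inner_vec_def mult.commute)
  finally show ?thesis .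
qed

lemma cofactor_vector_orthogonal: "j \<noteq> k \<Longrightarrow> cofactor_vector x k \<bullet> x j = 0"
  using column_det_repeated[of j k x] by (simp add: column_det_eq_inner)

lemma cofactor_vector_upd [simp]: "cofactor_vector (x(k := y)) k = cofactor_vector x k"
  by (simp add: cofactor_vector_def)

text \<open>The coordinates of y in the basis X are quotients of determinants, so inequalities
  between determinants become boxes to which the covering lemmas apply.\<close>

lemma cramer_columns:
  assumes "column_det X \<noteq> 0"
  shows "y = (\<Sum>i\<in>UNIV. (column_det (X(i := y)) / column_det X) *\<^sub>R X i)"
proof -
  define A where "A = (\<chi> i j. X j $ i)"
  have d: "det A \<noteq> 0" using assms by (simp add: A_def column_det_def)
  define c where "c = (\<chi> k. det (\<chi> i j. if j = k then y $ i else A $ i $ j) / det A)"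
  have "(\<chi> i j. if j = k then y $ i else A $ i $ j) = (\<chi> i j. (X(k := y)) j $ i)" for k
    by (simp add: A_def vec_eq_iff)
  then have c: "c = (\<chi> i. column_det (X(i := y)) / column_det X)"
    unfolding c_def column_det_def A_def by simp
  have "A *v c = y" using cramer[OF d, of c y] c_def by simp
  moreover have "A *v c = (\<Sum>i\<in>UNIV. c $ i *\<^sub>R X i)"
    by (simp add: A_def matrix_vector_mult_def vec_eq_iff mult.commute)
  ultimately show ?thesis by (simp add: c)
qed

lemma abs_det_le:
  fixes A :: "real ^ 'n ^ 'n"
  assumes "\<And>i j. \<bar>A $ i $ j\<bar> \<le> B"
  shows "\<bar>det A\<bar> \<le> fact CARD('n) * B ^ CARD('n)"
proof -
  have "\<bar>det A\<bar> \<le> (\<Sum>p\<in>{p. p permutes (UNIV::'n set)}. B ^ CARD('n))"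
    unfolding det_def
  proof (intro order_trans[OF sum_abs] sum_mono)
    fix p :: "'n \<Rightarrow> 'n"
    have "\<bar>\<Prod>i\<in>UNIV. A $ i $ p i\<bar> \<le> (\<Prod>i\<in>(UNIV::'n set). B)"
      unfolding abs_prod using assms by (intro prod_mono) auto
    moreover have "\<bar>of_int (sign p) :: real\<bar> = 1" by (simp add: sign_def)
    ultimately show "\<bar>of_int (sign p) * (\<Prod>i\<in>UNIV. A $ i $ p i)\<bar> \<le> B ^ CARD('n)"
      by (simp add: abs_mult)
  qed
  then show ?thesis by (simp add: card_permutations)
qed

lemma abs_column_det_le:
  fixes x :: "'n::finite \<Rightarrow> real ^ 'n"
  assumes "\<And>j. norm (x j) \<le> B"
  shows "\<bar>column_det x\<bar> \<le> fact CARD('n) * B ^ CARD('n)"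
  unfolding column_det_def using assms component_le_norm_cart order_trans
  by (intro abs_det_le) (simp, blast)

lemma norm_cofactor_vector_le:
  fixes x :: "'n::finite \<Rightarrow> real ^ 'n"
  assumes "\<And>j. j \<noteq> k \<Longrightarrow> norm (x j) \<le> B" "B \<ge> 1"
  shows "norm (cofactor_vector x k) \<le> real CARD('n) * (fact CARD('n) * B ^ CARD('n))"
proof -
  have "norm (cofactor_vector x k) \<le> (\<Sum>i\<in>(UNIV::'n set). fact CARD('n) * B ^ CARD('n))"
  proof (intro order_trans[OF norm_le_l1_cart] sum_mono)
    fix i
    show "\<bar>cofactor_vector x k $ i\<bar> \<le> fact CARD('n) * B ^ CARD('n)"
      unfolding cofactor_vector_def using assms by (auto intro!: abs_column_det_le simp: norm_axis_1)
  qed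
  then show ?thesis by simp
qed

text \<open>Each covering ball of radius \<beta>\<epsilon> carries mass at most C
  (\<beta>\<epsilon>)^s; here \<beta> \<ge> 1 keeps the radius above h. Multiplying by the number of
  balls gives the exponent s - d + |S|.\<close>

lemma thin_box_mass:
  fixes T :: "'a::metric_space \<Rightarrow> 'n::finite \<Rightarrow> real" and w :: "'a \<Rightarrow> real"
  assumes G: "finite G" "A \<subseteq> G" "\<And>y. y \<in> G \<Longrightarrow> w y \<ge> 0"
    and frost: "\<And>p \<rho>. h \<le> \<rho> \<Longrightarrow> (\<Sum>y\<in>{y\<in>G. dist p y \<le> \<rho>}. w y) \<le> C * \<rho> powr s"
    and thin: "\<And>x i. x \<in> A \<Longrightarrow> i \<in> S \<Longrightarrow> \<bar>T x i - \<alpha> i\<bar> \<le> \<kappa> * \<epsilon>"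
    and thick: "\<And>x i. x \<in> A \<Longrightarrow> \<bar>T x i - \<alpha> i\<bar> \<le> \<kappa>"
    and lip: "\<And>x y. (\<forall>i. \<bar>T x i - T y i\<bar> \<le> \<epsilon>) \<Longrightarrow> dist x y \<le> \<beta> * \<epsilon>"
    and \<epsilon>: "0 < \<epsilon>" "h \<le> \<epsilon>" "\<epsilon> \<le> 1" and \<kappa>: "\<kappa> \<ge> 0" and \<beta>: "\<beta> \<ge> 1" and C: "C \<ge> 0"
  shows "sum w A \<le> (2 * \<kappa> + 1) ^ CARD('n) * C * \<beta> powr s * \<epsilon> powr (s - real CARD('n) + real (card S))"
proof -
  obtain P where P: "finite P" "P \<subseteq> A" "A \<subseteq> (\<Union>p\<in>P. cball p (\<beta> * \<epsilon>))"
    "real (card P) \<le> (2 * \<kappa> + 1) ^ CARD('n) * \<epsilon> powr - (real CARD('n) - real (card S))"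
    by (rule thin_box_cover[of A S T \<alpha> \<kappa> \<epsilon> \<beta>]) (use assms in auto)
  have h: "h \<le> \<beta> * \<epsilon>" 
  proof -
    have "1 * \<epsilon> \<le> \<beta> * \<epsilon>" using \<epsilon> \<beta> by (intro mult_right_mono) auto
    with \<epsilon> show ?thesis by linarith
  qed
  have "sum w A \<le> sum w (\<Union>p\<in>P. {y\<in>G. dist p y \<le> \<beta> * \<epsilon>})"
    using G P by (intro sum_mono2) (auto simp: subset_iff)
  also have "\<dots> \<le> (\<Sum>p\<in>P. \<Sum>y\<in>{y\<in>G. dist p y \<le> \<beta> * \<epsilon>}. w y)"
    using P(1) G
  proof (induction P rule: finite_induct)
    case (insert p P)
    let ?U = "\<lambda>p. {y\<in>G. dist p y \<le> \<beta> * \<epsilon>}"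
    have "sum w (?U p \<union> (\<Union>q\<in>P. ?U q)) \<le> sum w (?U p) + sum w (\<Union>q\<in>P. ?U q)"
      using insert by (subst sum_Un) (auto intro!: sum_nonneg)
    then show ?case using insert by simp
  qed simp
  also have "\<dots> \<le> (\<Sum>p\<in>P. C * (\<beta> * \<epsilon>) powr s)"
    by (intro sum_mono frost h)
  also have "\<dots> = real (card P) * (C * (\<beta> powr s * \<epsilon> powr s))"
    using \<epsilon> \<beta> by (simp add: powr_mult)
  also have "\<dots> \<le> ((2 * \<kappa> + 1) ^ CARD('n) * \<epsilon> powr - (real CARD('n) - real (card S))) * (C * (\<beta> powr s * \<epsilon> powr s))"
    using C by (intro mult_right_mono P) auto
  also have "\<dots> = (2 * \<kappa> + 1) ^ CARD('n) * C * \<beta> powr s * (\<epsilon> powr - (real CARD('n) - real (card S)) * \<epsilon> powr s)"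
    by (simp only: mult_ac)
  also have "\<epsilon> powr - (real CARD('n) - real (card S)) * \<epsilon> powr s = \<epsilon> powr (s - real CARD('n) + real (card S))"
    by (subst powr_add[symmetric]) (simp add: algebra_simps)
  finally show ?thesis .
qed

text \<open>The first summand is the product of d - 1 box estimates for \<rho> \<le> 1, the second
  the total mass of all d - 1 columns, which settles \<rho> > 1.\<close>

definition cof_const :: "nat \<Rightarrow> real \<Rightarrow> real \<Rightarrow> real \<Rightarrow> real \<Rightarrow> real" where
  "cof_const d s C B \<tau> = ((2 * (2 * (fact d * B ^ d + B) / \<tau>) + 1) ^ d * C * (real d * B) powr s) ^ (d - 1) + (C * B powr s) ^ (d - 1)"

text \<open>
  If the cofactor vector of x is within \<open>\<rho>\<close> of p, then every column x j lies in the plate of width O(\<open>\<rho>\<close>)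
  orthogonal to p. Once the others are fixed, a last column j0 is moreover confined to an
  O(\<open>\<rho>\<close>)-neighbourhood of an affine subspace of codimension 2, since the cofactor vector depends on
  it through a linear map of rank 2. In the coordinates given by Cramer's rule both are boxes.
\<close>

lemma cofactor_frostman:
  fixes F :: "'n::finite \<Rightarrow> (real ^ 'n) set" and w :: "'n \<Rightarrow> real ^ 'n \<Rightarrow> real" and zk p :: "real ^ 'n"
  assumes F: "\<And>j. finite (F j)" "\<And>j y. y \<in> F j \<Longrightarrow> norm y \<le> B" and w: "\<And>j y. w j y \<ge> 0"
    and frost: "\<And>j p \<rho>. h \<le> \<rho> \<Longrightarrow> (\<Sum>y\<in>{y\<in>F j. dist p y \<le> \<rho>}. w j y) \<le> C * \<rho> powr s"
    and nondeg: "\<And>x. (\<And>j. j \<noteq> k \<Longrightarrow> x j \<in> F j) \<Longrightarrow> x k = zk \<Longrightarrow> \<tau> \<le> \<bar>column_det x\<bar>" and zk: "norm zk \<le> B"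
    and const: "B \<ge> 1" "\<tau> > 0" "C \<ge> 0" "0 < h" "h \<le> 1" "s > real CARD('n) - 1" and \<rho>: "h \<le> \<rho>" and card: "CARD('n) \<ge> 2"
  shows "(\<Sum>x\<in>{x\<in>PiE (UNIV - {k}) F. dist p (cofactor_vector x k) \<le> \<rho>}. \<Prod>j\<in>UNIV - {k}. w j (x j))
     \<le> cof_const CARD('n) s C B \<tau> * \<rho> powr ((real CARD('n) - 1) * (s - real CARD('n) + 1) + 1)"
proof -
  let ?d = "CARD('n)"
  let ?I = "UNIV - {k}"
  let ?W = "\<lambda>x. \<Prod>j\<in>?I. w j (x j)"
  define Bad where "Bad = {x\<in>PiE ?I F. dist p (cofactor_vector x k) \<le> \<rho>}"
  define D where "D = fact ?d * B ^ ?d"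
  \<comment> \<open>Large enough for both uses: 2D/\<tau> bounds every Cramer coordinate difference,
    and 2B\<rho>/\<tau> is the width in a thin direction.\<close>
  define \<kappa> where "\<kappa> = 2 * (D + B) / \<tau>"
  define M where "M = (2 * \<kappa> + 1) ^ ?d * C * (real ?d * B) powr s"
  define b where "b = s - real ?d + 1"
  have D: "D \<ge> 0" using const by (simp add: D_def)
  have \<kappa>: "\<kappa> \<ge> 0" using D const by (simp add: \<kappa>_def)
  have M: "M \<ge> 0" using \<kappa> const by (simp add: M_def)
  have b: "b > 0" using const by (simp add: b_def)
  have finI: "finite (PiE ?I F)" using F by (intro finite_PiE) auto
  have K: "cof_const ?d s C B \<tau> = M ^ (?d - 1) + (C * B powr s) ^ (?d - 1)"
    by (simp add: cof_const_def M_def \<kappa>_def D_def)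
  have card_I: "card ?I = ?d - 1" by (simp add: card_Diff_singleton)
  show ?thesis
  proof (cases "\<rho> \<le> 1 \<and> Bad \<noteq> {}")
    case False
    show ?thesis
    proof (cases "Bad = {}")
      case True
      then show ?thesis unfolding Bad_def[symmetric] K using M const by simp
    next
      case ne: False
      then have \<rho>1: "\<rho> > 1" using False by simp
      have "sum ?W Bad \<le> sum ?W (PiE ?I F)"
        using finI w by (intro sum_mono2) (auto simp: Bad_def prod_nonneg)
      also have "\<dots> = (\<Prod>j\<in>?I. sum (w j) (F j))" using F by (intro prod_sum_PiE[symmetric]) auto
      also have "\<dots> \<le> (\<Prod>j\<in>?I. C * B powr s)"
      proof (intro prod_mono conjI sum_nonneg w)
        fix j
        have "sum (w j) (F j) = (\<Sum>y\<in>{y\<in>F j. dist 0 y \<le> B}. w j y)" using F by (intro sum.cong) auto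
        also have "\<dots> \<le> C * B powr s" using const by (intro frost) auto
        finally show "sum (w j) (F j) \<le> C * B powr s" .
      qed
      also have "\<dots> = (C * B powr s) ^ (?d - 1)" by (simp add: card_I)
      also have "\<dots> \<le> cof_const ?d s C B \<tau>" unfolding K using M by simp
      also have "\<dots> \<le> cof_const ?d s C B \<tau> * \<rho> powr ((real ?d - 1) * b + 1)"
        
      proof -
        have "1 \<le> \<rho> powr ((real ?d - 1) * b + 1)"
          using \<rho>1 b card by (intro ge_one_powr_ge_zero) auto
        moreover have "0 \<le> cof_const ?d s C B \<tau>" unfolding K using M const by simp
        ultimately show ?thesis using mult_left_mono[of 1] by fastforce
      qed
      finally show ?thesis unfolding Bad_def b_def by (simp add: algebra_simps)
    qed
  next
    case True
    then have \<rho>1: "\<rho> \<le> 1" and "Bad \<noteq> {}" by auto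
    then obtain x0 where x0: "x0 \<in> Bad" by auto
    have "card ?I > 0" using card card_I by simp
    then have "?I \<noteq> {}" using card_gt_0_iff[of ?I] by blast
    then obtain j0 where j0: "j0 \<noteq> k" by blast
    have pos: "0 < \<rho>" using const \<rho> by simp
    \<comment> \<open>Both uses share this estimate: \<alpha> = 0 centres the box at the origin, for
      the plates, and \<alpha> = 1 centres it at a reference point q, for the last column.\<close>
    have box: "sum (w j) A \<le> M * \<rho> powr (s - real ?d + real (card S))"
      if A: "A \<subseteq> F j" and X: "\<And>i. norm (X i) \<le> B" "\<tau> \<le> \<bar>column_det X\<bar>"
        and q: "norm q \<le> B" and thin: "\<And>y i. y \<in> A \<Longrightarrow> i \<in> S \<Longrightarrow> \<bar>column_det (X(i := y)) - \<alpha> * column_det (X(i := q))\<bar> \<le> 2 * B * \<rho>"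
        and \<alpha>: "\<alpha> \<in> {0, 1}"
      for A j S X q \<alpha>
    proof -
      define T where "T = (\<lambda>y i. column_det (X(i := y)) / column_det X)"
      have dX: "column_det X \<noteq> 0" using X const by auto
      have bound: "\<bar>column_det (X(i := y))\<bar> \<le> D" if "norm y \<le> B" for i y
        unfolding D_def using X that by (intro abs_column_det_le) auto
      have Tdiff: "\<bar>T y i - \<alpha> * T q i\<bar> \<le> \<bar>column_det (X(i := y)) - \<alpha> * column_det (X(i := q))\<bar> / \<tau>" for y i
      proof -
        have "\<bar>T y i - \<alpha> * T q i\<bar> = \<bar>column_det (X(i := y)) - \<alpha> * column_det (X(i := q))\<bar> / \<bar>column_det X\<bar>"
          unfolding T_def by (simp add: diff_divide_distrib[symmetric] abs_divide)
        also have "\<dots> \<le> \<bar>column_det (X(i := y)) - \<alpha> * column_det (X(i := q))\<bar> / \<tau>"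
          using X const by (intro divide_left_mono) auto
        finally show ?thesis .
      qed
      show ?thesis unfolding M_def
      proof (rule thin_box_mass[where T = T and \<alpha> = "\<lambda>i. \<alpha> * T q i" and G = "F j" and h = h and \<epsilon> = \<rho> and S = S])
        fix y i assume y: "y \<in> A"
        have "\<bar>column_det (X(i := y)) - \<alpha> * column_det (X(i := q))\<bar> \<le> D + D"
          using bound[of y i] bound[of q i] q F(2) A y \<alpha> by (auto simp: subset_iff)
        then have "\<bar>T y i - \<alpha> * T q i\<bar> \<le> (D + D) / \<tau>"
          using Tdiff[of y i] const by (meson divide_right_mono less_imp_le order_trans)
        also have "\<dots> \<le> \<kappa>" unfolding \<kappa>_def using const by (intro divide_right_mono) auto
        finally show "\<bar>T y i - \<alpha> * T q i\<bar> \<le> \<kappa>" .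
        assume i: "i \<in> S"
        have "\<bar>T y i - \<alpha> * T q i\<bar> \<le> 2 * B * \<rho> / \<tau>"
          using Tdiff[of y i] thin[OF y i] const by (meson divide_right_mono less_imp_le order_trans)
        also have "\<dots> = (2 * B / \<tau>) * \<rho>" by simp
        also have "\<dots> \<le> \<kappa> * \<rho>" unfolding \<kappa>_def using const pos D by (intro mult_right_mono divide_right_mono) auto
        finally show "\<bar>T y i - \<alpha> * T q i\<bar> \<le> \<kappa> * \<rho>" .
      next
        fix x y assume "\<forall>i. \<bar>T x i - T y i\<bar> \<le> \<rho>"
        have "x - y = (\<Sum>i\<in>UNIV. T x i *\<^sub>R X i) - (\<Sum>i\<in>UNIV. T y i *\<^sub>R X i)"
          using cramer_columns[OF dX, of x] cramer_columns[OF dX, of y] unfolding T_def by simp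
        also have "\<dots> = (\<Sum>i\<in>UNIV. (T x i - T y i) *\<^sub>R X i)"
          by (simp add: scaleR_left_diff_distrib sum_subtractf)
        finally show "dist x y \<le> real ?d * B * \<rho>"
          unfolding dist_norm using norm_le_sum_of_scaled[of "\<lambda>i. T x i - T y i" \<rho> X B] X \<open>\<forall>i. \<bar>T x i - T y i\<bar> \<le> \<rho>\<close> by simp
      next
        have "1 * 1 \<le> real ?d * B" using const card by (intro mult_mono) auto
        then show "1 \<le> real ?d * B" by simp
      qed (use F A w frost \<rho> \<rho>1 pos \<kappa> const in auto)
    qed
    have BadD: "x j \<in> F j" "norm (x j) \<le> B" if "x \<in> Bad" "j \<noteq> k" for x j
      using that F(2) by (auto simp: Bad_def PiE_iff)
    have BadDiff: "norm (cofactor_vector x k - cofactor_vector y k) \<le> 2 * \<rho>" if "x \<in> Bad" "y \<in> Bad" for x y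
      using that dist_triangle2[of "cofactor_vector x k" "cofactor_vector y k" p] by (auto simp: Bad_def dist_norm norm_minus_commute)
    have inner_small: "\<bar>(cofactor_vector x k - cofactor_vector y k) \<bullet> q\<bar> \<le> 2 * B * \<rho>" if "x \<in> Bad" "y \<in> Bad" "norm q \<le> B" for x y q
    proof -
      have "\<bar>(cofactor_vector x k - cofactor_vector y k) \<bullet> q\<bar> \<le> (2 * \<rho>) * B"
        using BadDiff[OF that(1,2)] that(3) pos by (intro order_trans[OF Cauchy_Schwarz_ineq2] mult_mono) auto
      then show ?thesis by (simp add: mult_ac)
    qed
    \<comment> \<open>The plates are taken orthogonal to the cofactor vector of one bad tuple
      \<open>x0\<close> instead of p. Any other bad tuple has its cofactor vector within 2\<rho> of
      this one and orthogonal to its own columns, so its columns lie in the plates.\<close>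
    define Pl where "Pl = (\<lambda>j. {y\<in>F j. \<bar>cofactor_vector x0 k \<bullet> y\<bar> \<le> 2 * B * \<rho>})"
    have plate: "sum (w j) (Pl j) \<le> M * \<rho> powr b" for j
    proof -
      have "sum (w j) (Pl j) \<le> M * \<rho> powr (s - real ?d + real (card {k}))"
      proof (rule box[where X = "x0(k := zk)" and \<alpha> = 0 and q = zk])
        show "norm ((x0(k := zk)) i) \<le> B" for i using BadD[OF x0] zk by auto
        show "\<tau> \<le> \<bar>column_det (x0(k := zk))\<bar>" using BadD[OF x0] by (intro nondeg) auto
      qed (use zk in \<open>auto simp: Pl_def column_det_eq_inner\<close>)
      then show ?thesis by (simp add: b_def algebra_simps)
    qed
    have in_plate: "x j \<in> Pl j" if "x \<in> Bad" "j \<noteq> k" for x j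
    proof -
      have "cofactor_vector x0 k \<bullet> x j = (cofactor_vector x0 k - cofactor_vector x k) \<bullet> x j"
        using cofactor_vector_orthogonal[OF that(2), of x] by (simp add: inner_diff_left)
      then show ?thesis using inner_small[OF x0 that(1) BadD(2)[OF that]] BadD(1)[OF that] by (simp add: Pl_def)
    qed
    let ?I' = "?I - {j0}"
    have slice: "sum (w j0) {y\<in>F j0. g(j0 := y) \<in> Bad} \<le> M * \<rho> powr (b + 1)" for g
    proof (cases "{y\<in>F j0. g(j0 := y) \<in> Bad} = {}")
      case True
      then show ?thesis using M by (metis mult_nonneg_nonneg powr_ge_zero sum.empty)
    next
      case False
      then obtain q where q: "q \<in> F j0" "g(j0 := q) \<in> Bad" by auto
      let ?A = "{y\<in>F j0. g(j0 := y) \<in> Bad}"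
      let ?X = "g(j0 := q, k := zk)"
      have "sum (w j0) ?A \<le> M * \<rho> powr (s - real ?d + real (card {j0, k}))"
      proof (rule box[where X = ?X and \<alpha> = 1 and q = q])
        show "norm (?X i) \<le> B" for i using BadD[OF q(2), of i] zk by (cases "i = k") auto
        show "\<tau> \<le> \<bar>column_det ?X\<bar>" using BadD[OF q(2)] by (intro nondeg) auto
        show "norm q \<le> B" using F q by auto
        \<comment> \<open>Two thin directions. In slot k the determinant tests y against the
          cofactor vector formed with q, which equals a difference of two bad cofactor vectors
          because each kills its own column; in slot \<open>j0\<close> it tests the difference of
          cofactor vectors against \<open>zk\<close>.\<close>
        fix y i assume y: "y \<in> ?A" and i: "i \<in> {j0, k}"
        show "\<bar>column_det (?X(i := y)) - 1 * column_det (?X(i := q))\<bar> \<le> 2 * B * \<rho>"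
        proof (cases "i = k")
          case True
          have "column_det (?X(k := u)) = cofactor_vector (g(j0 := q)) k \<bullet> u" for u
            by (simp add: column_det_eq_inner)
          moreover have "cofactor_vector (g(j0 := q)) k \<bullet> q = 0"
            using cofactor_vector_orthogonal[OF j0, of "g(j0 := q)"] by simp
          moreover have "cofactor_vector (g(j0 := y)) k \<bullet> y = 0"
            using cofactor_vector_orthogonal[OF j0, of "g(j0 := y)"] by simp
          ultimately have "column_det (?X(i := y)) - 1 * column_det (?X(i := q)) = (cofactor_vector (g(j0 := q)) k - cofactor_vector (g(j0 := y)) k) \<bullet> y"
            using True by (simp add: inner_diff_left)
          then show ?thesis using inner_small[OF q(2), of "g(j0 := y)" y] y F(2)[of y j0] by simp
        next
          case False
          then have "i = j0" using i by auto
          have "?X(j0 := u) = (g(j0 := u))(k := zk)" for u using j0 by (auto simp: fun_eq_iff)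
          then have "column_det (?X(i := y)) - 1 * column_det (?X(i := q)) = (cofactor_vector (g(j0 := y)) k - cofactor_vector (g(j0 := q)) k) \<bullet> zk"
            unfolding \<open>i = j0\<close> by (simp only: column_det_eq_inner inner_diff_left mult_1)
          then show ?thesis using inner_small[of "g(j0 := y)" "g(j0 := q)" zk] y q zk by simp
        qed
      qed auto
      then show ?thesis using j0 by (simp add: b_def algebra_simps)
    qed
    have II: "?I = insert j0 ?I'" using j0 by auto
    have "sum ?W Bad = (\<Sum>x\<in>PiE ?I F. if x \<in> Bad then ?W x else 0)"
      using finI by (subst sum.inter_filter[symmetric]) (auto simp: Bad_def intro!: sum.cong)
    also have "\<dots> = (\<Sum>x\<in>(\<lambda>(y, g). g(j0 := y)) ` (F j0 \<times> PiE ?I' F). if x \<in> Bad then ?W x else 0)"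
      by (subst II, subst PiE_insert_eq) (rule refl)
    also have "\<dots> = (\<Sum>(y, g)\<in>F j0 \<times> PiE ?I' F. if g(j0 := y) \<in> Bad then ?W (g(j0 := y)) else 0)"
      by (subst sum.reindex[OF inj_combinator]) (auto intro!: sum.cong)
    also have "\<dots> = (\<Sum>g\<in>PiE ?I' F. \<Sum>y\<in>F j0. if g(j0 := y) \<in> Bad then ?W (g(j0 := y)) else 0)"
      by (subst sum.swap) (simp add: sum.cartesian_product)
    also have "\<dots> = (\<Sum>g\<in>PiE ?I' F. (\<Prod>j\<in>?I'. w j (g j)) * sum (w j0) {y\<in>F j0. g(j0 := y) \<in> Bad})"
    proof (rule sum.cong[OF refl])
      fix g
      have W: "?W (g(j0 := y)) = (\<Prod>j\<in>?I'. w j (g j)) * w j0 y" for y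
      proof -
        have "?W (g(j0 := y)) = w j0 y * (\<Prod>j\<in>?I'. w j ((g(j0 := y)) j))"
          using j0 by (subst prod.remove[of _ j0]) auto
        also have "(\<Prod>j\<in>?I'. w j ((g(j0 := y)) j)) = (\<Prod>j\<in>?I'. w j (g j))" by (intro prod.cong) auto
        finally show ?thesis by simp
      qed
      have "(\<Sum>y\<in>F j0. if g(j0 := y) \<in> Bad then ?W (g(j0 := y)) else 0) = (\<Sum>y\<in>{y\<in>F j0. g(j0 := y) \<in> Bad}. ?W (g(j0 := y)))"
        using F by (intro sum.inter_filter[symmetric]) auto
      then show "(\<Sum>y\<in>F j0. if g(j0 := y) \<in> Bad then ?W (g(j0 := y)) else 0) = (\<Prod>j\<in>?I'. w j (g j)) * sum (w j0) {y\<in>F j0. g(j0 := y) \<in> Bad}"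
        unfolding W sum_distrib_left by simp
    qed
    \<comment> \<open>If some entry of g lies outside its plate, no choice of the last column gives
      a bad tuple and the slice is empty.\<close>
    also have "\<dots> = (\<Sum>g\<in>PiE ?I' Pl. (\<Prod>j\<in>?I'. w j (g j)) * sum (w j0) {y\<in>F j0. g(j0 := y) \<in> Bad})"
    proof (rule sum.mono_neutral_right)
      show "finite (PiE ?I' F)" using F by (intro finite_PiE) auto
      show "PiE ?I' Pl \<subseteq> PiE ?I' F" by (intro PiE_mono) (auto simp: Pl_def)
      show "\<forall>g\<in>PiE ?I' F - PiE ?I' Pl. (\<Prod>j\<in>?I'. w j (g j)) * sum (w j0) {y\<in>F j0. g(j0 := y) \<in> Bad} = 0"
      proof
        fix g assume g: "g \<in> PiE ?I' F - PiE ?I' Pl"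
        have "{y\<in>F j0. g(j0 := y) \<in> Bad} = {}"
        proof (rule ccontr)
          assume "\<not> ?thesis"
          then obtain y where y: "g(j0 := y) \<in> Bad" by auto
          have "g j \<in> Pl j" if "j \<in> ?I'" for j using in_plate[OF y, of j] that by auto
          then show False using g by (auto simp: PiE_iff)
        qed
        then show "(\<Prod>j\<in>?I'. w j (g j)) * sum (w j0) {y\<in>F j0. g(j0 := y) \<in> Bad} = 0" by (simp only: sum.empty mult_zero_right)
      qed
    qed
    also have "\<dots> \<le> (\<Sum>g\<in>PiE ?I' Pl. (\<Prod>j\<in>?I'. w j (g j)) * (M * \<rho> powr (b + 1)))"
      by (intro sum_mono mult_left_mono slice prod_nonneg w)
    also have "\<dots> = (\<Prod>j\<in>?I'. sum (w j) (Pl j)) * (M * \<rho> powr (b + 1))"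
      unfolding sum_distrib_right[symmetric] using F by (subst prod_sum_PiE) (auto simp: Pl_def)
    also have "\<dots> \<le> (\<Prod>j\<in>?I'. M * \<rho> powr b) * (M * \<rho> powr (b + 1))"
      using M plate w by (intro mult_right_mono prod_mono) (auto intro: sum_nonneg)
    also have "\<dots> = M ^ (?d - 1) * \<rho> powr ((real ?d - 1) * b + 1)"
    proof -
      have c: "card ?I' = ?d - 2" using j0 card_I by (simp add: card_Diff_singleton)
      have e1: "M ^ (?d - 2) * M = M ^ (?d - 1)" 
      proof -
        have "?d - 1 = Suc (?d - 2)" using card by simp
        then show ?thesis by (simp only: power_Suc2)
      qed
      have e2: "(\<rho> powr b) ^ (?d - 2) * \<rho> powr (b + 1) = \<rho> powr ((real ?d - 1) * b + 1)"
      proof -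
        have "(\<rho> powr b) ^ (?d - 2) = \<rho> powr (b * real (?d - 2))"
          using pos by (simp add: powr_realpow[symmetric] powr_powr)
        then have "(\<rho> powr b) ^ (?d - 2) * \<rho> powr (b + 1) = \<rho> powr (b * real (?d - 2) + (b + 1))"
          by (simp only: powr_add)
        also have "b * real (?d - 2) + (b + 1) = (real ?d - 1) * b + 1" using card by (simp add: of_nat_diff algebra_simps)
        finally show ?thesis .
      qed
      have "(\<Prod>j\<in>?I'. M * \<rho> powr b) * (M * \<rho> powr (b + 1)) = (M ^ (?d - 2) * M) * ((\<rho> powr b) ^ (?d - 2) * \<rho> powr (b + 1))"
        unfolding prod_constant c power_mult_distrib by (simp only: mult_ac)
      then show ?thesis unfolding e1 e2 .
    qed
    also have "\<dots> \<le> cof_const ?d s C B \<tau> * \<rho> powr ((real ?d - 1) * b + 1)"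
      unfolding K using const by (intro mult_right_mono) auto
    finally show ?thesis unfolding Bad_def b_def by (simp add: algebra_simps)
  qed
qed

section \<open>Localisation at a nondegenerate tuple and passage to the limit\<close>

lemma exists_nondegenerate_tuple:
  fixes S :: "(real ^ 'n) set"
  assumes "span S = UNIV"
  obtains z :: "'n \<Rightarrow> real ^ 'n" where "\<And>j. z j \<in> S" "column_det z \<noteq> 0"
proof -
  obtain B where B: "B \<subseteq> S" "independent B" "S \<subseteq> span B" "card B = dim S" using basis_exists[of S] by blast
  have "card B = CARD('n)" using B(4) assms dim_span[of S] by simp
  moreover have "finite B" using B(2) independent_imp_finite by blast
  ultimately obtain z where z: "bij_betw z (UNIV :: 'n set) B" using finite_same_card_bij[of "UNIV :: 'n set" B] by auto
  have "rows (\<chi> j. z j) = B" using z by (auto simp: rows_def row_def bij_betw_def)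
  then have "rank (\<chi> j. z j) = card B" using B(2) by (simp add: row_rank_def dim_eq_card_independent)
  then have "column_det z \<noteq> 0" using \<open>card B = CARD('n)\<close> by (simp add: column_det_rows det_eq_0_rank)
  then show ?thesis using that z B(1) by (auto simp: bij_betw_def)
qed

lemma continuous_column_det: "continuous_on A (\<lambda>X :: real ^ 'n ^ 'n. column_det (\<lambda>j. X $ j))"
  unfolding column_det_def det_def by (intro continuous_intros)

lemma column_det_perturbation:
  fixes z :: "'n::finite \<Rightarrow> real ^ 'n"
  assumes "e > 0"
  obtains r where "r > 0" "\<And>x. (\<And>j. x j \<in> cball (z j) r) \<Longrightarrow> \<bar>column_det x - column_det z\<bar> \<le> e"
proof -
  have "continuous_on UNIV (\<lambda>X :: real ^ 'n ^ 'n. column_det (\<lambda>j. X $ j))" by (rule continuous_column_det)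
  then obtain \<delta> where \<delta>: "\<delta> > 0" "\<And>X :: real ^ 'n ^ 'n. dist X (\<chi> j. z j) < \<delta> \<Longrightarrow> dist (column_det (\<lambda>j. X $ j)) (column_det z) < e"
    using assms unfolding continuous_on_iff by (metis (no_types, lifting) UNIV_I ext vec_lambda_beta)
  show ?thesis
  proof (rule that[of "\<delta> / (2 * real CARD('n))"])
    show "\<delta> / (2 * real CARD('n)) > 0" using \<delta> by simp
    fix x assume x: "\<And>j. x j \<in> cball (z j) (\<delta> / (2 * real CARD('n)))"
    have "dist (\<chi> j. x j) (\<chi> j. z j) \<le> (\<Sum>j\<in>UNIV. dist (x j) (z j))"
      unfolding dist_vec_def by (rule order_trans[OF L2_set_le_sum]) auto
    also have "\<dots> \<le> (\<Sum>j\<in>(UNIV::'n set). \<delta> / (2 * real CARD('n)))"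
      using x by (intro sum_mono) (auto simp: dist_commute)
    also have "\<dots> < \<delta>" using \<delta> by simp
    finally have "dist (column_det (\<lambda>j. (\<chi> j. x j) $ j)) (column_det z) < e" by (rule \<delta>(2))
    then show "\<bar>column_det x - column_det z\<bar> \<le> e" by (simp add: dist_real_def)
  qed
qed

text \<open>Closedness of the value set turns values approximated to every accuracy into exact
  values.\<close>

lemma compact_column_det_values:
  fixes E :: "'n::finite \<Rightarrow> (real ^ 'n) set"
  assumes "\<And>j. compact (E j)"
  shows "compact {column_det x | x. \<forall>j. x j \<in> E j}"
proof -
  let ?P = "{X :: real ^ 'n ^ 'n. \<forall>j. X $ j \<in> E j}"
  have "closed (\<Inter>j. (\<lambda>X :: real ^ 'n ^ 'n. X $ j) -` E j)"
    by (intro closed_INT ballI continuous_closed_vimage compact_imp_closed assms) (auto intro!: continuous_intros)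
  moreover have "?P = (\<Inter>j. (\<lambda>X :: real ^ 'n ^ 'n. X $ j) -` E j)" by auto
  ultimately have "closed ?P" by simp
  moreover have "bounded ?P"
  proof -
    have "\<forall>j. \<exists>B. \<forall>x\<in>E j. norm x \<le> B" 
      using compact_imp_bounded[OF assms] by (simp add: bounded_iff)
    then obtain B where B: "\<forall>j. \<forall>x\<in>E j. norm x \<le> B j" by (rule choice[THEN exE])
    have "norm X \<le> (\<Sum>j\<in>UNIV. B j)" if "X \<in> ?P" for X
    proof -
      have "norm X \<le> (\<Sum>j\<in>UNIV. norm (X $ j))" unfolding norm_vec_def[of X] by (rule L2_set_le_sum) auto
      also have "\<dots> \<le> (\<Sum>j\<in>UNIV. B j)" using that B by (intro sum_mono) auto
      finally show ?thesis .
    qed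
    then show ?thesis unfolding bounded_iff by blast
  qed
  ultimately have "compact ?P" by (simp add: compact_eq_bounded_closed)
  then have "compact ((\<lambda>X. column_det (\<lambda>j. X $ j)) ` ?P)" by (intro compact_continuous_image continuous_column_det)
  moreover have "(\<lambda>X. column_det (\<lambda>j. X $ j)) ` ?P = {column_det x | x. \<forall>j. x j \<in> E j}"
  proof (intro equalityI subsetI)
    fix y assume "y \<in> {column_det x | x. \<forall>j. x j \<in> E j}"
    then obtain x where "y = column_det x" "\<forall>j. x j \<in> E j" by auto
    then show "y \<in> (\<lambda>X. column_det (\<lambda>j. X $ j)) ` ?P" by (intro image_eqI[of _ _ "\<chi> j. x j"]) auto
  qed auto
  ultimately show ?thesis by simp
qed

text \<open>Near a tuple z of nonzero determinant the sign of the determinant is constant, so its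
  modulus is the linear quantity \<open>\<sigma> * column_det x\<close>. One index k supplies y, the
  other d - 1 supply v, and the bilinear estimate is applied at every scale 2^(-n).\<close>

lemma column_det_values_interior:
  fixes K :: "(real ^ 'n) set"
  assumes card: "CARD('n) \<ge> 2" and K: "compact K" "\<not> content_null s K" and s: "s > real CARD('n) - 1 + 1 / real CARD('n)"
  shows "\<exists>a b. a < b \<and> {a<..<b} \<subseteq> {\<bar>column_det x\<bar> | x. \<forall>j. x j \<in> K}"
proof -
  let ?d = "CARD('n)"
  define \<alpha> where "\<alpha> = (real ?d - 1) * (s - real ?d + 1) + 1"
  have s1: "s > real ?d - 1" using s by (smt (verit) divide_nonneg_nonneg of_nat_0_le_iff)
  have spos: "s > 0" using s1 card by linarith
  have \<alpha>: "\<alpha> > 0" unfolding \<alpha>_def using s1 card by (intro add_nonneg_pos mult_nonneg_nonneg) auto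
  \<comment> \<open>Inserting \<open>\<alpha>\<close>, the inequality reads d (s - d + 1) > 1, which
    is the hypothesis on s.\<close>
  have gap: "s + \<alpha> > DIM(real ^ 'n) + 1"
  proof -
    have "(s - (real ?d - 1)) * real ?d > 1 / real ?d * real ?d"
      using s card by (intro mult_strict_right_mono) auto
    then show ?thesis using card unfolding \<alpha>_def by (simp add: algebra_simps)
  qed
  let ?S = "{z\<in>K. \<forall>r>0. \<not> content_null s (K \<inter> cball z r)}"
  obtain z where z: "\<And>j. z j \<in> ?S" "column_det z \<noteq> 0"
    using exists_nondegenerate_tuple[OF span_content_support[OF K s1]] by blast
  define \<sigma> where "\<sigma> = sgn (column_det z)"
  define t0 where "t0 = \<bar>column_det z\<bar> / 2"
  define t1 where "t1 = 3 * \<bar>column_det z\<bar> / 2"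
  have t01: "0 < t0" "t0 < t1" using z(2) by (auto simp: t0_def t1_def)
  have \<sigma>: "\<bar>\<sigma>\<bar> = 1" using z(2) by (simp add: \<sigma>_def)
  obtain r where r: "r > 0" "\<And>x. (\<And>j. x j \<in> cball (z j) r) \<Longrightarrow> \<bar>column_det x - column_det z\<bar> \<le> t0"
    using column_det_perturbation[OF t01(1), of z] by blast
  define E where "E = (\<lambda>j. K \<inter> cball (z j) r)"
  have E: "compact (E j)" "\<not> content_null s (E j)" for j
    using K z(1) r(1) by (auto simp: E_def intro!: compact_Int)
  have vals: "\<sigma> * column_det x \<in> {t0..t1}" if "\<And>j. x j \<in> E j" for x
  proof -
    have "\<bar>column_det x - column_det z\<bar> \<le> \<bar>column_det z\<bar> / 2" using r(2)[of x] that by (auto simp: E_def t0_def)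
    then show ?thesis unfolding \<sigma>_def t0_def t1_def by (auto simp: sgn_if abs_if split: if_splits)
  qed
  obtain B0 where B0: "\<And>x. x \<in> K \<Longrightarrow> norm x \<le> B0" using compact_imp_bounded[OF K(1)] unfolding bounded_iff by blast
  define B1 where "B1 = max 1 B0"
  have B1: "B1 \<ge> 1" "\<And>j x. x \<in> E j \<Longrightarrow> norm x \<le> B1" using B0 by (auto simp: B1_def E_def le_max_iff_disj)
  define Q where "Q = (\<lambda>j c h F w. finite F \<and> F \<subseteq> E j \<and> (\<forall>x. (0::real) \<le> w x) \<and> c \<le> sum w F \<and>
     (\<forall>p \<rho>. h \<le> \<rho> \<longrightarrow> (\<Sum>y\<in>{y\<in>F. dist p y \<le> \<rho>}. w y) \<le> (2 * \<rho>) powr s))"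
  have "\<exists>c>0. \<forall>h>0. \<exists>F w. Q j c h F w" for j
    unfolding Q_def by (rule discrete_frostman[OF E spos, of j]) blast
  then obtain c0 where c0: "\<And>j. c0 j > 0" "\<And>j h. h > 0 \<Longrightarrow> \<exists>F w. Q j (c0 j) h F w"
    by metis
  define k :: 'n where "k = undefined"
  let ?I = "UNIV - {k}"
  define c where "c = min (c0 k) (\<Prod>j\<in>?I. c0 j)"
  have c: "c > 0" unfolding c_def using c0(1) by (auto intro!: prod_pos)
  define C1 where "C1 = (2::real) powr s"
  define Kc where "Kc = cof_const ?d s C1 B1 t0"
  define T where "T = C1 * B1 powr s"
  \<comment> \<open>One constant dominating both Frostman constants and both total masses, as the
    configuration demands a common C.\<close>
  define C where "C = C1 + T + T ^ card ?I + \<bar>Kc\<bar>"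
  define B where "B = B1 + real ?d * (fact ?d * B1 ^ ?d)"
  have C1: "C1 \<ge> 0" "T \<ge> 0" by (auto simp: C1_def T_def)
  have C: "C1 \<le> C" "T \<le> C" "T ^ card ?I \<le> C" "Kc \<le> C" 
    using C1 zero_le_power[OF C1(2), of "card ?I"] abs_ge_self[of Kc] abs_ge_zero[of Kc] unfolding C_def by linarith+
  have B: "B1 \<le> B" "real ?d * (fact ?d * B1 ^ ?d) \<le> B" unfolding B_def using B1 by auto
  have zk: "z k \<in> E k" "norm (z k) \<le> B1" using z(1)[of k] r(1) B1(2)[of "z k" k] by (auto simp: E_def)
  define Kd where "Kd = shell_const DIM(real ^ 'n) s \<alpha> C B t0 t1"
  define gp where "gp = (s + \<alpha> - DIM(real ^ 'n) - 1) / 2"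
  define Good where "Good = (\<lambda>\<kappa> \<delta> n. \<forall>(A::(real ^ 'n) set) m (Om::('n \<Rightarrow> real ^ 'n) set) N v J.
       bilinear_config A m Om N v s \<alpha> C B t0 t1 (1 / 2 ^ n) Kd gp J \<longrightarrow> c \<le> sum m A \<longrightarrow> c \<le> sum N Om \<longrightarrow>
       (\<forall>\<omega>\<in>Om. \<forall>y\<in>A. v \<omega> \<bullet> y \<in> {t0..t1}) \<longrightarrow>
       (\<exists>ts\<in>{t0..t1}. \<forall>t\<in>{t0..t1}. \<bar>t - ts\<bar> \<le> \<kappa> \<longrightarrow> (\<exists>\<omega>\<in>Om. \<exists>y\<in>A. \<bar>v \<omega> \<bullet> y - t\<bar> < \<delta>)))"
  have "\<exists>\<kappa>>0. \<forall>\<delta>>0. eventually (Good \<kappa> \<delta>) sequentially"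
    unfolding Good_def Kd_def gp_def by (rule bilinear_values_near_interval[OF c gap t01(2)])
  then obtain \<kappa> where \<kappa>: "\<kappa> > 0" and ev: "\<And>\<delta>. \<delta> > 0 \<Longrightarrow> eventually (Good \<kappa> \<delta>) sequentially"
    by blast
  have near: "\<exists>ts\<in>{t0..t1}. \<forall>t\<in>{t0..t1}. \<bar>t - ts\<bar> \<le> \<kappa> \<longrightarrow> (\<exists>x. (\<forall>j. x j \<in> E j) \<and> \<bar>\<sigma> * column_det x - t\<bar> < \<delta>)" if \<delta>: "\<delta> > 0" for \<delta>
  proof -
    obtain n where "Good \<kappa> \<delta> n"
      using ev[OF \<delta>] by (auto simp: eventually_sequentially)
    note n = this[unfolded Good_def, THEN spec, THEN spec, THEN spec, THEN spec, THEN spec, THEN spec, THEN mp, THEN mp, THEN mp, THEN mp]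
    define h where "h = 1 / (2::real) ^ n"
    have h: "0 < h" "h \<le> 1" by (auto simp: h_def)
    obtain F w where "\<And>j. Q j (c0 j) h (F j) (w j)" using c0(2)[OF h(1)] by metis
    then have F: "\<And>j. finite (F j)" "\<And>j. F j \<subseteq> E j" and w: "\<And>j x. (0::real) \<le> w j x" "\<And>j. c0 j \<le> sum (w j) (F j)"
      and frost: "\<And>j p \<rho>. h \<le> \<rho> \<Longrightarrow> (\<Sum>y\<in>{y\<in>F j. dist p y \<le> \<rho>}. w j y) \<le> (2 * \<rho>) powr s"
      unfolding Q_def by blast+
    have frost1: "(\<Sum>y\<in>{y\<in>F j. dist p y \<le> \<rho>}. w j y) \<le> C1 * \<rho> powr s" if "h \<le> \<rho>" for j p \<rho>
      using frost[OF that, of j p] that h by (simp add: C1_def powr_mult)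
    have total: "sum (w j) (F j) \<le> T" for j
    proof -
      have "sum (w j) (F j) = (\<Sum>y\<in>{y\<in>F j. dist 0 y \<le> B1}. w j y)"
        using B1(2) F(2) by (intro sum.cong) auto
      also have "\<dots> \<le> T" unfolding T_def using h B1 by (intro frost1) auto
      finally show ?thesis .
    qed
    let ?Om = "PiE ?I F" and ?N = "\<lambda>x. \<Prod>j\<in>?I. w j (x j)" and ?v = "\<lambda>x. \<sigma> *\<^sub>R cofactor_vector x k"
    have massN: "sum ?N ?Om = (\<Prod>j\<in>?I. sum (w j) (F j))"
      using F by (intro prod_sum_PiE[symmetric]) auto
    have OmE: "x j \<in> E j" if "x \<in> ?Om" "j \<noteq> k" for x j using that F(2) by (auto simp: PiE_iff)
    have val: "?v x \<bullet> y = \<sigma> * column_det (x(k := y))" for x y by (simp add: column_det_eq_inner)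
    have dist\<sigma>: "dist p (?v x) = dist (\<sigma> *\<^sub>R p) (cofactor_vector x k)" for p x
    proof -
      have "\<sigma> * \<sigma> = 1" using \<sigma> by (metis abs_mult_self_eq mult_1)
      then have "\<sigma> *\<^sub>R (p - ?v x) = \<sigma> *\<^sub>R p - cofactor_vector x k" by (simp add: scaleR_diff_right)
      then have "dist (\<sigma> *\<^sub>R p) (cofactor_vector x k) = \<bar>\<sigma>\<bar> * dist p (?v x)" by (metis dist_norm norm_scaleR)
      then show ?thesis using \<sigma> by simp
    qed
    have range: "?v x \<bullet> y \<in> {t0..t1}" if "x \<in> ?Om" "y \<in> E k" for x y
      unfolding val using that OmE by (intro vals) auto
    \<comment> \<open>J = 2^n makes the grid of dilations exactly as fine as the scale h.\<close>
    have "bilinear_config (F k) (w k) ?Om ?N ?v s \<alpha> C B t0 t1 (1 / 2 ^ n) Kd gp (2 ^ n)"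
    proof
      show "finite (F k)" "finite ?Om" using F by (auto intro!: finite_PiE)
      show "0 \<le> w k y" for y by (rule w)
      show "0 \<le> ?N \<omega>" for \<omega> by (intro prod_nonneg w)
      show "sum (w k) (F k) \<le> C" using total[of k] C by simp
      have "(\<Prod>j\<in>?I. sum (w j) (F j)) \<le> (\<Prod>j\<in>?I. T)" using total w by (intro prod_mono) (auto intro: sum_nonneg)
      then show "sum ?N ?Om \<le> C" unfolding massN using C(3) by simp
      fix p \<rho> assume "1 / 2 ^ n \<le> (\<rho>::real)"
      then have \<rho>: "h \<le> \<rho>" by (simp add: h_def)
      have "(\<Sum>y\<in>{y\<in>F k. dist p y \<le> \<rho>}. w k y) \<le> C1 * \<rho> powr s" by (rule frost1[OF \<rho>])
      also have "\<dots> \<le> C * \<rho> powr s" using C by (intro mult_right_mono) auto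
      finally show "(\<Sum>y\<in>{y\<in>F k. dist p y \<le> \<rho>}. w k y) \<le> C * \<rho> powr s" .
      have "(\<Sum>x\<in>{x\<in>?Om. dist p (?v x) \<le> \<rho>}. ?N x) \<le> Kc * \<rho> powr \<alpha>"
        unfolding dist\<sigma> Kc_def \<alpha>_def
      proof (rule cofactor_frostman[where zk = "z k" and h = h])
        show "norm y \<le> B1" if "y \<in> F j" for j y using that F(2) B1(2) by blast
        show "t0 \<le> \<bar>column_det x\<bar>" if "\<And>j. j \<noteq> k \<Longrightarrow> x j \<in> F j" "x k = z k" for x
        proof -
          have "x j \<in> E j" for j using that F(2) zk by (cases "j = k") auto
          then have "t0 \<le> \<sigma> * column_det x" using vals[of x] by auto
          also have "\<dots> \<le> \<bar>\<sigma> * column_det x\<bar>" by simp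
          finally show ?thesis using \<sigma> by (simp add: abs_mult)
        qed
      qed (use F w frost1 zk B1 t01 C1 h s1 \<rho> card in \<open>auto simp: subset_iff\<close>)
      also have "\<dots> \<le> C * \<rho> powr \<alpha>" using C by (intro mult_right_mono) auto
      finally show "(\<Sum>x\<in>{x\<in>?Om. dist p (?v x) \<le> \<rho>}. ?N x) \<le> C * \<rho> powr \<alpha>" .
    next
      show "norm y \<le> B" if "y \<in> F k" for y using that F(2)[of k] B1(2)[of y k] B by auto
      show "norm (?v x) \<le> B" if "x \<in> ?Om" for x
      proof -
        have "norm (cofactor_vector x k) \<le> real ?d * (fact ?d * B1 ^ ?d)"
          using OmE[OF that] B1 by (intro norm_cofactor_vector_le) blast+
        then show ?thesis using B(2) \<sigma> by simp
      qed
    qed (use t01 spos \<alpha> in \<open>auto simp: Kd_def gp_def\<close>)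
    then have "\<exists>ts\<in>{t0..t1}. \<forall>t\<in>{t0..t1}. \<bar>t - ts\<bar> \<le> \<kappa> \<longrightarrow> (\<exists>x\<in>?Om. \<exists>y\<in>F k. \<bar>?v x \<bullet> y - t\<bar> < \<delta>)"
    proof (rule n)
      show "c \<le> sum (w k) (F k)" using w(2)[of k] by (simp add: c_def)
      have "(\<Prod>j\<in>?I. c0 j) \<le> (\<Prod>j\<in>?I. sum (w j) (F j))" using w(2) c0(1) by (intro prod_mono) (auto intro: less_imp_le)
      then show "c \<le> sum ?N ?Om" unfolding massN by (simp add: c_def)
      show "\<forall>x\<in>?Om. \<forall>y\<in>F k. ?v x \<bullet> y \<in> {t0..t1}" using range F(2)[of k] by blast
    qed
    then obtain ts where ts: "ts \<in> {t0..t1}" "\<And>t. t \<in> {t0..t1} \<Longrightarrow> \<bar>t - ts\<bar> \<le> \<kappa> \<Longrightarrow> \<exists>x\<in>?Om. \<exists>y\<in>F k. \<bar>?v x \<bullet> y - t\<bar> < \<delta>"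
      by blast
    show ?thesis
    proof (intro bexI[OF _ ts(1)] ballI impI)
      fix t assume "t \<in> {t0..t1}" "\<bar>t - ts\<bar> \<le> \<kappa>"
      then obtain x y where xy: "x \<in> ?Om" "y \<in> F k" "\<bar>?v x \<bullet> y - t\<bar> < \<delta>" using ts(2) by blast
      then have "\<forall>j. (x(k := y)) j \<in> E j" using OmE[OF xy(1)] F(2)[of k] by auto
      then show "\<exists>x. (\<forall>j. x j \<in> E j) \<and> \<bar>\<sigma> * column_det x - t\<bar> < \<delta>" using xy(3) unfolding val by blast
    qed
  qed
  have "\<exists>ts. \<forall>n. ts n \<in> {t0..t1} \<and> (\<forall>t\<in>{t0..t1}. \<bar>t - ts n\<bar> \<le> \<kappa> \<longrightarrow> (\<exists>x. (\<forall>j. x j \<in> E j) \<and> \<bar>\<sigma> * column_det x - t\<bar> < inverse (real (Suc n))))"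
    by (intro choice allI) (use near in \<open>simp add: Bex_def\<close>)
  then obtain ts where ts: "\<And>n. ts n \<in> {t0..t1}"
    "\<And>n t. t \<in> {t0..t1} \<Longrightarrow> \<bar>t - ts n\<bar> \<le> \<kappa> \<Longrightarrow> \<exists>x. (\<forall>j. x j \<in> E j) \<and> \<bar>\<sigma> * column_det x - t\<bar> < inverse (real (Suc n))"
    by blast
  \<comment> \<open>The centres \<open>ts n\<close> are uncontrolled points of a compact interval.
    Along a subsequence they converge to l, and every t closer to l than \<open>\<kappa>\<close>
    eventually lies in the good intervals.\<close>
  obtain l f where l: "l \<in> {t0..t1}" "strict_mono f" "(ts \<circ> f) \<longlonglongrightarrow> l"
    using ts(1) compact_Icc[of t0 t1] unfolding compact_def by metis
  define V where "V = (\<lambda>u. \<sigma> * u) ` {column_det x | x. \<forall>j. x j \<in> E j}"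
  have "compact V" unfolding V_def by (intro compact_continuous_image compact_column_det_values E continuous_intros)
  then have V: "closed V" by (rule compact_imp_closed)
  have inV: "t \<in> V" if t: "t \<in> {t0..t1}" "\<bar>t - l\<bar> < \<kappa>" for t
  proof -
    have "t \<in> closure V"
      unfolding closure_approachable
    proof (intro allI impI)
      fix e :: real assume e: "e > 0"
      have "eventually (\<lambda>n. dist ((ts \<circ> f) n) l < \<kappa> - \<bar>t - l\<bar>) sequentially"
        using tendstoD[OF l(3), of "\<kappa> - \<bar>t - l\<bar>"] t(2) by simp
      moreover have "eventually (\<lambda>n. inverse (real (Suc n)) < e) sequentially"
        using LIMSEQ_inverse_real_of_nat e by (rule order_tendstoD)
      ultimately have "eventually (\<lambda>n. dist ((ts \<circ> f) n) l < \<kappa> - \<bar>t - l\<bar> \<and> inverse (real (Suc n)) < e) sequentially"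
        by eventually_elim auto
      then obtain n where n: "dist ((ts \<circ> f) n) l < \<kappa> - \<bar>t - l\<bar>" "inverse (real (Suc n)) < e"
        by (auto simp: eventually_sequentially)
      then have "\<bar>t - ts (f n)\<bar> \<le> \<kappa>" by (simp add: dist_real_def)
      then obtain x where x: "\<forall>j. x j \<in> E j" "\<bar>\<sigma> * column_det x - t\<bar> < inverse (real (Suc (f n)))"
        using ts(2)[OF t(1), of "f n"] by blast
      have "inverse (real (Suc (f n))) \<le> inverse (real (Suc n))"
        using strict_mono_imp_increasing[OF l(2), of n] by (intro le_imp_inverse_le) auto
      then have "dist (\<sigma> * column_det x) t < e" using x(2) n(2) unfolding dist_real_def by linarith
      moreover have "\<sigma> * column_det x \<in> V" using x(1) by (auto simp: V_def)
      ultimately show "\<exists>y\<in>V. dist y t < e" by blast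
    qed
    then show ?thesis using V by simp
  qed
  \<comment> \<open>The limit centre may be an endpoint of [t0, t1]; cutting its neighbourhood to
    this interval still leaves a nondegenerate piece.\<close>
  define a where "a = max t0 (l - \<kappa>)"
  define b where "b = min t1 (l + \<kappa>)"
  have "a < b" using l(1) t01 \<kappa> by (auto simp: a_def b_def)
  moreover have "{a<..<b} \<subseteq> {\<bar>column_det x\<bar> | x. \<forall>j. x j \<in> K}"
  proof
    fix t assume t: "t \<in> {a<..<b}"
    then have "t \<in> V" by (intro inV) (auto simp: a_def b_def)
    then obtain x where x: "\<forall>j. x j \<in> E j" "t = \<sigma> * column_det x" by (auto simp: V_def)
    have "t > 0" using t t01 by (auto simp: a_def)
    then have "t = \<bar>column_det x\<bar>" using x(2) \<sigma> by (metis abs_mult abs_of_pos mult_1)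
    then show "t \<in> {\<bar>column_det x\<bar> | x. \<forall>j. x j \<in> K}" using x(1) by (auto simp: E_def)
  qed
  ultimately show ?thesis by blast
qed

theorem theorem1p2:
  fixes E :: "(real ^ 'n) set" and x0 :: "real ^ 'n"
  assumes "CARD('n) \<ge> 3"
    and "compact E"
    and "hausdorff_dim E > real CARD('n) - 1 + 1 / real CARD('n)"
  shows "interior {\<bar>det (\<chi> i j. (x j - x0) $ i)\<bar> | x :: 'n \<Rightarrow> real ^ 'n. \<forall>j. x j \<in> E} \<noteq> {}"
proof -
  obtain s where s: "real CARD('n) - 1 + 1 / real CARD('n) < s" "s < hausdorff_dim E"
    using assms(3) dense by blast
  have "0 < real CARD('n) - 1 + 1 / real CARD('n)" using assms(1) by (intro add_pos_pos) auto
  then have "s > 0" using s by linarith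
  let ?K = "(\<lambda>x. x - x0) ` E"
  have "compact ?K" using assms(2) by (intro compact_continuous_image continuous_intros)
  moreover have "\<not> content_null s ?K"
    using not_content_null_if_less_hausdorff_dim[OF \<open>s > 0\<close> s(2)] content_null_translation by blast
  ultimately obtain a b where ab: "a < b" "{a<..<b} \<subseteq> {\<bar>column_det x\<bar> | x. \<forall>j. x j \<in> ?K}"
    using column_det_values_interior[of ?K s] assms(1) s by auto
  have "{\<bar>column_det x\<bar> | x. \<forall>j. x j \<in> ?K} \<subseteq> {\<bar>det (\<chi> i j. (x j - x0) $ i)\<bar> | x :: 'n \<Rightarrow> real ^ 'n. \<forall>j. x j \<in> E}"
  proof
    fix t assume "t \<in> {\<bar>column_det x\<bar> | x. \<forall>j. x j \<in> ?K}"
    then obtain x where x: "t = \<bar>column_det x\<bar>" "\<forall>j. x j \<in> ?K" by auto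
    then have "\<forall>j. x j + x0 \<in> E" by (auto simp: image_iff algebra_simps)
    then show "t \<in> {\<bar>det (\<chi> i j. (x j - x0) $ i)\<bar> | x :: 'n \<Rightarrow> real ^ 'n. \<forall>j. x j \<in> E}"
      using x(1) unfolding column_det_def by (intro CollectI exI[of _ "\<lambda>j. x j + x0"]) simp
  qed
  with ab have "{a<..<b} \<subseteq> interior {\<bar>det (\<chi> i j. (x j - x0) $ i)\<bar> | x :: 'n \<Rightarrow> real ^ 'n. \<forall>j. x j \<in> E}"
    by (intro interior_maximal) auto
  moreover have "(a + b) / 2 \<in> {a<..<b}" using ab(1) by auto
  ultimately show ?thesis by blast
qed

end
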